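(* Let $d\ge 1$, let $2<b\le\infty$ and $\psi\in\Psi(b)$, and let $\Phi=\Phi(x_1,\dots,x_d;t)$, $t\in T$, be a non-trivial measurable real-valued kernel, symmetric in $x_1,\dots,x_d\in X$, of constant (in $t$) rank $r$, with $\mathbf{E}\,\Phi(t)=0$ for all $t\in T$ and $$\sup_{t\in T}\|\Phi(t)\|_{G\psi}<\infty .$$ Let $w(t,s)=\|\Phi(t)-\Phi(s)\|_{G\psi}$ and $\tau(p)=\left[\frac{p}{\ln p}\right]^d\psi(p)$ for $2\le p<b$. Let $$\phi_n(t)=n^{r/2}\,\bigl(U_n(t)-\mathbf{E}U_n(t)\bigr),\qquad n>d,$$ be the centered and normed deviations of the $U$-statistics $U_n(t)$ with kernel $\Phi(\cdot;t)$. Suppose in addition that $$K=K(w,\tau):=\int_0^1\exp\bigl\{v_\tau\bigl(H(T,w,\epsilon)\bigr)\bigr\}\,d\epsilon<\infty .$$ Then the family of distributions generated in the space $C(T,w)$ by the $w$-continuous with probability one random fields $\phi_n(\cdot)$ is weakly compact, and in addition $$\sup_n\Bigl\|\sup_{t\in T}|\phi_n(t)|\Bigr\|_{G\tau}\le C\bigl(w,\tau,K,\mathrm{diam}_w(T)\bigr)<\infty ,$$ with the corresponding tail estimate $$\sup_n T_{\sup_{t}|\phi_n(t)|}(y)\le\exp\Bigl\{-\nu_\tau^*\Bigl[\ln\bigl(y/C_2(w,\tau,K,\mathrm{diam}_w(T))\bigr)\Bigr]\Bigr\},\qquad y>C_2\,e ,$$ where $C_2=C_2(w,\tau,K,\mathrm{diam}_w(T))$.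 Here $C$ and $C_2$ are finite constants determined by the displayed arguments: the semi-distance $w$, the function $\tau$, the value $K$ of the entropy integral, and the diameter $\mathrm{diam}_w(T)$.
   Context: Probability space and $U$-statistics. $(\Omega,F,\mathbf{P})$ is a probability space; $\xi(1),\xi(2),\dots$ are independent identically distributed random variables with values in a measurable space $(X,S)$. For $t\in T$ put $\Phi(t):=\Phi(\xi(1),\dots,\xi(d);t)$ and, for $n>d$, $$U_n(t)=\binom{n}{d}^{-1}\sum_{1\le i_1<i_2<\dots<i_d\le n}\Phi(\xi(i_1),\dots,\xi(i_d);t).$$ The rank of the kernel $\Phi(\cdot;t)$ is the usual (Hoeffding) rank, i.e. the smallest $c\in\{1,\dots,d\}$ for which $g_c(x_1,\dots,x_c)=\mathbf{E}\,\Phi(x_1,\dots,x_c,\xi(c+1),\dots,\xi(d);t)-\mathbf{E}\,\Phi(t)$ satisfies $\mathrm{Var}\,g_c(\xi(1),\dots,\xi(c))>0$. Thus $\mathrm{Var}(U_n(t))\asymp n^{-r}$ as $n\to\infty$ when the rank is $r$. It is assumed that the rank $r$ does not depend on $t$. The suprema over $n$ are over $n>d$. Grand Lebesgue spaces. For a random variable $\eta$ and $p\ge1$, $|\eta|_p=[\mathbf{E}|\eta|^p]^{1/p}$. For $2<b\le\infty$, $\Psi(b)$ is the set of functions $\psi$, continuous on $[2,b)$ and bounded from below by a positive constant, with $b=\sup\{p:\psi(p)<\infty\}$ (so the set where $\psi$ is finite is $[2,b)$ or $[2,b]$). For $\psi\in\Psi(b)$, $$\|\zeta\|_{G\psi}=\sup_{p\in(2,b)}\frac{|\zeta|_p}{\psi(p)}.$$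 The same definition applies with $\tau$ in place of $\psi$ (one has $\tau\in\Psi(b)$). Auxiliary functions. $\nu_\tau(p)=p\ln\tau(p)$ for $2\le p<b$, and $\nu_\tau(p)=\infty$ for $p<2$ or $p>b$; $\nu_\tau^*(y)=\sup_x\,(xy-\nu_\tau(x))$ is its Young–Fenchel (Legendre) transform; $v_\tau(x)=\inf_{p\in(2,b)}\left(\frac{x}{p}+\ln\tau(p)\right)$. Tail function. $T_\eta(x)=\max(\mathbf{P}(\eta>x),\mathbf{P}(\eta<-x))$ for $x>0$. Metric and entropy. $w$ is a bounded semi-distance on $T$, with $\mathrm{diam}_w(T)=\sup_{t,s\in T}w(t,s)<\infty$; $T$ is assumed compact with respect to $w$, and $C(T,w)$ is the space of real-valued $w$-continuous functions on $T$ with the uniform norm. $H(T,w,\epsilon)=\ln N(T,w,\epsilon)$, where $N(T,w,\epsilon)$ is the minimal number of closed $w$-balls $\{s\in T:w(t,s)\le\epsilon\}$, $t\in T$, covering $T$. The random fields considered are assumed separable. A family of distributions on $C(T,w)$ is called weakly compact if it is relatively compact for weak convergence of probability measures (Prokhorov sense).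
   Formalization: For fixed d, b and ψ, the constants C and C_2 also depend on sup_t ‖Φ(t)‖_{Gψ}; without this the claim fails, e.g. for one-point T, where scaling Φ by λ changes the norm of sup_t|φ_n| but not w, τ, K or diam_w(T). *)

theory Defs
  imports "HOL-Probability.Probability"
begin

section \<open>Grand Lebesgue spaces\<close>

text \<open>
  The function \<open>\<psi>\<close> is extended-valued because the interval of finiteness is part of the
  definition of \<open>\<Psi>(b)\<close>; its values at arguments below 2 play no role.
\<close>

definition dom2 :: "ereal \<Rightarrow> real set" where
  "dom2 b = {p. 2 \<le> p \<and> ereal p < b}"

definition Psi :: "ereal \<Rightarrow> (real \<Rightarrow> ennreal) set" where
  "Psi b = {\<psi>. (\<forall>p\<in>dom2 b. \<psi> p < \<infinity>) \<and> continuous_on (dom2 b) \<psi> \<and>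
              (\<exists>c>0. \<forall>p\<ge>2. c \<le> \<psi> p) \<and>
              (SUP p\<in>{p. 2 \<le> p \<and> \<psi> p < \<infinity>}. ereal p) = b}"

definition Lp_norm :: "'a measure \<Rightarrow> real \<Rightarrow> ('a \<Rightarrow> real) \<Rightarrow> ennreal" where
  "Lp_norm M p \<eta> =
     (if integrable M (\<lambda>\<omega>. \<bar>\<eta> \<omega>\<bar> powr p)
      then ennreal ((\<integral>\<omega>. \<bar>\<eta> \<omega>\<bar> powr p \<partial>M) powr (1 / p)) else \<infinity>)"

definition gls_norm :: "'a measure \<Rightarrow> ereal \<Rightarrow> (real \<Rightarrow> ennreal) \<Rightarrow> ('a \<Rightarrow> real) \<Rightarrow> ennreal" where
  "gls_norm M b \<psi> \<zeta> = (SUP p\<in>{p. 2 < p \<and> ereal p < b}. Lp_norm M p \<zeta> / \<psi> p)"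

definition tau :: "nat \<Rightarrow> ereal \<Rightarrow> (real \<Rightarrow> ennreal) \<Rightarrow> real \<Rightarrow> ennreal" where
  "tau d b \<psi> p = (if p \<in> dom2 b then ennreal ((p / ln p) ^ d) * \<psi> p else \<infinity>)"

text \<open>
  The right endpoint \<open>p = b\<close> gets the value \<open>\<infinity>\<close>, since \<open>\<tau>\<close> is only given for \<open>2 \<le> p < b\<close>.
\<close>

definition nu :: "ereal \<Rightarrow> (real \<Rightarrow> ennreal) \<Rightarrow> real \<Rightarrow> ereal" where
  "nu b \<tau> p = (if p \<in> dom2 b then ereal (p * ln (enn2real (\<tau> p))) else \<infinity>)"

definition young_fenchel :: "(real \<Rightarrow> ereal) \<Rightarrow> real \<Rightarrow> ereal" where
  "young_fenchel f y = (SUP x. ereal (x * y) - f x)"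

definition v_fun :: "ereal \<Rightarrow> (real \<Rightarrow> ennreal) \<Rightarrow> real \<Rightarrow> real" where
  "v_fun b \<tau> x = (INF p\<in>{p. 2 < p \<and> ereal p < b}. x / p + ln (enn2real (\<tau> p)))"

definition exp_ereal :: "ereal \<Rightarrow> ereal" where
  "exp_ereal x = (case x of ereal r \<Rightarrow> ereal (exp r) | PInfty \<Rightarrow> \<infinity> | MInfty \<Rightarrow> 0)"

definition tail :: "'a measure \<Rightarrow> ('a \<Rightarrow> real) \<Rightarrow> real \<Rightarrow> real" where
  "tail M \<eta> x = max (measure M {\<omega>\<in>space M. \<eta> \<omega> > x}) (measure M {\<omega>\<in>space M. \<eta> \<omega> < - x})"


section \<open>Semi-distances and entropy\<close>

text \<open>
  The index set \<open>T\<close> is the universe of a type \<open>'t\<close>.  The library's metric spaces require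
  distinct points to have positive distance, so the topology of a semi-distance is
  introduced directly.
\<close>

definition semi_topology :: "('t \<Rightarrow> 't \<Rightarrow> real) \<Rightarrow> 't topology" where
  "semi_topology w = topology (\<lambda>U. \<forall>x\<in>U. \<exists>e>0. \<forall>y. w x y < e \<longrightarrow> y \<in> U)"

lemma openin_semi_topology:
  "openin (semi_topology w) U \<longleftrightarrow> (\<forall>x\<in>U. \<exists>e>0. \<forall>y. w x y < e \<longrightarrow> y \<in> U)"
proof -
  have "istopology (\<lambda>U. \<forall>x\<in>U. \<exists>e>0. \<forall>y. w x y < e \<longrightarrow> y \<in> U)"
    unfolding istopology_def
  proof (intro conjI allI impI ballI)
    fix S U x
    assume S: "\<forall>x\<in>S. \<exists>e>0. \<forall>y. w x y < e \<longrightarrow> y \<in> S"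
      and U: "\<forall>x\<in>U. \<exists>e>0. \<forall>y. w x y < e \<longrightarrow> y \<in> U" and x: "x \<in> S \<inter> U"
    from S x obtain e1 where e1: "e1 > 0" "\<forall>y. w x y < e1 \<longrightarrow> y \<in> S" by blast
    from U x obtain e2 where e2: "e2 > 0" "\<forall>y. w x y < e2 \<longrightarrow> y \<in> U" by blast
    show "\<exists>e>0. \<forall>y. w x y < e \<longrightarrow> y \<in> S \<inter> U"
      using e1 e2 by (intro exI[of _ "min e1 e2"]) auto
  next
    fix \<K> x
    assume "\<forall>K\<in>\<K>. \<forall>x\<in>K. \<exists>e>0. \<forall>y. w x y < e \<longrightarrow> y \<in> K" and "x \<in> \<Union>\<K>"
    then show "\<exists>e>0. \<forall>y. w x y < e \<longrightarrow> y \<in> \<Union>\<K>" by (meson UnionE UnionI)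
  qed
  then show ?thesis
    by (simp add: semi_topology_def topology_inverse')
qed

lemma topspace_semi_topology [simp]: "topspace (semi_topology w) = UNIV"
proof -
  have "openin (semi_topology w) UNIV"
    by (auto simp: openin_semi_topology intro: exI[of _ "1::real"])
  then show ?thesis
    using openin_subset by blast
qed

definition diam :: "('t \<Rightarrow> 't \<Rightarrow> real) \<Rightarrow> real" where
  "diam w = (SUP (t, s)\<in>UNIV. w t s)"

definition covering_number :: "('t \<Rightarrow> 't \<Rightarrow> real) \<Rightarrow> real \<Rightarrow> nat" where
  "covering_number w \<epsilon> =
     (LEAST n. \<exists>A. finite A \<and> card A = n \<and> (\<forall>s. \<exists>t\<in>A. w t s \<le> \<epsilon>))"

definition entropy :: "('t \<Rightarrow> 't \<Rightarrow> real) \<Rightarrow> real \<Rightarrow> real" where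
  "entropy w \<epsilon> = ln (real (covering_number w \<epsilon>))"

definition entropy_integral :: "ereal \<Rightarrow> (real \<Rightarrow> ennreal) \<Rightarrow> ('t \<Rightarrow> 't \<Rightarrow> real) \<Rightarrow> ennreal" where
  "entropy_integral b \<tau> w =
     (\<integral>\<^sup>+\<epsilon>\<in>{0<..1}. ennreal (exp (v_fun b \<tau> (entropy w \<epsilon>))) \<partial>lborel)"


section \<open>U-statistics\<close>

text \<open>
  Observations are indexed by \<open>1, 2, \<dots>\<close>, and a \<open>d\<close>-tuple of points of \<open>X\<close> is an element of
  the product space over the index set \<open>{1..d}\<close>.
\<close>

definition iid_sequence :: "'a measure \<Rightarrow> 'x measure \<Rightarrow> (nat \<Rightarrow> 'a \<Rightarrow> 'x) \<Rightarrow> bool" where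
  "iid_sequence M S \<xi> \<longleftrightarrow> prob_space.indep_vars M (\<lambda>_. S) \<xi> {1..} \<and>
     (\<forall>i\<ge>1. distr M S (\<xi> i) = distr M S (\<xi> 1))"

definition measurable_symmetric_kernel ::
  "nat \<Rightarrow> 'x measure \<Rightarrow> ((nat \<Rightarrow> 'x) \<Rightarrow> real) \<Rightarrow> bool" where
  "measurable_symmetric_kernel d S f \<longleftrightarrow>
     f \<in> borel_measurable (PiM {1..d} (\<lambda>_. S)) \<and>
     (\<forall>\<pi> x. \<pi> permutes {1..d} \<longrightarrow> x \<in> space (PiM {1..d} (\<lambda>_. S)) \<longrightarrow> f (x \<circ> \<pi>) = f x)"

definition kernel_var :: "(nat \<Rightarrow> 'a \<Rightarrow> 'x) \<Rightarrow> nat \<Rightarrow> ((nat \<Rightarrow> 'x) \<Rightarrow> real) \<Rightarrow> 'a \<Rightarrow> real" where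
  "kernel_var \<xi> d f \<omega> = f (\<lambda>k\<in>{1..d}. \<xi> k \<omega>)"

definition var_of :: "'a measure \<Rightarrow> ('a \<Rightarrow> real) \<Rightarrow> real" where
  "var_of M \<eta> = (\<integral>\<omega>. (\<eta> \<omega> - (\<integral>\<omega>'. \<eta> \<omega>' \<partial>M))\<^sup>2 \<partial>M)"

definition kernel_projection ::
  "'a measure \<Rightarrow> (nat \<Rightarrow> 'a \<Rightarrow> 'x) \<Rightarrow> nat \<Rightarrow> ((nat \<Rightarrow> 'x) \<Rightarrow> real) \<Rightarrow> nat \<Rightarrow> (nat \<Rightarrow> 'x) \<Rightarrow> real" where
  "kernel_projection M \<xi> d f c x =
     (\<integral>\<omega>. f (\<lambda>k\<in>{1..d}. if k \<le> c then x k else \<xi> k \<omega>) \<partial>M) - (\<integral>\<omega>. kernel_var \<xi> d f \<omega> \<partial>M)"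

definition hoeffding_rank ::
  "'a measure \<Rightarrow> (nat \<Rightarrow> 'a \<Rightarrow> 'x) \<Rightarrow> nat \<Rightarrow> ((nat \<Rightarrow> 'x) \<Rightarrow> real) \<Rightarrow> nat" where
  "hoeffding_rank M \<xi> d f =
     (LEAST c. c \<in> {1..d} \<and> 0 < var_of M (\<lambda>\<omega>. kernel_projection M \<xi> d f c (\<lambda>k. \<xi> k \<omega>)))"

definition index_tuples :: "nat \<Rightarrow> nat \<Rightarrow> (nat \<Rightarrow> nat) set" where
  "index_tuples d n = {i \<in> {1..d} \<rightarrow>\<^sub>E {1..n}. strict_mono_on {1..d} i}"

definition U_stat :: "(nat \<Rightarrow> 'a \<Rightarrow> 'x) \<Rightarrow> nat \<Rightarrow> ((nat \<Rightarrow> 'x) \<Rightarrow> real) \<Rightarrow> nat \<Rightarrow> 'a \<Rightarrow> real" where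
  "U_stat \<xi> d f n \<omega> =
     (\<Sum>i\<in>index_tuples d n. f (\<lambda>k\<in>{1..d}. \<xi> (i k) \<omega>)) / real (n choose d)"

definition normed_deviation ::
  "'a measure \<Rightarrow> (nat \<Rightarrow> 'a \<Rightarrow> 'x) \<Rightarrow> nat \<Rightarrow> ((nat \<Rightarrow> 'x) \<Rightarrow> 't \<Rightarrow> real) \<Rightarrow> nat \<Rightarrow> nat \<Rightarrow> 'a \<Rightarrow> 't \<Rightarrow> real"
  where
  "normed_deviation M \<xi> d \<Phi> r n \<omega> t =
     real n powr (real r / 2) *
       (U_stat \<xi> d (\<lambda>x. \<Phi> x t) n \<omega> - (\<integral>\<omega>'. U_stat \<xi> d (\<lambda>x. \<Phi> x t) n \<omega>' \<partial>M))"

definition kernel_dist ::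
  "'a measure \<Rightarrow> (nat \<Rightarrow> 'a \<Rightarrow> 'x) \<Rightarrow> nat \<Rightarrow> ereal \<Rightarrow> (real \<Rightarrow> ennreal) \<Rightarrow>
   ((nat \<Rightarrow> 'x) \<Rightarrow> 't \<Rightarrow> real) \<Rightarrow> 't \<Rightarrow> 't \<Rightarrow> real" where
  "kernel_dist M \<xi> d b \<psi> \<Phi> t s =
     enn2real (gls_norm M b \<psi>
       (\<lambda>\<omega>. kernel_var \<xi> d (\<lambda>x. \<Phi> x t) \<omega> - kernel_var \<xi> d (\<lambda>x. \<Phi> x s) \<omega>))"


section \<open>Random fields and their laws on \<open>C(T,w)\<close>\<close>

text \<open>Separability in the sense of Doob, with a countable separant \<open>D\<close>.\<close>

definition separable_field ::
  "'a measure \<Rightarrow> ('t \<Rightarrow> 't \<Rightarrow> real) \<Rightarrow> ('a \<Rightarrow> 't \<Rightarrow> real) \<Rightarrow> bool" where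
  "separable_field M w X \<longleftrightarrow>
     (\<exists>D. countable D \<and>
        (AE \<omega> in M. \<forall>t. \<forall>\<epsilon>>0. \<exists>s\<in>D. w t s < \<epsilon> \<and> \<bar>X \<omega> t - X \<omega> s\<bar> < \<epsilon>))"

definition C_space :: "('t \<Rightarrow> 't \<Rightarrow> real) \<Rightarrow> ('t \<Rightarrow> real) topology" where
  "C_space w = mtopology_of (cfunspace (semi_topology w) euclidean_metric)"

definition borel_on :: "'s topology \<Rightarrow> 's measure" where
  "borel_on X = sigma (topspace X) {U. openin X U}"

text \<open>
  The paths of a field may fail to be continuous on a null set, on which they are
  replaced by the zero function.  As \<open>T\<close> may be uncountable, this path map (and the supremum
  of the field) need only be measurable with respect to the completion of the probability space.
\<close>

definition path_map ::
  "('t \<Rightarrow> 't \<Rightarrow> real) \<Rightarrow> ('a \<Rightarrow> 't \<Rightarrow> real) \<Rightarrow> 'a \<Rightarrow> 't \<Rightarrow> real" where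
  "path_map w X \<omega> =
     (if continuous_map (semi_topology w) euclideanreal (X \<omega>) then X \<omega> else (\<lambda>_. 0))"

definition law_on_C ::
  "'a measure \<Rightarrow> ('t \<Rightarrow> 't \<Rightarrow> real) \<Rightarrow> ('a \<Rightarrow> 't \<Rightarrow> real) \<Rightarrow> ('t \<Rightarrow> real) measure" where
  "law_on_C M w X = distr (completion M) (borel_on (C_space w)) (path_map w X)"

definition weakly_convergent_to ::
  "'s topology \<Rightarrow> (nat \<Rightarrow> 's measure) \<Rightarrow> 's measure \<Rightarrow> bool" where
  "weakly_convergent_to X \<mu> \<nu> \<longleftrightarrow>
     (\<forall>f. continuous_map X euclideanreal f \<longrightarrow> bounded (f ` topspace X) \<longrightarrow>
        (\<lambda>n. \<integral>x. f x \<partial>\<mu> n) \<longlonglongrightarrow> (\<integral>x. f x \<partial>\<nu>))"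

text \<open>
  Relative compactness of a family of Borel probability measures: every sequence in the
  family has a subsequence converging weakly to some Borel probability measure.
\<close>

definition weakly_compact_family :: "'s topology \<Rightarrow> 's measure set \<Rightarrow> bool" where
  "weakly_compact_family X F \<longleftrightarrow>
     (\<forall>\<mu>\<in>F. prob_space \<mu> \<and> sets \<mu> = sets (borel_on X)) \<and>
     (\<forall>\<mu>. range \<mu> \<subseteq> F \<longrightarrow>
        (\<exists>\<nu> k. prob_space \<nu> \<and> sets \<nu> = sets (borel_on X) \<and> strict_mono (k :: nat \<Rightarrow> nat) \<and>
           weakly_convergent_to X (\<mu> \<circ> k) \<nu>))"

text \<open>
  A real supremum: it is meaningful at those \<open>\<omega>\<close> whose path is bounded, hence almost surely
  for fields with continuous paths on a compact index set.
\<close>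

definition sup_field :: "('a \<Rightarrow> 't \<Rightarrow> real) \<Rightarrow> 'a \<Rightarrow> real" where
  "sup_field X \<omega> = (SUP t. \<bar>X \<omega> t\<bar>)"

end

theory Submission
  imports Defs
begin

text \<open>
  A degenerate sum over \<open>i 1 < \<dots> < i d\<close> is, up to sums of lower order, a martingale in its
  largest index. The 2-smoothness of \<open>L p\<close>, with constant of order \<open>p\<close>, and induction on \<open>d\<close>
  bound the \<open>L p\<close> norm of the normed deviation of a \<open>U\<close>-statistic by a constant times
  \<open>p powr (d / 2)\<close> times that of its kernel, uniformly in \<open>n\<close>; this suffices because
  \<open>sqrt p \<le> p / ln p\<close>. The increments of the kernel satisfy the same degeneracy, so the fields have
  increments controlled by \<open>w\<close>, and chaining along nets of radius \<open>(1 / 2) ^ k\<close> turns the entropy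
  condition into a moment bound for the supremum and a modulus of continuity, both uniform in \<open>n\<close>.
  The latter two give tightness in \<open>C(T,w)\<close>; the Chebyshev inequality, optimised over \<open>p\<close>, gives the tail.
\<close>

section \<open>Moment bounds\<close>

text \<open>Uniformity in \<open>n\<close> shapes the proof. Apart from the field itself, everything
  that chaining uses (the nets, the moduli, the entropy weights) is built from \<open>w\<close> and
  \<tau> alone, so its bounds pass to all \<open>n > d\<close> at once. The obstacle is that
  separability supplies only some countable set, unrelated to the nets, and that paths are not known
  to be continuous beforehand. A point is therefore attached to each level by a net point that its
  chains visit infinitely often, and nearness of two points is reduced to a relation between the
  finitely many points of one net. Each comparison then costs countably many null sets, and
  continuity comes out as a conclusion. The entropy condition yields, at each level, an exponent
  that suits that level only; exchanging it for a prescribed exponent \<open>q\<close> costs the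
  factor \<open>\<tau> q / lower\<close>, which is where the positive lower bound of \<psi> enters.
  The final constant collects this factor, \<open>(7 * d) ^ d\<close> from the moments of
  U-statistics, the norm of the kernel at level 0, and \<open>4 * K\<close> from the series of
  entropy weights.\<close>

definition Lp_le :: "'a measure \<Rightarrow> real \<Rightarrow> real \<Rightarrow> ('a \<Rightarrow> real) \<Rightarrow> bool" where
  "Lp_le M p a f \<longleftrightarrow> 0 \<le> a \<and> f \<in> borel_measurable M \<and>
     (\<integral>\<^sup>+\<omega>. ennreal (\<bar>f \<omega>\<bar> powr p) \<partial>M) \<le> ennreal (a powr p)"

lemma Lp_leD:
  assumes "Lp_le M p a f"
  shows "0 \<le> a" "f \<in> borel_measurable M"
    "(\<integral>\<^sup>+\<omega>. ennreal (\<bar>f \<omega>\<bar> powr p) \<partial>M) \<le> ennreal (a powr p)"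
  using assms by (auto simp: Lp_le_def)

lemma Lp_le_mono:
  assumes "Lp_le M p a f" "a \<le> b" "0 \<le> p"
  shows "Lp_le M p b f"
  using assms order_trans[OF Lp_leD(3)[OF assms(1)], of "ennreal (b powr p)"]
  by (auto simp: Lp_le_def intro!: ennreal_leI powr_mono2)

lemma Lp_le_cong_abs:
  assumes "Lp_le M p a f" "g \<in> borel_measurable M" "AE \<omega> in M. \<bar>g \<omega>\<bar> \<le> \<bar>f \<omega>\<bar>" "0 \<le> p"
  shows "Lp_le M p a g"
proof -
  have "(\<integral>\<^sup>+\<omega>. ennreal (\<bar>g \<omega>\<bar> powr p) \<partial>M) \<le> (\<integral>\<^sup>+\<omega>. ennreal (\<bar>f \<omega>\<bar> powr p) \<partial>M)"
    by (intro nn_integral_mono_AE) (use assms in \<open>auto elim!: eventually_mono intro!: ennreal_leI powr_mono2\<close>)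
  with assms show ?thesis
    by (auto simp: Lp_le_def)
qed

lemma Lp_le_zero: "Lp_le M p 0 (\<lambda>_. 0)"
  by (simp add: Lp_le_def)

lemma Lp_le_zeroD:
  assumes "Lp_le M p 0 f"
  shows "AE \<omega> in M. f \<omega> = 0"
proof -
  have [measurable]: "f \<in> borel_measurable M"
    using assms by (rule Lp_leD)
  have "(\<integral>\<^sup>+\<omega>. ennreal (\<bar>f \<omega>\<bar> powr p) \<partial>M) = 0"
    using Lp_leD(3)[OF assms] by simp
  then have "AE \<omega> in M. ennreal (\<bar>f \<omega>\<bar> powr p) = 0"
    by (subst (asm) nn_integral_0_iff_AE) auto
  then show ?thesis
    by eventually_elim auto
qed

lemma Lp_le_cmult:
  assumes "Lp_le M p a f"
  shows "Lp_le M p (\<bar>c\<bar> * a) (\<lambda>\<omega>. c * f \<omega>)"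
proof -
  note [measurable] = Lp_leD(2)[OF assms]
  have "(\<integral>\<^sup>+\<omega>. ennreal (\<bar>c * f \<omega>\<bar> powr p) \<partial>M) = ennreal (\<bar>c\<bar> powr p) * (\<integral>\<^sup>+\<omega>. ennreal (\<bar>f \<omega>\<bar> powr p) \<partial>M)"
    by (subst nn_integral_cmult[symmetric]) (auto simp: abs_mult powr_mult ennreal_mult)
  also have "\<dots> \<le> ennreal (\<bar>c\<bar> powr p) * ennreal (a powr p)"
    by (intro mult_left_mono Lp_leD[OF assms]) auto
  also have "\<dots> = ennreal ((\<bar>c\<bar> * a) powr p)"
    using Lp_leD(1)[OF assms] by (simp add: powr_mult ennreal_mult)
  finally show ?thesis
    using Lp_leD(1)[OF assms] by (simp add: Lp_le_def)
qed

lemma Lp_le_minus: "Lp_le M p a f \<Longrightarrow> Lp_le M p a (\<lambda>\<omega>. - f \<omega>)"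
  by (simp add: Lp_le_def)

lemma Lp_le_abs: "Lp_le M p a f \<Longrightarrow> Lp_le M p a (\<lambda>\<omega>. \<bar>f \<omega>\<bar>)"
  by (auto simp: Lp_le_def)

text \<open>Convexity of the power on the closed half-line. The second derivative criterion is
  applied on the open half-line, since that derivative may blow up at 0; combinations with an
  endpoint 0 follow from \<open>t powr p \<le> t\<close> for \<open>t\<close> in [0, 1].\<close>

lemma powr_convex_combination:
  fixes x y u v p :: real
  assumes "p \<ge> 1" "x \<ge> 0" "y \<ge> 0" "u \<ge> 0" "v \<ge> 0" "u + v = 1"
  shows "(u * x + v * y) powr p \<le> u * x powr p + v * y powr p"
proof -
  have u: "u = 1 - v" "v \<le> 1" using assms by auto
  have "convex_on {0..} (\<lambda>x::real. x powr p)"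
  proof -
    have "convex_on {0<..} (\<lambda>x::real. x powr p)"
      by (rule f''_ge0_imp_convex[where f' = "\<lambda>x. p * x powr (p - 1)" and f'' = "\<lambda>x. p * ((p - 1) * x powr (p - 1 - 1))"])
         (use assms in \<open>auto intro!: derivative_eq_intros\<close>)
    then show ?thesis
      unfolding convex_on_def
    proof (intro conjI ballI allI impI, goal_cases)
      case (2 x y u v)
      then have v: "v = 1 - u" by auto
      have *: "(t * z) powr p \<le> t * z powr p" if "t \<ge> 0" "t \<le> 1" "z \<ge> 0" for t z :: real
      proof -
        have "t powr p \<le> t"
          using that powr_mono'[of 1 p t] assms by (cases "t = 0") auto
        then show ?thesis
          using that by (simp add: powr_mult mult_right_mono)
      qed
      have "u \<le> 1" "v \<le> 1" using 2 by auto
      consider "x = 0" | "y = 0" | "x > 0" "y > 0" using 2 by force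
      then show ?case
        by cases (use 2 \<open>u \<le> 1\<close> \<open>v \<le> 1\<close> *[of v y] *[of u x] assms(1) in auto)
    qed auto
  qed
  from convex_onD[OF this, of v x y] show ?thesis
    using assms u by auto
qed

text \<open>Minkowski's inequality, from convexity of the power applied to \<open>f / a\<close> and
  \<open>g / b\<close> with weights \<open>a / (a + b)\<close> and \<open>b / (a + b)\<close>. A
  zero bound cannot be divided by; it forces its function to vanish almost everywhere.\<close>

lemma Lp_le_add:
  assumes f: "Lp_le M p a f" and g: "Lp_le M p b g" and p: "p \<ge> 1"
  shows "Lp_le M p (a + b) (\<lambda>\<omega>. f \<omega> + g \<omega>)"
proof -
  note [measurable] = Lp_leD(2)[OF f] Lp_leD(2)[OF g]
  consider "a = 0" | "b = 0" | "a > 0" "b > 0"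
    using Lp_leD(1)[OF f] Lp_leD(1)[OF g] by linarith
  then show ?thesis
  proof cases
    case 1
    from Lp_le_zeroD[OF f[unfolded 1]] have "AE \<omega> in M. \<bar>f \<omega> + g \<omega>\<bar> \<le> \<bar>g \<omega>\<bar>"
      by eventually_elim auto
    with g p show ?thesis by (simp add: 1) (rule Lp_le_cong_abs, auto)
  next
    case 2
    from Lp_le_zeroD[OF g[unfolded 2]] have "AE \<omega> in M. \<bar>f \<omega> + g \<omega>\<bar> \<le> \<bar>f \<omega>\<bar>"
      by eventually_elim auto
    with f p show ?thesis by (simp add: 2) (rule Lp_le_cong_abs, auto)
  next
    case 3
    let ?u = "a / (a + b)" and ?v = "b / (a + b)"
    have uv: "?u + ?v = 1" using 3 by (simp add: add_divide_distrib[symmetric])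
    have le: "\<bar>x + y\<bar> powr p \<le> (a + b) powr p * (?u * (1 / a powr p) * \<bar>x\<bar> powr p + ?v * (1 / b powr p) * \<bar>y\<bar> powr p)" for x y :: real
    proof -
      have "\<bar>x + y\<bar> powr p \<le> ((a + b) * (?u * (\<bar>x\<bar> / a) + ?v * (\<bar>y\<bar> / b))) powr p"
      proof (rule powr_mono2)
        have "(a + b) * (?u * (\<bar>x\<bar> / a) + ?v * (\<bar>y\<bar> / b)) = \<bar>x\<bar> + \<bar>y\<bar>"
          using 3 by (simp add: distrib_left)
        then show "\<bar>x + y\<bar> \<le> (a + b) * (?u * (\<bar>x\<bar> / a) + ?v * (\<bar>y\<bar> / b))" by linarith
      qed (use p in auto)
      also have "\<dots> = (a + b) powr p * (?u * (\<bar>x\<bar> / a) + ?v * (\<bar>y\<bar> / b)) powr p"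
        using 3 by (subst powr_mult) auto
      also have "\<dots> \<le> (a + b) powr p * (?u * (\<bar>x\<bar> / a) powr p + ?v * (\<bar>y\<bar> / b) powr p)"
        by (intro mult_left_mono powr_convex_combination) (use 3 p uv in auto)
      also have "\<dots> = (a + b) powr p * (?u * (1 / a powr p) * \<bar>x\<bar> powr p + ?v * (1 / b powr p) * \<bar>y\<bar> powr p)"
        using 3 by (simp add: powr_divide)
      finally show ?thesis .
    qed
    have "(\<integral>\<^sup>+\<omega>. ennreal (\<bar>f \<omega> + g \<omega>\<bar> powr p) \<partial>M)
        \<le> (\<integral>\<^sup>+\<omega>. ennreal ((a + b) powr p) * (ennreal (?u * (1 / a powr p)) * ennreal (\<bar>f \<omega>\<bar> powr p) + ennreal (?v * (1 / b powr p)) * ennreal (\<bar>g \<omega>\<bar> powr p)) \<partial>M)"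
      using 3 by (intro nn_integral_mono)
        (auto simp: ennreal_mult[symmetric] ennreal_plus[symmetric] simp del: ennreal_plus intro!: ennreal_leI order_trans[OF le])
    also have "\<dots> = ennreal ((a + b) powr p) * (ennreal (?u * (1 / a powr p)) * (\<integral>\<^sup>+\<omega>. ennreal (\<bar>f \<omega>\<bar> powr p) \<partial>M) + ennreal (?v * (1 / b powr p)) * (\<integral>\<^sup>+\<omega>. ennreal (\<bar>g \<omega>\<bar> powr p) \<partial>M))"
      by (simp add: nn_integral_cmult nn_integral_add)
    also have "\<dots> \<le> ennreal ((a + b) powr p) * (ennreal (?u * (1 / a powr p)) * ennreal (a powr p) + ennreal (?v * (1 / b powr p)) * ennreal (b powr p))"
      by (intro mult_left_mono add_mono Lp_leD[OF f] Lp_leD[OF g]) auto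
    also have "\<dots> = ennreal ((a + b) powr p * (?u * (1 / a powr p) * a powr p + ?v * (1 / b powr p) * b powr p))"
      using 3 by (simp add: ennreal_mult[symmetric] ennreal_plus[symmetric] del: ennreal_plus)
    also have "(a + b) powr p * (?u * (1 / a powr p) * a powr p + ?v * (1 / b powr p) * b powr p) = (a + b) powr p"
      using 3 uv by simp
    finally show ?thesis
      using 3 by (simp add: Lp_le_def)
  qed
qed

lemma Lp_le_diff:
  assumes "Lp_le M p a f" "Lp_le M p b g" "p \<ge> 1"
  shows "Lp_le M p (a + b) (\<lambda>\<omega>. f \<omega> - g \<omega>)"
  using Lp_le_add[OF assms(1) Lp_le_minus[OF assms(2)] assms(3)] by simp

lemma Lp_le_sum:
  assumes "finite I" "\<And>i. i \<in> I \<Longrightarrow> Lp_le M p (a i) (f i)" "p \<ge> 1"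
  shows "Lp_le M p (\<Sum>i\<in>I. a i) (\<lambda>\<omega>. \<Sum>i\<in>I. f i \<omega>)"
  using assms(1,2)
  by (induction I rule: finite_induct) (auto simp: Lp_le_zero intro!: Lp_le_add assms(3))

text \<open>The weighted inequality between arithmetic and geometric mean for 1 and
  \<open>x powr p\<close>, that is, convexity of \<open>exp\<close> between 0 and
  \<open>p * ln x\<close>.\<close>

lemma powr_weighted_le:
  fixes x p q :: real
  assumes "x \<ge> 0" "0 < q" "q \<le> p"
  shows "x powr q \<le> 1 - q / p + (q / p) * x powr p"
proof (cases "x = 0")
  case False
  have "q / p \<le> 1" using assms by simp
  have "exp ((1 - q / p) * 0 + (q / p) * (p * ln x)) \<le> (1 - q / p) * exp 0 + (q / p) * exp (p * ln x)"
    using convex_onD[OF exp_convex, of "q / p" 0 "p * ln x"] assms \<open>q / p \<le> 1\<close> by simp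
  then show ?thesis
    using assms False by (simp add: powr_def)
qed (use assms in auto)

text \<open>Lyapunov's inequality: the preceding bound is applied to the absolute value of
  \<open>f / a\<close> and integrated; the constant term uses total mass 1.\<close>

lemma (in prob_space) Lp_le_exponent_mono:
  assumes f: "Lp_le M p a f" and q: "0 < q" "q \<le> p"
  shows "Lp_le M q a f"
proof (cases "a = 0")
  case True
  note [measurable] = Lp_leD(2)[OF f]
  from Lp_le_zeroD[OF f[unfolded True]] have "AE \<omega> in M. \<bar>f \<omega>\<bar> \<le> \<bar>0\<bar>"
    by eventually_elim auto
  then show ?thesis
    unfolding True by (intro Lp_le_cong_abs[OF Lp_le_zero]) (use q in auto)
next
  case False
  then have a: "a > 0" using Lp_leD(1)[OF f] by simp
  note [measurable] = Lp_leD(2)[OF f]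
  have le: "\<bar>x\<bar> powr q \<le> a powr q * (1 - q / p) + a powr q * (q / p) * (1 / a powr p) * \<bar>x\<bar> powr p" for x
  proof -
    have "\<bar>x\<bar> powr q = a powr q * (\<bar>x\<bar> / a) powr q"
      using a by (simp add: powr_divide)
    also have "\<dots> \<le> a powr q * (1 - q / p + (q / p) * (\<bar>x\<bar> / a) powr p)"
      by (intro mult_left_mono powr_weighted_le) (use a q in auto)
    also have "\<dots> = a powr q * (1 - q / p) + a powr q * (q / p) * (1 / a powr p) * \<bar>x\<bar> powr p"
      using a by (simp add: powr_divide algebra_simps)
    finally show ?thesis .
  qed
  have qp: "0 \<le> 1 - q / p" using q by simp
  have c: "0 \<le> a powr q * (q / p) * (1 / a powr p)" using q a by simp
  have "(\<integral>\<^sup>+\<omega>. ennreal (\<bar>f \<omega>\<bar> powr q) \<partial>M)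
     \<le> (\<integral>\<^sup>+\<omega>. ennreal (a powr q * (1 - q / p)) + ennreal (a powr q * (q / p) * (1 / a powr p)) * ennreal (\<bar>f \<omega>\<bar> powr p) \<partial>M)"
  proof (intro nn_integral_mono)
    fix \<omega>
    have "ennreal (\<bar>f \<omega>\<bar> powr q) \<le> ennreal (a powr q * (1 - q / p) + a powr q * (q / p) * (1 / a powr p) * \<bar>f \<omega>\<bar> powr p)"
      by (intro ennreal_leI le)
    also have "\<dots> = ennreal (a powr q * (1 - q / p)) + ennreal (a powr q * (q / p) * (1 / a powr p)) * ennreal (\<bar>f \<omega>\<bar> powr p)"
      using c qp by (subst ennreal_mult[symmetric], simp, simp, subst ennreal_plus[symmetric])
        (use mult_nonneg_nonneg[OF c] in auto)
    finally show "ennreal (\<bar>f \<omega>\<bar> powr q) \<le> ennreal (a powr q * (1 - q / p)) + ennreal (a powr q * (q / p) * (1 / a powr p)) * ennreal (\<bar>f \<omega>\<bar> powr p)" .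
  qed
  also have "\<dots> = ennreal (a powr q * (1 - q / p)) + ennreal (a powr q * (q / p) * (1 / a powr p)) * (\<integral>\<^sup>+\<omega>. ennreal (\<bar>f \<omega>\<bar> powr p) \<partial>M)"
    by (simp add: nn_integral_cmult nn_integral_add emeasure_space_1)
  also have "\<dots> \<le> ennreal (a powr q * (1 - q / p)) + ennreal (a powr q * (q / p) * (1 / a powr p)) * ennreal (a powr p)"
    by (intro mult_left_mono add_left_mono Lp_leD[OF f]) auto
  also have "\<dots> = ennreal (a powr q * (1 - q / p) + a powr q * (q / p) * (1 / a powr p) * a powr p)"
    using a c qp q by (subst ennreal_mult[symmetric], simp, simp, subst ennreal_plus) auto
  also have "a powr q * (1 - q / p) + a powr q * (q / p) * (1 / a powr p) * a powr p = a powr q"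
    using a by (simp add: algebra_simps)
  finally show ?thesis
    using a by (simp add: Lp_le_def)
qed

lemma (in prob_space) Lp_le_integrable:
  assumes "Lp_le M p a f" "p \<ge> 1"
  shows "integrable M f" "expectation (\<lambda>\<omega>. \<bar>f \<omega>\<bar>) \<le> a"
proof -
  note [measurable] = Lp_leD(2)[OF assms(1)]
  have L1: "(\<integral>\<^sup>+\<omega>. ennreal \<bar>f \<omega>\<bar> \<partial>M) \<le> ennreal a"
    using Lp_leD(3,1)[OF Lp_le_exponent_mono[OF assms(1), of 1]] assms(2) by simp
  then show int: "integrable M f"
    by (intro integrableI_bounded) (auto intro: le_less_trans)
  have "ennreal (expectation (\<lambda>\<omega>. \<bar>f \<omega>\<bar>)) \<le> ennreal a"
    using L1 int by (subst nn_integral_eq_integral[symmetric]) auto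
  then show "expectation (\<lambda>\<omega>. \<bar>f \<omega>\<bar>) \<le> a"
    using Lp_leD(1)[OF assms(1)] by simp
qed

text \<open>The infimum behind the entropy weights need not be attained, so estimates with
  near-optimal exponents carry an error \<open>e\<close>. This removes it.\<close>

lemma Lp_le_limit:
  assumes f: "f \<in> borel_measurable M" and "0 \<le> a" "0 < p"
    and le: "\<And>e. e > 0 \<Longrightarrow> Lp_le M p (a + e) f"
  shows "Lp_le M p a f"
proof -
  have "(\<lambda>n. a + 1 / real (Suc n)) \<longlonglongrightarrow> a + 0"
    by (intro tendsto_intros LIMSEQ_Suc lim_1_over_n)
  then have "(\<lambda>n. (a + 1 / real (Suc n)) powr p) \<longlonglongrightarrow> a powr p"
    using assms by (intro tendsto_powr') auto
  then have "(\<lambda>n. ennreal ((a + 1 / Suc n) powr p)) \<longlonglongrightarrow> ennreal (a powr p)"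
    by (intro tendsto_ennrealI)
  then have "(\<integral>\<^sup>+\<omega>. ennreal (\<bar>f \<omega>\<bar> powr p) \<partial>M) \<le> ennreal (a powr p)"
    by (rule LIMSEQ_le_const) (use Lp_leD(3)[OF le] in auto)
  then show ?thesis
    using assms by (simp add: Lp_le_def)
qed

text \<open>The \<open>p\<close>-th power of the maximum is at most the sum of the
  \<open>p\<close>-th powers, so \<open>N\<close> functions cost a factor
  \<open>N powr (1 / p)\<close>. This is how covering numbers enter.\<close>

lemma Lp_le_Max:
  assumes F: "finite F" "F \<noteq> {}" and f: "\<And>s. s \<in> F \<Longrightarrow> Lp_le M p a (f s)" and p: "p > 0" and N: "real (card F) \<le> N"
  shows "Lp_le M p (N powr (1 / p) * a) (\<lambda>\<omega>. Max ((\<lambda>s. \<bar>f s \<omega>\<bar>) ` F))"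
proof -
  have [measurable]: "\<And>s. s \<in> F \<Longrightarrow> f s \<in> borel_measurable M"
    using Lp_leD(2)[OF f] .
  obtain s0 where "s0 \<in> F" using F by auto
  then have a: "a \<ge> 0" using Lp_leD(1)[OF f] by auto
  have N0: "N \<ge> 0" using N by linarith
  have le: "\<bar>Max ((\<lambda>s. \<bar>f s \<omega>\<bar>) ` F)\<bar> powr p \<le> (\<Sum>s\<in>F. \<bar>f s \<omega>\<bar> powr p)" for \<omega>
  proof -
    have "Max ((\<lambda>s. \<bar>f s \<omega>\<bar>) ` F) \<in> (\<lambda>s. \<bar>f s \<omega>\<bar>) ` F" using F by (intro Max_in) auto
    then obtain s where s: "s \<in> F" "Max ((\<lambda>s. \<bar>f s \<omega>\<bar>) ` F) = \<bar>f s \<omega>\<bar>" by auto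
    then show ?thesis
      using F by (auto intro!: member_le_sum)
  qed
  have "(\<integral>\<^sup>+\<omega>. ennreal (\<bar>Max ((\<lambda>s. \<bar>f s \<omega>\<bar>) ` F)\<bar> powr p) \<partial>M) \<le> (\<integral>\<^sup>+\<omega>. (\<Sum>s\<in>F. ennreal (\<bar>f s \<omega>\<bar> powr p)) \<partial>M)"
    by (intro nn_integral_mono) (auto simp: sum_ennreal intro!: ennreal_leI le)
  also have "\<dots> = (\<Sum>s\<in>F. \<integral>\<^sup>+\<omega>. ennreal (\<bar>f s \<omega>\<bar> powr p) \<partial>M)"
    by (intro nn_integral_sum) auto
  also have "\<dots> \<le> (\<Sum>s\<in>F. ennreal (a powr p))"
    by (intro sum_mono Lp_leD[OF f])
  also have "\<dots> = ennreal (card F * a powr p)"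
    by (simp add: ennreal_mult ennreal_of_nat_eq_real_of_nat)
  also have "\<dots> \<le> ennreal (N * a powr p)"
    by (intro ennreal_leI mult_right_mono N) auto
  also have "N * a powr p = (N powr (1 / p) * a) powr p"
    using p a N0 by (simp add: powr_mult powr_powr)
  moreover have "(\<lambda>\<omega>. Max ((\<lambda>s. \<bar>f s \<omega>\<bar>) ` F)) \<in> borel_measurable M"
    using F by (intro borel_measurable_Max) auto
  ultimately show ?thesis
    using a by (simp add: Lp_le_def)
qed

text \<open>Almost sure summability comes from exponent 1, where the expectation of the series is at
  most the sum of the \<open>a k\<close>. The bound for the limit then passes from the partial sums,
  controlled by Minkowski, through Fatou's lemma.\<close>

lemma (in prob_space) Lp_le_suminf:
  assumes f: "\<And>k. Lp_le M p (a k) (f k)" and p: "p \<ge> 1" and a: "summable a"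
  shows "AE \<omega> in M. summable (\<lambda>k. \<bar>f k \<omega>\<bar>)"
    and "Lp_le M p (suminf a) (\<lambda>\<omega>. \<Sum>k. \<bar>f k \<omega>\<bar>)"
proof -
  have [measurable]: "f k \<in> borel_measurable M" for k
    using Lp_leD(2)[OF f] .
  have a0: "a k \<ge> 0" for k using Lp_leD(1)[OF f] .
  have "(\<integral>\<^sup>+\<omega>. (\<Sum>k. ennreal \<bar>f k \<omega>\<bar>) \<partial>M) = (\<Sum>k. \<integral>\<^sup>+\<omega>. ennreal \<bar>f k \<omega>\<bar> \<partial>M)"
    by (intro nn_integral_suminf) auto
  also have "\<dots> \<le> (\<Sum>k. ennreal (a k))"
  proof (intro suminf_le)
    show "(\<integral>\<^sup>+\<omega>. ennreal \<bar>f k \<omega>\<bar> \<partial>M) \<le> ennreal (a k)" for k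
      using Lp_leD(3)[OF Lp_le_exponent_mono[OF f[of k], of 1]] p a0 by simp
  qed auto
  also have "\<dots> < \<infinity>"
    using a a0 by (subst suminf_ennreal2) auto
  finally have "AE \<omega> in M. (\<Sum>k. ennreal \<bar>f k \<omega>\<bar>) \<noteq> \<infinity>"
    by (intro nn_integral_PInf_AE) auto
  then show sm: "AE \<omega> in M. summable (\<lambda>k. \<bar>f k \<omega>\<bar>)"
    by eventually_elim (auto intro: summable_suminf_not_top)
  have part: "(\<integral>\<^sup>+\<omega>. ennreal ((\<Sum>k<n. \<bar>f k \<omega>\<bar>) powr p) \<partial>M) \<le> ennreal (suminf a powr p)" for n
  proof -
    have "Lp_le M p (\<Sum>k<n. a k) (\<lambda>\<omega>. \<Sum>k<n. \<bar>f k \<omega>\<bar>)"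
      by (intro Lp_le_sum Lp_le_abs f p) auto
    from Lp_leD(3)[OF this] have "(\<integral>\<^sup>+\<omega>. ennreal ((\<Sum>k<n. \<bar>f k \<omega>\<bar>) powr p) \<partial>M) \<le> ennreal ((\<Sum>k<n. a k) powr p)"
      by (simp add: sum_nonneg)
    also have "\<dots> \<le> ennreal (suminf a powr p)"
      using a a0 p by (intro ennreal_leI powr_mono2 sum_le_suminf sum_nonneg) auto
    finally show ?thesis .
  qed
  have "(\<integral>\<^sup>+\<omega>. ennreal (\<bar>\<Sum>k. \<bar>f k \<omega>\<bar>\<bar> powr p) \<partial>M) = (\<integral>\<^sup>+\<omega>. liminf (\<lambda>n. ennreal ((\<Sum>k<n. \<bar>f k \<omega>\<bar>) powr p)) \<partial>M)"
  proof (rule nn_integral_cong_AE)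
    from sm show "AE \<omega> in M. ennreal (\<bar>\<Sum>k. \<bar>f k \<omega>\<bar>\<bar> powr p) = liminf (\<lambda>n. ennreal ((\<Sum>k<n. \<bar>f k \<omega>\<bar>) powr p))"
    proof eventually_elim
      case (elim \<omega>)
      have "(\<lambda>n. ennreal ((\<Sum>k<n. \<bar>f k \<omega>\<bar>) powr p)) \<longlonglongrightarrow> ennreal ((\<Sum>k. \<bar>f k \<omega>\<bar>) powr p)"
        using p by (intro tendsto_ennrealI tendsto_powr' summable_LIMSEQ elim tendsto_const)
          (auto simp: sum_nonneg)
      from lim_imp_Liminf[OF _ this] show ?case
        using suminf_nonneg[OF elim] by simp
    qed
  qed
  also have "\<dots> \<le> liminf (\<lambda>n. \<integral>\<^sup>+\<omega>. ennreal ((\<Sum>k<n. \<bar>f k \<omega>\<bar>) powr p) \<partial>M)"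
    by (intro nn_integral_liminf) auto
  also have "\<dots> \<le> ennreal (suminf a powr p)"
    using part by (intro Liminf_le) (auto intro: always_eventually)
  finally show "Lp_le M p (suminf a) (\<lambda>\<omega>. \<Sum>k. \<bar>f k \<omega>\<bar>)"
    using a a0 by (auto simp: Lp_le_def intro!: suminf_nonneg)
qed

text \<open>\<open>Lp_norm\<close> is infinite by definition when the power is not integrable, while
  \<open>Lp_le\<close> expresses the same through a nonnegative integral. All estimates are made
  with \<open>Lp_le\<close> and translated here.\<close>

lemma Lp_norm_le_iff:
  assumes "f \<in> borel_measurable M" "0 \<le> a" "0 < p"
  shows "Lp_norm M p f \<le> ennreal a \<longleftrightarrow> Lp_le M p a f"
proof (cases "integrable M (\<lambda>\<omega>. \<bar>f \<omega>\<bar> powr p)")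
  case True
  let ?I = "\<integral>\<omega>. \<bar>f \<omega>\<bar> powr p \<partial>M"
  have I: "?I \<ge> 0" by (intro integral_nonneg_AE) auto
  have "?I powr (1 / p) \<le> a \<longleftrightarrow> ?I \<le> a powr p"
  proof
    assume "?I powr (1 / p) \<le> a"
    then have "(?I powr (1 / p)) powr p \<le> a powr p" using assms by (intro powr_mono2) auto
    then show "?I \<le> a powr p" using assms I by (simp add: powr_powr)
  next
    assume "?I \<le> a powr p"
    then have "?I powr (1 / p) \<le> (a powr p) powr (1 / p)" using assms I by (intro powr_mono2) auto
    then show "?I powr (1 / p) \<le> a" using assms by (simp add: powr_powr)
  qed
  then show ?thesis
    using True assms by (simp add: Lp_norm_def Lp_le_def nn_integral_eq_integral)
next
  case False
  then have "(\<integral>\<^sup>+\<omega>. ennreal (\<bar>f \<omega>\<bar> powr p) \<partial>M) = \<infinity>"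
    using assms(1) by (auto simp: integrable_iff_bounded not_less top_unique)
  then show ?thesis
    using False assms by (auto simp: Lp_norm_def Lp_le_def top_unique)
qed

lemma Lp_le_completion: "Lp_le M p a f \<Longrightarrow> Lp_le (completion M) p a f"
  by (simp add: Lp_le_def nn_integral_completion measurable_completion)

lemma (in prob_space) Lp_le_tail:
  assumes f: "Lp_le M p a f" and p: "p > 0" and y: "y > 0"
  shows "prob {\<omega>\<in>space M. y < \<bar>f \<omega>\<bar>} \<le> (a / y) powr p"
proof -
  note [measurable] = Lp_leD(2)[OF f]
  have "emeasure M {\<omega>\<in>space M. y < \<bar>f \<omega>\<bar>} \<le> emeasure M {\<omega>\<in>space M. 1 \<le> ennreal (1 / y powr p) * ennreal (\<bar>f \<omega>\<bar> powr p)}"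
  proof (intro emeasure_mono)
    have "1 \<le> 1 / y powr p * \<bar>t\<bar> powr p" if "y < \<bar>t\<bar>" for t
      using that y p powr_mono2[of p y "\<bar>t\<bar>"] by (simp add: field_simps)
    then show "{\<omega>\<in>space M. y < \<bar>f \<omega>\<bar>} \<subseteq> {\<omega>\<in>space M. 1 \<le> ennreal (1 / y powr p) * ennreal (\<bar>f \<omega>\<bar> powr p)}"
      by (auto simp: ennreal_mult[symmetric] ennreal_1[symmetric] simp del: ennreal_1)
  qed measurable
  also have "\<dots> = emeasure M ({\<omega>\<in>space M. 1 \<le> ennreal (1 / y powr p) * ennreal (\<bar>f \<omega>\<bar> powr p)} \<inter> space M)"
    by (simp add: Int_absorb2)
  also have "\<dots> \<le> ennreal (1 / y powr p) * (\<integral>\<^sup>+\<omega>. ennreal (\<bar>f \<omega>\<bar> powr p) * indicator (space M) \<omega> \<partial>M)"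
    using nn_integral_Markov_inequality[of "\<lambda>\<omega>. ennreal (\<bar>f \<omega>\<bar> powr p)" "space M" M "ennreal (1 / y powr p)"]
    by (simp add: Int_def conj_ac)
  also have "\<dots> = ennreal (1 / y powr p) * (\<integral>\<^sup>+\<omega>. ennreal (\<bar>f \<omega>\<bar> powr p) \<partial>M)"
    by (intro arg_cong2[where f = "(*)"] refl nn_integral_cong) auto
  also have "\<dots> \<le> ennreal (1 / y powr p) * ennreal (a powr p)"
    by (intro mult_left_mono Lp_leD[OF f]) auto
  also have "\<dots> = ennreal ((a / y) powr p)"
    using y Lp_leD(1)[OF f] by (simp add: ennreal_mult[symmetric] powr_divide)
  finally show ?thesis
    by (simp add: emeasure_eq_measure)
qed

section \<open>Adding a conditionally centred term to a function in \<open>L p\<close>\<close>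

text \<open>The linear term is kept apart from a remainder of second order, so that it can vanish
  after integration against a centred variable.\<close>

lemma exp_le_add_exp_square:
  fixes z :: real
  shows "exp z \<le> z + exp (z\<^sup>2)"
proof -
  have e: "1 + z\<^sup>2 \<le> exp (z\<^sup>2)" by (rule exp_ge_add_one_self)
  consider "z \<ge> 1" | "0 \<le> z" "z \<le> 1" | "-1 \<le> z" "z < 0" | "z < - 1" by linarith
  then show ?thesis
  proof cases
    case 1
    then have "z \<le> z\<^sup>2" by (simp add: power2_eq_square)
    then have "exp z \<le> exp (z\<^sup>2)" by simp
    with 1 show ?thesis by linarith
  next
    case 2
    from exp_bound[OF this] e show ?thesis by linarith
  next
    case 3
    have "1 - z \<le> exp (- z)" using exp_ge_add_one_self[of "- z"] by simp
    then have "exp z \<le> 1 / (1 - z)" using 3 by (simp add: exp_minus field_simps)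
    also have "\<dots> \<le> 1 + z + z\<^sup>2"
    proof -
      have "z ^ 3 \<le> 0" using 3 by (simp add: power_less_zero_eq_numeral less_imp_le)
      then show ?thesis using 3 by (simp add: divide_le_eq algebra_simps power2_eq_square power3_eq_cube)
    qed
    finally show ?thesis using e by linarith
  next
    case 4
    then have "exp z \<le> 1" by simp
    moreover have "- z \<le> z\<^sup>2" using 4 mult_left_mono[of 1 "- z" "- z"] by (simp add: power2_eq_square)
    ultimately show ?thesis using e by linarith
  qed
qed

lemma square_powr_half:
  fixes x p :: real
  shows "(x\<^sup>2) powr (p / 2) = \<bar>x\<bar> powr p"
proof -
  have "x\<^sup>2 = \<bar>x\<bar> powr 2" by simp
  then show ?thesis by (simp only: powr_powr) simp
qed

lemma one_plus_powr_ge: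
  fixes t p :: real
  assumes "t \<ge> 0" "p \<ge> 1"
  shows "1 + p * t \<le> (1 + t) powr p"
  using mult_left_mono[OF powr_weighted_le[of "1 + t" 1 p], of p] assms
  by (simp add: distrib_left right_diff_distrib)

text \<open>With \<open>s = p * u\<^sup>2\<close> at most 1, convexity of \<open>exp\<close> on
  [0, 2] and \<open>exp 2 \<le> 9\<close> give \<open>exp (2 * s) \<le> 1 + 8 * s\<close>; its power
  \<open>p / 2\<close> dominates \<open>exp ((p * u)\<^sup>2)\<close>. This is the origin of the 8.
  For larger \<open>s\<close> the linear term is absorbed by Bernoulli's inequality and
  \<open>2 \<le> 2 powr (p / 2)\<close>.\<close>

lemma abs_one_plus_powr_le:
  fixes u p :: real
  assumes p: "p \<ge> 2"
  shows "\<bar>1 + u\<bar> powr p \<le> (1 + 8 * p * u\<^sup>2) powr (p / 2) + p * u"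
proof (cases "p * u\<^sup>2 \<le> 1")
  case True
  let ?s = "p * u\<^sup>2"
  have "u\<^sup>2 < 1"
  proof (rule ccontr)
    assume "\<not> u\<^sup>2 < 1"
    then have "p * 1 \<le> p * u\<^sup>2" using p by (intro mult_left_mono) auto
    then show False using True p by linarith
  qed
  then have u: "\<bar>u\<bar> < 1" by (simp add: abs_square_less_1)
  have e1: "exp (1::real) ^ 2 \<le> 3 ^ 2"
    by (intro power_mono exp_le) auto
  have "exp (2 * ?s) \<le> (1 - ?s) * exp 0 + ?s * exp 2"
    using convex_onD[OF exp_convex, of ?s 0 2] True p by (simp add: mult.commute)
  also have "\<dots> \<le> (1 - ?s) * 1 + ?s * 9"
    using e1 p True by (intro add_mono mult_left_mono) (auto simp: exp_double[of 1, simplified])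
  also have "\<dots> = 1 + 8 * p * u\<^sup>2" by simp
  finally have "2 * ?s \<le> ln (1 + 8 * p * u\<^sup>2)"
    using p by (subst ln_ge_iff) (auto intro!: add_pos_nonneg)
  then have "p / 2 * (2 * ?s) \<le> p / 2 * ln (1 + 8 * p * u\<^sup>2)"
    using p by (intro mult_left_mono) auto
  then have s: "exp ((p * u)\<^sup>2) \<le> (1 + 8 * p * u\<^sup>2) powr (p / 2)"
    using p by (auto simp: powr_def power2_eq_square add_nonneg_eq_0_iff ac_simps)
  have "\<bar>1 + u\<bar> powr p = exp (p * ln (1 + u))"
    using u by (simp add: powr_def)
  also have "\<dots> \<le> exp (p * u)"
    using u p by (simp add: ln_add_one_self_le_self2)
  also have "\<dots> \<le> p * u + exp ((p * u)\<^sup>2)"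
    by (rule exp_le_add_exp_square)
  finally show ?thesis using s by linarith
next
  case False
  have "\<bar>1 + u\<bar> powr p \<le> (1 + \<bar>u\<bar>) powr p"
    using p by (intro powr_mono2) auto
  moreover have "p * \<bar>u\<bar> \<le> (1 + \<bar>u\<bar>) powr p"
    using one_plus_powr_ge[of "\<bar>u\<bar>" p] p by linarith
  moreover have "- (p * u) \<le> p * \<bar>u\<bar>" using p by (simp add: abs_if)
  ultimately have "\<bar>1 + u\<bar> powr p - p * u \<le> 2 * (1 + \<bar>u\<bar>) powr p" by linarith
  also have "(1 + \<bar>u\<bar>) powr p = ((1 + \<bar>u\<bar>)\<^sup>2) powr (p / 2)"
    by (simp add: square_powr_half)
  also have "2 * \<dots> \<le> 2 powr (p / 2) * ((1 + \<bar>u\<bar>)\<^sup>2) powr (p / 2)"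
    using p powr_mono[of 1 "p / 2" 2] by (intro mult_right_mono) auto
  also have "\<dots> = (2 * (1 + \<bar>u\<bar>)\<^sup>2) powr (p / 2)"
    by (simp add: powr_mult)
  also have "\<dots> \<le> (1 + 8 * p * u\<^sup>2) powr (p / 2)"
  proof (intro powr_mono2)
    have "2 * (1 + \<bar>u\<bar>)\<^sup>2 \<le> 4 + 4 * u\<^sup>2"
      using zero_le_power2[of "1 - \<bar>u\<bar>"] by (simp add: power2_eq_square algebra_simps)
    moreover have "2 * u\<^sup>2 \<le> p * u\<^sup>2" using p by (intro mult_right_mono) auto
    ultimately show "2 * (1 + \<bar>u\<bar>)\<^sup>2 \<le> 1 + 8 * p * u\<^sup>2" using False by linarith
  qed (use p in auto)
  finally show ?thesis by linarith
qed

text \<open>The homogeneous form of the preceding bound. The last term is the derivative of the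
  \<open>p\<close>-th power at \<open>x\<close> in direction \<open>y\<close>; it integrates to zero
  when \<open>y\<close> has conditional mean zero given \<open>x\<close>.\<close>

lemma abs_add_powr_le:
  fixes x y p :: real
  assumes p: "p \<ge> 2"
  shows "\<bar>x + y\<bar> powr p \<le> (x\<^sup>2 + 8 * p * y\<^sup>2) powr (p / 2) + p * (sgn x * \<bar>x\<bar> powr (p - 1) * y)"
proof (cases "x = 0")
  case True
  have "\<bar>y\<bar> powr p = (y\<^sup>2) powr (p / 2)"
    by (simp add: square_powr_half)
  also have "\<dots> \<le> (8 * p * y\<^sup>2) powr (p / 2)"
    using p mult_right_mono[of 1 "8 * p" "y\<^sup>2"] by (intro powr_mono2) auto
  finally show ?thesis using True by simp
next
  case False
  have x2: "\<bar>x\<bar> powr p = (x\<^sup>2) powr (p / 2)"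
    by (simp add: square_powr_half)
  have xp: "\<bar>x\<bar> powr p = \<bar>x\<bar> * \<bar>x\<bar> powr (p - 1)"
    using False by (simp add: powr_mult_base)
  have "\<bar>x + y\<bar> = \<bar>x\<bar> * \<bar>1 + y / x\<bar>"
    using False by (simp add: abs_mult[symmetric] distrib_left)
  then have "\<bar>x + y\<bar> powr p = \<bar>x\<bar> powr p * \<bar>1 + y / x\<bar> powr p"
    by (simp add: powr_mult)
  also have "\<dots> \<le> \<bar>x\<bar> powr p * ((1 + 8 * p * (y / x)\<^sup>2) powr (p / 2) + p * (y / x))"
    by (intro mult_left_mono abs_one_plus_powr_le p) auto
  also have "\<dots> = (x\<^sup>2) powr (p / 2) * (1 + 8 * p * (y / x)\<^sup>2) powr (p / 2) + p * (\<bar>x\<bar> powr p * (y / x))"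
    by (simp add: distrib_left x2)
  also have "(x\<^sup>2) powr (p / 2) * (1 + 8 * p * (y / x)\<^sup>2) powr (p / 2) = (x\<^sup>2 + 8 * p * y\<^sup>2) powr (p / 2)"
    using False p by (subst powr_mult[symmetric]) (auto simp: distrib_left power_divide)
  also have "\<bar>x\<bar> powr p * (y / x) = sgn x * \<bar>x\<bar> powr (p - 1) * y"
    using False unfolding xp by (simp add: sgn_if abs_if)
  finally show ?thesis .
qed

lemma Lp_le_integral:
  assumes f: "Lp_le M p a f"
  shows "integrable M (\<lambda>\<omega>. \<bar>f \<omega>\<bar> powr p)" "(\<integral>\<omega>. \<bar>f \<omega>\<bar> powr p \<partial>M) \<le> a powr p"
proof -
  note [measurable] = Lp_leD(2)[OF f]
  show int: "integrable M (\<lambda>\<omega>. \<bar>f \<omega>\<bar> powr p)"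
    using Lp_leD(3)[OF f] by (intro integrableI_bounded) (auto intro: le_less_trans)
  show "(\<integral>\<omega>. \<bar>f \<omega>\<bar> powr p \<partial>M) \<le> a powr p"
    using Lp_leD(3)[OF f] nn_integral_eq_integral[OF int] by simp
qed

lemma Lp_leI_integral:
  assumes "f \<in> borel_measurable M" "0 \<le> a"
    "integrable M (\<lambda>\<omega>. \<bar>f \<omega>\<bar> powr p)" "(\<integral>\<omega>. \<bar>f \<omega>\<bar> powr p \<partial>M) \<le> a powr p"
  shows "Lp_le M p a f"
  using assms nn_integral_eq_integral[OF assms(3)] by (auto simp: Lp_le_def intro!: ennreal_leI)

text \<open>The constant grows like \<open>sqrt p\<close>, which is dominated by \<open>p / ln p\<close>; this is why
  no Rosenthal-type inequality is needed.\<close>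

lemma Lp_le_add_orthogonal:
  assumes f: "Lp_le M p a f" and g: "Lp_le M p b g" and p: "p \<ge> 2"
    and orth: "(\<integral>\<omega>. sgn (f \<omega>) * \<bar>f \<omega>\<bar> powr (p - 1) * g \<omega> \<partial>M) = 0"
  shows "Lp_le M p (sqrt (a\<^sup>2 + 8 * p * b\<^sup>2)) (\<lambda>\<omega>. f \<omega> + g \<omega>)"
proof -
  note [measurable] = Lp_leD(2)[OF f] Lp_leD(2)[OF g]
  have sq: "Lp_le M (p / 2) (a\<^sup>2) (\<lambda>\<omega>. (f \<omega>)\<^sup>2)" if "Lp_le M p a f" for a f
  proof -
    have "\<bar>(x::real)\<^sup>2\<bar> powr (p / 2) = \<bar>x\<bar> powr p" for x
      by (simp add: square_powr_half)
    from this this[of a] Lp_leD[OF that] show ?thesis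
      by (auto simp: Lp_le_def)
  qed
  \<comment> \<open>Squaring turns \<open>L p\<close> bounds into \<open>L (p / 2)\<close> bounds,
    and Minkowski applies there because \<open>p / 2 \<ge> 1\<close>.\<close>
  have h: "Lp_le M (p / 2) (a\<^sup>2 + \<bar>8 * p\<bar> * b\<^sup>2) (\<lambda>\<omega>. (f \<omega>)\<^sup>2 + 8 * p * (g \<omega>)\<^sup>2)"
    by (intro Lp_le_add Lp_le_cmult sq f g) (use p in auto)
  have hint: "integrable M (\<lambda>\<omega>. ((f \<omega>)\<^sup>2 + 8 * p * (g \<omega>)\<^sup>2) powr (p / 2))"
    "(\<integral>\<omega>. ((f \<omega>)\<^sup>2 + 8 * p * (g \<omega>)\<^sup>2) powr (p / 2) \<partial>M) \<le> (a\<^sup>2 + 8 * p * b\<^sup>2) powr (p / 2)"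
    using Lp_le_integral[OF h] p by (simp_all add: add_nonneg_nonneg)
  \<comment> \<open>Bounding by the larger of the two absolute values makes the cross term
    integrable.\<close>
  have dom: "\<bar>sgn x * \<bar>x\<bar> powr (p - 1) * y\<bar> \<le> \<bar>x\<bar> powr p + \<bar>y\<bar> powr p" for x y :: real
  proof (cases "\<bar>x\<bar> \<le> \<bar>y\<bar>")
    case True
    have "\<bar>sgn x * \<bar>x\<bar> powr (p - 1) * y\<bar> \<le> \<bar>y\<bar> powr (p - 1) * \<bar>y\<bar>"
      using True p by (auto simp: abs_mult sgn_if intro!: mult_right_mono powr_mono2)
    also have "\<dots> = \<bar>y\<bar> powr p"
      using p powr_mult_base[of "\<bar>y\<bar>" "p - 1"] by (simp add: mult.commute)
    finally show ?thesis by (simp add: add_increasing)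
  next
    case False
    have "\<bar>sgn x * \<bar>x\<bar> powr (p - 1) * y\<bar> \<le> \<bar>x\<bar> powr (p - 1) * \<bar>x\<bar>"
      using False p by (auto simp: abs_mult sgn_if intro!: mult_mono)
    also have "\<dots> = \<bar>x\<bar> powr p"
      using p powr_mult_base[of "\<bar>x\<bar>" "p - 1"] by (simp add: mult.commute)
    finally show ?thesis by (simp add: add_increasing2)
  qed
  have int: "integrable M (\<lambda>\<omega>. sgn (f \<omega>) * \<bar>f \<omega>\<bar> powr (p - 1) * g \<omega>)"
    by (rule Bochner_Integration.integrable_bound[OF Bochner_Integration.integrable_add[OF Lp_le_integral(1)[OF f] Lp_le_integral(1)[OF g]]])
      (use dom in \<open>auto simp: add_nonneg_nonneg intro!: AE_I2\<close>)
  have fg: "integrable M (\<lambda>\<omega>. \<bar>f \<omega> + g \<omega>\<bar> powr p)"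
    using p by (intro Lp_le_integral(1)[OF Lp_le_add[OF f g]]) auto
  have "(\<integral>\<omega>. \<bar>f \<omega> + g \<omega>\<bar> powr p \<partial>M)
      \<le> (\<integral>\<omega>. ((f \<omega>)\<^sup>2 + 8 * p * (g \<omega>)\<^sup>2) powr (p / 2) + p * (sgn (f \<omega>) * \<bar>f \<omega>\<bar> powr (p - 1) * g \<omega>) \<partial>M)"
    by (intro integral_mono fg Bochner_Integration.integrable_add hint integrable_mult_right int abs_add_powr_le p)
  also have "\<dots> = (\<integral>\<omega>. ((f \<omega>)\<^sup>2 + 8 * p * (g \<omega>)\<^sup>2) powr (p / 2) \<partial>M)"
    using orth by (subst Bochner_Integration.integral_add) (auto intro!: hint integrable_mult_right int)
  also have "\<dots> \<le> (a\<^sup>2 + 8 * p * b\<^sup>2) powr (p / 2)" by (rule hint)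
  also have "\<dots> = sqrt (a\<^sup>2 + 8 * p * b\<^sup>2) powr p"
    using p by (simp add: powr_half_sqrt[symmetric] powr_powr add_nonneg_nonneg)
  finally show ?thesis
    using p by (intro Lp_leI_integral fg) (auto simp: add_nonneg_nonneg)
qed

section \<open>Chaining\<close>

locale compact_semimetric =
  fixes w :: "'t \<Rightarrow> 't \<Rightarrow> real"
  assumes w_nonneg: "0 \<le> w t s" and w_refl [simp]: "w t t = 0" and w_sym: "w t s = w s t"
    and w_triangle: "w t u \<le> w t s + w s u"
    and compact: "compact_space (semi_topology w)"
begin

lemma openin_ball: "openin (semi_topology w) {s. w t s < e}"
  unfolding openin_semi_topology
proof clarify
  fix x assume x: "w t x < e"
  have "w t y < e" if "w x y < e - w t x" for y
    using w_triangle[of t y x] that by linarith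
  with x show "\<exists>e'>0. \<forall>y. w x y < e' \<longrightarrow> y \<in> {s. w t s < e}"
    by (intro exI[of _ "e - w t x"]) auto
qed

lemma finite_net:
  assumes "e > 0"
  obtains A where "finite A" "\<And>s. \<exists>t\<in>A. w t s < e"
proof -
  define \<U> where "\<U> = range (\<lambda>t. {s. w t s < e})"
  have "\<forall>U\<in>\<U>. openin (semi_topology w) U" by (auto simp: \<U>_def openin_ball)
  moreover have "UNIV \<subseteq> \<Union>\<U>" using assms w_refl by (auto simp: \<U>_def)
  moreover have "compactin (semi_topology w) UNIV" using compact by (simp add: compact_space_def)
  ultimately obtain \<F> where \<F>: "finite \<F>" "\<F> \<subseteq> \<U>" "\<Union>\<F> = UNIV"
    unfolding compactin_def by (meson top.extremum_unique)
  note \<F>(2)[unfolded \<U>_def]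
  with \<F>(1) obtain A where A: "finite A" "\<F> = (\<lambda>t. {s. w t s < e}) ` A"
    by (auto dest: finite_subset_image)
  have "\<exists>t\<in>A. w t s < e" for s
  proof -
    have "s \<in> \<Union>\<F>" using \<F>(3) by simp
    then show ?thesis unfolding A(2) by auto
  qed
  then show ?thesis using that A(1) by blast
qed

lemma covering_number_net:
  assumes "e > 0"
  shows "\<exists>A. finite A \<and> card A = covering_number w e \<and> (\<forall>s. \<exists>t\<in>A. w t s \<le> e)"
proof -
  obtain A where A: "finite A" "\<And>s. \<exists>t\<in>A. w t s < e" using finite_net[OF assms] by blast
  show ?thesis
    unfolding covering_number_def
    by (rule LeastI[of _ "card A"]) (use A in \<open>force intro: less_imp_le\<close>)
qed

lemma covering_number_le:
  assumes "finite A" "\<And>s. \<exists>t\<in>A. w t s \<le> e"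
  shows "covering_number w e \<le> card A"
  unfolding covering_number_def using assms by (intro Least_le) auto

lemma covering_number_ge_1:
  assumes "e > 0"
  shows "covering_number w e \<ge> 1"
proof -
  obtain A where A: "finite A" "card A = covering_number w e" "\<forall>s. \<exists>t\<in>A. w t s \<le> e"
    using covering_number_net[OF assms] by blast
  from A(3) have "A \<noteq> {}" by blast
  then have "card A > 0" using A(1) by (simp add: card_gt_0_iff)
  then show ?thesis using A(2) by simp
qed

lemma covering_number_antimono:
  assumes "0 < e" "e \<le> e'"
  shows "covering_number w e' \<le> covering_number w e"
proof -
  obtain A where A: "finite A" "card A = covering_number w e" "\<forall>s. \<exists>t\<in>A. w t s \<le> e"
    using covering_number_net[OF assms(1)] by blast
  have "covering_number w e' \<le> card A"
    by (rule covering_number_le[OF A(1)]) (use A(3) assms(2) order_trans in blast)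
  then show ?thesis using A(2) by simp
qed

section \<open>Nets, chains and a deterministic modulus\<close>

definition net :: "nat \<Rightarrow> 't set" where
  "net k = (SOME A. finite A \<and> card A = covering_number w ((1 / 2) ^ k) \<and> (\<forall>s. \<exists>t\<in>A. w t s \<le> (1 / 2) ^ k))"

lemma net: "finite (net k)" "card (net k) = covering_number w ((1 / 2) ^ k)" "\<exists>t\<in>net k. w t s \<le> (1 / 2) ^ k"
proof -
  have "(0::real) < (1 / 2) ^ k" by simp
  from someI_ex[OF covering_number_net[OF this]]
  show "finite (net k)" "card (net k) = covering_number w ((1 / 2) ^ k)" "\<exists>t\<in>net k. w t s \<le> (1 / 2) ^ k"
    unfolding net_def by auto
qed

lemma net_nonempty: "net k \<noteq> {}"
  using net(3) by blast

definition nearest :: "nat \<Rightarrow> 't \<Rightarrow> 't" where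
  "nearest k s = (SOME t. t \<in> net k \<and> w t s \<le> (1 / 2) ^ k)"

lemma nearest: "nearest k s \<in> net k" "w (nearest k s) s \<le> (1 / 2) ^ k"
proof -
  have "\<exists>t. t \<in> net k \<and> w t s \<le> (1 / 2) ^ k" using net(3) by blast
  from someI_ex[OF this] show "nearest k s \<in> net k" "w (nearest k s) s \<le> (1 / 2) ^ k"
    unfolding nearest_def by auto
qed

text \<open>Successive projection through the nets: the recursion counts the levels crossed, so the
  starting point is \<open>nearest (m + j) t\<close>.\<close>

fun chain :: "nat \<Rightarrow> nat \<Rightarrow> 't \<Rightarrow> 't" where
  "chain m 0 t = nearest m t"
| "chain m (Suc j) t = nearest m (chain (Suc m) j t)"

lemma chain_in_net: "chain m j t \<in> net m"
  by (cases j) (auto simp: nearest)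

text \<open>The point \<open>chain m j t\<close> reached at level \<open>m\<close> depends on the starting level \<open>m + j\<close>;
  a limit point exists because the net is finite.\<close>

definition linked :: "nat \<Rightarrow> 't \<Rightarrow> 't \<Rightarrow> bool" where
  "linked m t s \<longleftrightarrow> (\<exists>\<^sub>\<infinity>j. chain m j t = s)"

lemma linked_in_net: "linked m t s \<Longrightarrow> s \<in> net m"
  unfolding linked_def using chain_in_net by (auto simp: INFM_nat)

lemma linked_exists: "\<exists>s. linked m t s"
proof -
  have "range (\<lambda>j. chain m j t) \<subseteq> net m" using chain_in_net by auto
  then have "finite (range (\<lambda>j. chain m j t))" using net(1) finite_subset by blast
  from pigeonhole_infinite[OF infinite_UNIV_nat this] obtain j0 where "infinite {j \<in> UNIV. chain m j t = chain m j0 t}"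
    by blast
  then show ?thesis unfolding linked_def by (auto simp: frequently_cofinite)
qed

text \<open>The sets of points linked to \<open>s\<close> and to \<open>s'\<close> have distance
  zero. Comparing the field at two arbitrary nearby points is reduced to this relation between
  points of a finite net.\<close>

definition adjacent :: "nat \<Rightarrow> 't \<Rightarrow> 't \<Rightarrow> bool" where
  "adjacent m s s' \<longleftrightarrow> (\<forall>\<delta>>0. \<exists>u v. linked m u s \<and> linked m v s' \<and> w u v < \<delta>)"

text \<open>Each of the finitely many pairs of net points that are not adjacent keeps its linked
  sets apart by a positive distance, and the minimum of these distances works. It is determined by
  \<open>w\<close> and the level, not by any random field, hence it serves all \<open>n\<close> at
  once.\<close>

lemma modulus_exists:
  "\<exists>\<delta>>0. \<forall>t t' s s'. linked m t s \<longrightarrow> linked m t' s' \<longrightarrow> w t t' < \<delta> \<longrightarrow> adjacent m s s'"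
proof -
  define J where "J = {(s, s'). s \<in> net m \<and> s' \<in> net m \<and> \<not> adjacent m s s'}"
  have "J \<subseteq> net m \<times> net m" by (auto simp: J_def)
  then have fin: "finite J" by (rule finite_subset) (intro finite_cartesian_product net)
  have "\<forall>z\<in>J. \<exists>\<delta>>0. \<forall>u v. linked m u (fst z) \<longrightarrow> linked m v (snd z) \<longrightarrow> \<not> w u v < \<delta>"
    by (auto simp: J_def adjacent_def)
  then obtain \<delta> where \<delta>: "\<And>z. z \<in> J \<Longrightarrow> \<delta> z > 0"
    "\<And>z u v. z \<in> J \<Longrightarrow> linked m u (fst z) \<Longrightarrow> linked m v (snd z) \<Longrightarrow> \<not> w u v < (\<delta> z :: real)"
    by metis
  \<comment> \<open>The inserted 1 covers the case that all pairs are adjacent.\<close>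
  define \<delta>0 where "\<delta>0 = Min (insert 1 (\<delta> ` J))"
  have "\<delta>0 > 0" using fin \<delta>(1) by (auto simp: \<delta>0_def)
  moreover have "adjacent m s s'" if "linked m t s" "linked m t' s'" "w t t' < \<delta>0" for t t' s s'
  proof (rule ccontr)
    assume "\<not> adjacent m s s'"
    then have J: "(s, s') \<in> J" using that linked_in_net by (auto simp: J_def)
    then have "\<delta>0 \<le> \<delta> (s, s')" using fin by (auto simp: \<delta>0_def)
    moreover have "\<not> w t t' < \<delta> (s, s')" using \<delta>(2)[OF J, of t t'] that by simp
    ultimately show False using that(3) by linarith
  qed
  ultimately show ?thesis by blast
qed

definition modulus :: "nat \<Rightarrow> real" where
  "modulus m = (SOME \<delta>. \<delta> > 0 \<and> (\<forall>t t' s s'. linked m t s \<longrightarrow> linked m t' s' \<longrightarrow> w t t' < \<delta> \<longrightarrow> adjacent m s s'))"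

lemma modulus_pos: "modulus m > 0"
  and modulus_adjacent: "linked m t s \<Longrightarrow> linked m t' s' \<Longrightarrow> w t t' < modulus m \<Longrightarrow> adjacent m s s'"
  using someI_ex[OF modulus_exists[of m]] unfolding modulus_def by blast+

end

text \<open>Here \<open>B\<close> is the constant of the moment bounds, \<sigma> the size of the
  field at a single point, \<open>c\<close> a lower bound for \<tau>, and \<open>E k\<close> stands
  for the entropy weight at radius \<open>(1 / 2) ^ k\<close>. The slack \<open>e\<close> reflects
  that the weight is an infimum over exponents. Only \<open>X\<close> will vary with
  \<open>n\<close>, so every bound expressed by the other parameters is uniform.\<close>

locale entropy_chaining = compact_semimetric w + prob_space M
  for w :: "'t \<Rightarrow> 't \<Rightarrow> real" and M :: "'a measure" +
  fixes I :: "real set" and \<tau> :: "real \<Rightarrow> real" and B \<sigma> c :: real and E :: "nat \<Rightarrow> real"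
    and X :: "'a \<Rightarrow> 't \<Rightarrow> real"
  assumes I: "I \<noteq> {}" "\<And>p. p \<in> I \<Longrightarrow> 1 \<le> p"
    and c: "0 < c" "\<And>p. p \<in> I \<Longrightarrow> c \<le> \<tau> p" and B: "0 \<le> B" and \<sigma>: "0 \<le> \<sigma>"
    and E: "\<And>k. 0 \<le> E k"
      "\<And>k e. 0 < e \<Longrightarrow> \<exists>p\<in>I. real (covering_number w ((1 / 2) ^ k)) powr (1 / p) * \<tau> p \<le> E k + e"
    and E_summable: "summable (\<lambda>k. (1 / 2) ^ k * E (Suc k))"
    and increment: "\<And>p t s. p \<in> I \<Longrightarrow> Lp_le M p (B * \<tau> p * w t s) (\<lambda>\<omega>. X \<omega> t - X \<omega> s)"
    and pointwise: "\<And>p t. p \<in> I \<Longrightarrow> Lp_le M p (B * \<tau> p * \<sigma>) (\<lambda>\<omega>. X \<omega> t)"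
begin

lemma measurable_X [measurable]: "(\<lambda>\<omega>. X \<omega> t) \<in> borel_measurable M"
  using pointwise I(1) by (auto dest: Lp_leD)

text \<open>If \<open>q \<le> p\<close>, the \<open>L q\<close> norm of the maximum is at most its \<open>L p\<close> norm; otherwise
  \<open>N powr (1 / q) \<le> N powr (1 / p)\<close>. Either way a single near-optimal exponent \<open>p\<close> serves all \<open>q\<close>,
  at the price of the factor \<open>\<tau> q / c\<close>.\<close>

lemma Lp_le_Max_entropy:
  assumes F: "finite F" "F \<noteq> {}" "card F \<le> covering_number w ((1 / 2) ^ k)" and a: "0 \<le> a"
    and Y: "\<And>p s. p \<in> I \<Longrightarrow> s \<in> F \<Longrightarrow> Lp_le M p (B * \<tau> p * a) (Y s)" and q: "q \<in> I"
  shows "Lp_le M q (B * (\<tau> q / c) * (a * E k)) (\<lambda>\<omega>. Max ((\<lambda>s. \<bar>Y s \<omega>\<bar>) ` F))"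
proof (rule Lp_le_limit)
  let ?N = "real (covering_number w ((1 / 2) ^ k))" and ?Y = "\<lambda>\<omega>. Max ((\<lambda>s. \<bar>Y s \<omega>\<bar>) ` F)"
  have N1: "?N \<ge> 1" using covering_number_ge_1[of "(1 / 2) ^ k"] by simp
  have N: "real (card F) \<le> ?N" using F(3) by simp
  have q1: "q \<ge> 1" using I(2)[OF q] .
  show "0 < q" using q1 by simp
  have \<tau>q: "1 \<le> \<tau> q / c" "\<tau> q \<ge> 0" using c(1) c(2)[OF q] by auto
  show "?Y \<in> borel_measurable M" using Lp_leD(2)[OF Y[OF q]] F by (intro borel_measurable_Max) auto
  show "0 \<le> B * (\<tau> q / c) * (a * E k)" using B \<tau>q a E(1) by (intro mult_nonneg_nonneg) auto
  fix e :: real assume e: "e > 0"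
  define G where "G = B * (\<tau> q / c) * a"
  have G0: "G \<ge> 0" unfolding G_def using B \<tau>q a by (intro mult_nonneg_nonneg) auto
  \<comment> \<open>Dividing by \<open>G + 1\<close> instead of \<open>G\<close> also covers
    \<open>G = 0\<close>.\<close>
  define e' where "e' = e / (G + 1)"
  have e': "e' > 0" "G * e' \<le> e" using e G0 by (auto simp: e'_def field_simps)
  obtain p where p: "p \<in> I" "?N powr (1 / p) * \<tau> p \<le> E k + e'" using E(2)[OF e'(1)] by blast
  have p1: "p \<ge> 1" using I(2)[OF p(1)] .
  have \<tau>p: "1 \<le> \<tau> p / c" "\<tau> p \<ge> 0" using c(1) c(2)[OF p(1)] by auto
  have "Lp_le M q (G * (?N powr (1 / p) * \<tau> p)) ?Y"
  proof (cases "q \<le> p")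
    case True
    have "Lp_le M p (?N powr (1 / p) * (B * \<tau> p * a)) ?Y"
      using p1 by (intro Lp_le_Max F N Y p) auto
    then have "Lp_le M q (?N powr (1 / p) * (B * \<tau> p * a)) ?Y"
      by (rule Lp_le_exponent_mono) (use True q1 in auto)
    moreover have "?N powr (1 / p) * (B * \<tau> p * a) * 1 \<le> ?N powr (1 / p) * (B * \<tau> p * a) * (\<tau> q / c)"
      using \<tau>q \<tau>p B a by (intro mult_left_mono) auto
    ultimately show ?thesis
      by (elim Lp_le_mono) (use q1 in \<open>simp_all add: G_def mult_ac\<close>)
  next
    case False
    have "Lp_le M q (?N powr (1 / q) * (B * \<tau> q * a)) ?Y"
      using q1 by (intro Lp_le_Max F N Y q) auto
    moreover have "?N powr (1 / q) * (B * \<tau> q * a) * 1 \<le> ?N powr (1 / p) * (B * \<tau> q * a) * (\<tau> p / c)"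
      using \<tau>q \<tau>p B a N1 False p1 by (intro mult_mono powr_mono) (auto simp: field_simps)
    ultimately show ?thesis
      by (elim Lp_le_mono) (use q1 in \<open>simp_all add: G_def mult_ac\<close>)
  qed
  moreover have "G * (?N powr (1 / p) * \<tau> p) \<le> G * E k + G * e'"
    using mult_left_mono[OF p(2) G0] by (simp add: distrib_left)
  ultimately show "Lp_le M q (B * (\<tau> q / c) * (a * E k) + e) ?Y"
    by (elim Lp_le_mono) (use q1 e' in \<open>simp_all add: G_def mult_ac\<close>)
qed

section \<open>Almost sure bounds along chains\<close>

definition link_max :: "nat \<Rightarrow> 'a \<Rightarrow> real" where
  "link_max k \<omega> = Max ((\<lambda>s. \<bar>X \<omega> s - X \<omega> (nearest k s)\<bar>) ` net (Suc k))"

lemma link_max_ge: "s \<in> net (Suc k) \<Longrightarrow> \<bar>X \<omega> s - X \<omega> (nearest k s)\<bar> \<le> link_max k \<omega>"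
  unfolding link_max_def using net(1) by (intro Max_ge) auto

lemma link_max_nonneg: "0 \<le> link_max k \<omega>"
proof -
  obtain s where "s \<in> net (Suc k)" using net_nonempty by blast
  from link_max_ge[OF this] show ?thesis by (rule order_trans[rotated]) simp
qed

text \<open>The links start in \<open>net (Suc k)\<close>, whose size is charged to
  \<open>E (Suc k)\<close>, and end in \<open>net k\<close>, at distance at most
  \<open>(1 / 2) ^ k\<close>. This explains the shift between the two indices.\<close>

lemma Lp_le_link_max:
  assumes "q \<in> I"
  shows "Lp_le M q (B * (\<tau> q / c) * ((1 / 2) ^ k * E (Suc k))) (link_max k)"
  unfolding link_max_def
proof (rule Lp_le_Max_entropy[OF net(1) net_nonempty _ _ _ assms])
  fix p s assume p: "p \<in> I" and "s \<in> net (Suc k)"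
  have "w s (nearest k s) \<le> (1 / 2) ^ k" using nearest(2) w_sym by simp
  moreover have "0 \<le> \<tau> p" using c(1) c(2)[OF p] by simp
  ultimately show "Lp_le M p (B * \<tau> p * (1 / 2) ^ k) (\<lambda>\<omega>. X \<omega> s - X \<omega> (nearest k s))"
    using B I(2)[OF p] by (intro Lp_le_mono[OF increment[OF p]] mult_left_mono) auto
qed (auto simp: net)

definition rest :: "nat \<Rightarrow> real" where
  "rest m = (\<Sum>k. (1 / 2) ^ (m + k) * E (Suc (m + k)))"

definition tail_sum :: "nat \<Rightarrow> 'a \<Rightarrow> real" where
  "tail_sum m \<omega> = (\<Sum>k. link_max (m + k) \<omega>)"

lemma rest_tendsto_0: "rest \<longlonglongrightarrow> 0"
  unfolding rest_def using suminf_exist_split2[OF E_summable] by (simp add: add.commute)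

lemma Lp_le_tail_sum:
  assumes "q \<in> I"
  shows "Lp_le M q (B * (\<tau> q / c) * rest m) (tail_sum m)"
proof -
  have sm: "summable (\<lambda>k. (1 / 2) ^ (m + k) * E (Suc (m + k)))"
    using summable_ignore_initial_segment[OF E_summable, of m] by (simp add: add.commute)
  have "Lp_le M q (\<Sum>k. B * (\<tau> q / c) * ((1 / 2) ^ (m + k) * E (Suc (m + k)))) (\<lambda>\<omega>. \<Sum>k. \<bar>link_max (m + k) \<omega>\<bar>)"
    by (rule Lp_le_suminf(2)[OF _ I(2)[OF assms] summable_mult[OF sm]]) (rule Lp_le_link_max[OF assms])
  then show ?thesis
    unfolding rest_def tail_sum_def using suminf_mult[OF sm, of "B * (\<tau> q / c)"] by (simp add: link_max_nonneg)
qed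

lemma AE_summable_link_max: "AE \<omega> in M. summable (\<lambda>k. link_max k \<omega>)"
proof -
  obtain p where p: "p \<in> I" using I(1) by blast
  from Lp_le_suminf(1)[OF Lp_le_link_max[OF p] I(2)[OF p] summable_mult[OF E_summable]]
  show ?thesis by (simp add: link_max_nonneg)
qed

lemma AE_tail_sum_tendsto_0: "AE \<omega> in M. (\<lambda>m. tail_sum m \<omega>) \<longlonglongrightarrow> 0"
  using AE_summable_link_max
proof eventually_elim
  case (elim \<omega>)
  from suminf_exist_split2[OF elim] show ?case unfolding tail_sum_def by (simp add: add.commute)
qed

text \<open>Telescoping over the links. The level must be generalised in the induction, since
  \<open>chain m (Suc j)\<close> adds one link to \<open>chain (Suc m) j\<close>.\<close>

lemma chain_le_sum:
  "\<bar>X \<omega> (chain m j t) - X \<omega> (nearest (m + j) t)\<bar> \<le> (\<Sum>k<j. link_max (m + k) \<omega>)"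
proof (induction j arbitrary: m)
  case (Suc j)
  have "\<bar>X \<omega> (chain (Suc m) j t) - X \<omega> (chain m (Suc j) t)\<bar> \<le> link_max m \<omega>"
    using link_max_ge[OF chain_in_net[of "Suc m" j t], of \<omega>] by simp
  moreover have "(\<Sum>k<Suc j. link_max (m + k) \<omega>) = link_max m \<omega> + (\<Sum>k<j. link_max (Suc m + k) \<omega>)"
    by (simp only: sum.lessThan_Suc_shift) simp
  ultimately show ?case using Suc[of "Suc m"] by simp
qed simp

text \<open>Geometrically small distances make the increments summable in \<open>L p\<close>, hence
  almost surely summable. This is how limits are taken before paths are known to be
  continuous.\<close>

lemma AE_tendsto_of_summable_distance:
  assumes "\<And>k. w (u k) (v k) \<le> (1 / 2) ^ k"
  shows "AE \<omega> in M. (\<lambda>k. X \<omega> (u k) - X \<omega> (v k)) \<longlonglongrightarrow> 0"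
proof -
  obtain p where p: "p \<in> I" using I(1) by blast
  have "Lp_le M p (B * \<tau> p * (1 / 2) ^ k) (\<lambda>\<omega>. X \<omega> (u k) - X \<omega> (v k))" for k
    using assms B c(1) c(2)[OF p] I(2)[OF p] by (intro Lp_le_mono[OF increment[OF p]] mult_left_mono) auto
  from Lp_le_suminf(1)[OF this I(2)[OF p]]
  have "AE \<omega> in M. summable (\<lambda>k. \<bar>X \<omega> (u k) - X \<omega> (v k)\<bar>)"
    by (simp add: summable_mult summable_geometric)
  then show ?thesis
    by eventually_elim (auto dest!: summable_LIMSEQ_zero simp: tendsto_rabs_zero_iff)
qed

text \<open>A linked point is reached by chains from arbitrarily high levels. Along these, the
  starting value tends to the value at \<open>t\<close>, while the links crossed never cost more
  than the whole tail.\<close>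

lemma AE_linked:
  "AE \<omega> in M. \<forall>m s. linked m t s \<longrightarrow> \<bar>X \<omega> t - X \<omega> s\<bar> \<le> tail_sum m \<omega>"
proof -
  have "AE \<omega> in M. (\<lambda>k. X \<omega> (nearest k t) - X \<omega> t) \<longlonglongrightarrow> 0"
    by (rule AE_tendsto_of_summable_distance) (rule nearest)
  with AE_summable_link_max show ?thesis
  proof eventually_elim
    case (elim \<omega>)
    show ?case
    proof (intro allI impI)
      fix m s assume l: "linked m t s"
      have "summable (\<lambda>k. link_max (m + k) \<omega>)"
        using summable_ignore_initial_segment[OF elim(1), of m] by (simp add: add.commute)
      then have part: "(\<Sum>k<j. link_max (m + k) \<omega>) \<le> tail_sum m \<omega>" for j
        unfolding tail_sum_def by (intro sum_le_suminf) (auto simp: link_max_nonneg)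
      show "\<bar>X \<omega> t - X \<omega> s\<bar> \<le> tail_sum m \<omega>"
      proof (rule field_le_epsilon)
        fix e :: real assume "e > 0"
        from LIMSEQ_D[OF elim(2) this] obtain n0 where n0: "\<And>k. k \<ge> n0 \<Longrightarrow> \<bar>X \<omega> (nearest k t) - X \<omega> t\<bar> < e"
          by auto
        obtain j where j: "j \<ge> n0" "chain m j t = s" using l unfolding linked_def INFM_nat_le by blast
        have "\<bar>X \<omega> s - X \<omega> (nearest (m + j) t)\<bar> \<le> tail_sum m \<omega>"
          using chain_le_sum[of \<omega> m j t] part[of j] j by simp
        with n0[of "m + j"] j show "\<bar>X \<omega> t - X \<omega> s\<bar> \<le> tail_sum m \<omega> + e" by simp
      qed
    qed
  qed
qed

text \<open>Choose linked points \<open>u i\<close> and \<open>v i\<close> at distance below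
  \<open>(1 / 2) ^ i\<close>: their values merge in the limit, and each side contributes one
  \<open>tail_sum\<close>.\<close>

lemma AE_adjacent:
  assumes "adjacent m s s'"
  shows "AE \<omega> in M. \<bar>X \<omega> s - X \<omega> s'\<bar> \<le> 2 * tail_sum m \<omega>"
proof -
  have "\<forall>i. \<exists>u v. linked m u s \<and> linked m v s' \<and> w u v < (1 / 2) ^ i"
    using assms by (auto simp: adjacent_def)
  then obtain u v where uv: "\<And>i. linked m (u i) s" "\<And>i. linked m (v i) s'" "\<And>i. w (u i) (v i) < (1 / 2) ^ i"
    by metis
  have "AE \<omega> in M. (\<lambda>k. X \<omega> (u k) - X \<omega> (v k)) \<longlonglongrightarrow> 0"
    by (rule AE_tendsto_of_summable_distance) (use uv in \<open>auto intro: less_imp_le\<close>)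
  moreover have "AE \<omega> in M. \<forall>i. \<forall>m s. linked m (u i) s \<longrightarrow> \<bar>X \<omega> (u i) - X \<omega> s\<bar> \<le> tail_sum m \<omega>"
    by (subst AE_all_countable) (intro allI AE_linked)
  moreover have "AE \<omega> in M. \<forall>i. \<forall>m s. linked m (v i) s \<longrightarrow> \<bar>X \<omega> (v i) - X \<omega> s\<bar> \<le> tail_sum m \<omega>"
    by (subst AE_all_countable) (intro allI AE_linked)
  ultimately show ?thesis
  proof eventually_elim
    case (elim \<omega>)
    show ?case
    proof (rule field_le_epsilon)
      fix e :: real assume "e > 0"
      from LIMSEQ_D[OF elim(1) this] obtain i where "\<bar>X \<omega> (u i) - X \<omega> (v i)\<bar> < e" by auto
      moreover have "\<bar>X \<omega> (u i) - X \<omega> s\<bar> \<le> tail_sum m \<omega>" "\<bar>X \<omega> (v i) - X \<omega> s'\<bar> \<le> tail_sum m \<omega>"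
        using elim uv by auto
      ultimately show "\<bar>X \<omega> s - X \<omega> s'\<bar> \<le> 2 * tail_sum m \<omega> + e" by linarith
    qed
  qed
qed

lemma AE_all_linked_adjacent:
  assumes "countable D"
  shows "AE \<omega> in M. (\<forall>t\<in>D. \<forall>m s. linked m t s \<longrightarrow> \<bar>X \<omega> t - X \<omega> s\<bar> \<le> tail_sum m \<omega>) \<and>
    (\<forall>m s s'. s \<in> net m \<longrightarrow> s' \<in> net m \<longrightarrow> adjacent m s s' \<longrightarrow> \<bar>X \<omega> s - X \<omega> s'\<bar> \<le> 2 * tail_sum m \<omega>)"
proof (rule AE_conjI)
  show "AE \<omega> in M. \<forall>t\<in>D. \<forall>m s. linked m t s \<longrightarrow> \<bar>X \<omega> t - X \<omega> s\<bar> \<le> tail_sum m \<omega>"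
    using assms by (subst AE_ball_countable) (auto intro: AE_linked)
  have "AE \<omega> in M. \<forall>m. \<forall>z\<in>{z \<in> net m \<times> net m. adjacent m (fst z) (snd z)}. \<bar>X \<omega> (fst z) - X \<omega> (snd z)\<bar> \<le> 2 * tail_sum m \<omega>"
    unfolding AE_all_countable
  proof
    fix m
    show "AE \<omega> in M. \<forall>z\<in>{z \<in> net m \<times> net m. adjacent m (fst z) (snd z)}. \<bar>X \<omega> (fst z) - X \<omega> (snd z)\<bar> \<le> 2 * tail_sum m \<omega>"
    proof (rule AE_finite_allI)
      show "finite {z \<in> net m \<times> net m. adjacent m (fst z) (snd z)}"
        by (rule finite_subset[of _ "net m \<times> net m"]) (auto intro: net)
    qed (auto intro: AE_adjacent)
  qed
  then show "AE \<omega> in M. \<forall>m s s'. s \<in> net m \<longrightarrow> s' \<in> net m \<longrightarrow> adjacent m s s' \<longrightarrow> \<bar>X \<omega> s - X \<omega> s'\<bar> \<le> 2 * tail_sum m \<omega>"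
    by eventually_elim force
qed

definition max_bound :: "'a \<Rightarrow> real" where
  "max_bound \<omega> = Max ((\<lambda>s. \<bar>X \<omega> s\<bar>) ` net 0) + tail_sum 0 \<omega>"

lemma Lp_le_max_bound:
  assumes q: "q \<in> I"
  shows "Lp_le M q (B * (\<tau> q / c) * (\<sigma> * E 0 + rest 0)) max_bound"
proof -
  have "Lp_le M q (B * (\<tau> q / c) * (\<sigma> * E 0)) (\<lambda>\<omega>. Max ((\<lambda>s. \<bar>X \<omega> s\<bar>) ` net 0))"
    by (rule Lp_le_Max_entropy[OF net(1) net_nonempty _ \<sigma> pointwise q]) (use net(2)[of 0] in simp_all)
  from Lp_le_add[OF this Lp_le_tail_sum[OF q, of 0] I(2)[OF q]] show ?thesis
    unfolding max_bound_def by (simp add: distrib_left)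
qed

text \<open>The strict inequality \<open>w t t' < modulus m\<close> leaves room to move both points
  into the separant, where the countably many almost sure bounds hold together. The factor 4 is one
  tail for each descent to the net and two for the adjacent pair.\<close>

lemma separable_bounds:
  assumes "separable_field M w X"
  shows "AE \<omega> in M. \<forall>m t t'. w t t' < modulus m \<longrightarrow> \<bar>X \<omega> t - X \<omega> t'\<bar> \<le> 4 * tail_sum m \<omega>"
    and "AE \<omega> in M. \<forall>t. \<bar>X \<omega> t\<bar> \<le> max_bound \<omega>"
proof -
  obtain D where D: "countable D" and
    sep: "AE \<omega> in M. \<forall>t. \<forall>\<epsilon>>0. \<exists>s\<in>D. w t s < \<epsilon> \<and> \<bar>X \<omega> t - X \<omega> s\<bar> < \<epsilon>"
    using assms by (auto simp: separable_field_def)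
  from sep AE_all_linked_adjacent[OF D]
  show "AE \<omega> in M. \<forall>m t t'. w t t' < modulus m \<longrightarrow> \<bar>X \<omega> t - X \<omega> t'\<bar> \<le> 4 * tail_sum m \<omega>"
  proof eventually_elim
    case (elim \<omega>)
    have lk: "\<bar>X \<omega> t - X \<omega> s\<bar> \<le> tail_sum m \<omega>" if "t \<in> D" "linked m t s" for t m s
      using elim(2) that by blast
    have adj: "\<bar>X \<omega> s - X \<omega> s'\<bar> \<le> 2 * tail_sum m \<omega>" if "s \<in> net m" "s' \<in> net m" "adjacent m s s'" for m s s'
      using elim(2) that by blast
    show ?case
    proof (intro allI impI)
      fix m t t' assume tt: "w t t' < modulus m"
      show "\<bar>X \<omega> t - X \<omega> t'\<bar> \<le> 4 * tail_sum m \<omega>"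
      proof (rule field_le_epsilon)
        fix e :: real assume e: "e > 0"
        define \<epsilon> where "\<epsilon> = min (e / 2) ((modulus m - w t t') / 2)"
        have \<epsilon>: "\<epsilon> > 0" using e tt by (simp add: \<epsilon>_def)
        obtain u where u: "u \<in> D" "w t u < \<epsilon>" "\<bar>X \<omega> t - X \<omega> u\<bar> < \<epsilon>" using elim(1) \<epsilon> by blast
        obtain u' where u': "u' \<in> D" "w t' u' < \<epsilon>" "\<bar>X \<omega> t' - X \<omega> u'\<bar> < \<epsilon>" using elim(1) \<epsilon> by blast
        have le: "\<epsilon> \<le> e / 2" "\<epsilon> \<le> (modulus m - w t t') / 2"
          unfolding \<epsilon>_def by (rule min.cobounded1, rule min.cobounded2)
        have "2 * \<epsilon> \<le> modulus m - w t t'" using le(2) by (simp add: field_simps)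
        then have "w u u' < modulus m"
          using w_triangle[of u u' t] w_triangle[of t u' t'] w_sym[of u t] u(2) u'(2) le by linarith
        obtain s where s: "linked m u s" using linked_exists by blast
        obtain s' where s': "linked m u' s'" using linked_exists by blast
        have "\<bar>X \<omega> s - X \<omega> s'\<bar> \<le> 2 * tail_sum m \<omega>"
          using modulus_adjacent[OF s s' \<open>w u u' < modulus m\<close>] linked_in_net[OF s] linked_in_net[OF s'] by (intro adj)
        with lk[OF u(1) s] lk[OF u'(1) s'] u(3) u'(3) le
        show "\<bar>X \<omega> t - X \<omega> t'\<bar> \<le> 4 * tail_sum m \<omega> + e" by linarith
      qed
    qed
  qed
  from sep AE_all_linked_adjacent[OF D] show "AE \<omega> in M. \<forall>t. \<bar>X \<omega> t\<bar> \<le> max_bound \<omega>"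
  proof eventually_elim
    case (elim \<omega>)
    show ?case
    proof
      fix t
      show "\<bar>X \<omega> t\<bar> \<le> max_bound \<omega>"
      proof (rule field_le_epsilon)
        fix e :: real assume "e > 0"
        then obtain u where u: "u \<in> D" "\<bar>X \<omega> t - X \<omega> u\<bar> < e" using elim(1) by blast
        obtain s where s: "linked 0 u s" using linked_exists by blast
        have "\<bar>X \<omega> u - X \<omega> s\<bar> \<le> tail_sum 0 \<omega>" using elim(2) u(1) s by blast
        moreover have "\<bar>X \<omega> s\<bar> \<le> Max ((\<lambda>s. \<bar>X \<omega> s\<bar>) ` net 0)"
          using linked_in_net[OF s] net(1) by (intro Max_ge) auto
        ultimately show "\<bar>X \<omega> t\<bar> \<le> max_bound \<omega> + e" using u(2) unfolding max_bound_def by linarith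
      qed
    qed
  qed
qed

end

section \<open>Weak convergence in complete metric spaces\<close>

lemma space_borel_on [simp]: "space (borel_on X) = topspace X"
  unfolding borel_on_def by (rule space_measure_of) (auto dest: openin_subset)

lemma sets_borel_on: "sets (borel_on X) = sigma_sets (topspace X) {U. openin X U}"
  unfolding borel_on_def by (rule sets_measure_of) (auto dest: openin_subset)

lemma openin_sets_borel_on [intro]: "openin X U \<Longrightarrow> U \<in> sets (borel_on X)"
  by (auto simp: sets_borel_on)

lemma measurable_borel_onI:
  assumes "\<And>x. x \<in> space N \<Longrightarrow> f x \<in> topspace X"
    "\<And>U. openin X U \<Longrightarrow> f -` U \<inter> space N \<in> sets N"
  shows "f \<in> N \<rightarrow>\<^sub>M borel_on X"
  unfolding borel_on_def using assms by (intro measurable_measure_of) (auto dest: openin_subset)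

lemma continuous_map_borel_measurable:
  assumes "continuous_map X euclideanreal g"
  shows "g \<in> borel_measurable (borel_on X)"
proof (rule borel_measurableI)
  fix S :: "real set" assume "open S"
  then have "openin X {x \<in> topspace X. g x \<in> S}"
    using assms by (auto simp: continuous_map_def)
  moreover have "g -` S \<inter> space (borel_on X) = {x \<in> topspace X. g x \<in> S}" by auto
  ultimately show "g -` S \<inter> space (borel_on X) \<in> sets (borel_on X)" by auto
qed

text \<open>In base 3 with digits 0 and 1, the first differing digit \<open>m\<close> contributes
  \<open>(1 / 3) ^ m\<close>, and all later digits together can cancel at most half of it. Close
  codes therefore share their leading digits, which fails in base 2.\<close>

lemma triadic_digits_eq:
  fixes \<alpha> \<beta> :: "nat \<Rightarrow> bool"
  assumes close: "\<bar>(\<Sum>i. of_bool (\<alpha> i) * (1 / 3) ^ i) - (\<Sum>i. of_bool (\<beta> i) * (1 / 3) ^ i)\<bar> < (1 / 2) * (1 / 3 :: real) ^ n"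
    and "i \<le> n"
  shows "\<alpha> i = \<beta> i"
proof (rule ccontr)
  assume "\<alpha> i \<noteq> \<beta> i"
  define m where "m = (LEAST i. \<alpha> i \<noteq> \<beta> i)"
  have m: "\<alpha> m \<noteq> \<beta> m" unfolding m_def using \<open>\<alpha> i \<noteq> \<beta> i\<close> by (rule LeastI)
  have "m \<le> i" unfolding m_def using \<open>\<alpha> i \<noteq> \<beta> i\<close> by (rule Least_le)
  have lt: "\<alpha> k = \<beta> k" if "k < m" for k using not_less_Least[of k "\<lambda>i. \<alpha> i \<noteq> \<beta> i"] that by (auto simp: m_def)
  have geo: "summable (\<lambda>i. (1 / 3 :: real) ^ i)" by (rule summable_geometric) simp
  have sm: "summable (\<lambda>i. of_bool (\<gamma> i) * (1 / 3 :: real) ^ i)" for \<gamma> :: "nat \<Rightarrow> bool"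
    by (rule summable_comparison_test'[OF geo]) auto
  define e where "e i = (of_bool (\<alpha> i) - of_bool (\<beta> i)) * (1 / 3 :: real) ^ i" for i
  have e: "summable e" unfolding e_def using summable_diff[OF sm[of \<alpha>] sm[of \<beta>]] by (simp add: algebra_simps)
  have eq: "(\<Sum>i. of_bool (\<alpha> i) * (1 / 3) ^ i) - (\<Sum>i. of_bool (\<beta> i) * (1 / 3 :: real) ^ i) = suminf e"
    unfolding e_def using suminf_diff[OF sm[of \<alpha>] sm[of \<beta>]] by (simp add: algebra_simps)
  have "suminf e = (\<Sum>k. e (k + Suc m)) + sum e {..<Suc m}"
    by (rule suminf_split_initial_segment[OF e])
  also have "sum e {..<Suc m} = e m"
    using lt by (simp add: e_def)
  finally have s: "suminf e = (\<Sum>k. e (k + Suc m)) + e m" .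
  have ab: "\<bar>e m\<bar> = (1 / 3) ^ m" using m by (auto simp: e_def)
  have bound: "\<bar>e (k + Suc m)\<bar> \<le> (1 / 3) ^ Suc m * (1 / 3) ^ k" for k
    by (auto simp: e_def power_add)
  have sumg: "summable (\<lambda>k. (1 / 3 :: real) ^ Suc m * (1 / 3) ^ k)" by (intro summable_mult geo)
  have abs: "summable (\<lambda>k. \<bar>e (k + Suc m)\<bar>)"
    by (rule summable_comparison_test'[OF sumg]) (use bound in auto)
  have "\<bar>\<Sum>k. e (k + Suc m)\<bar> \<le> (\<Sum>k. \<bar>e (k + Suc m)\<bar>)" by (rule summable_rabs[OF abs])
  also have "\<dots> \<le> (\<Sum>k. (1 / 3) ^ Suc m * (1 / 3) ^ k)" by (rule suminf_le[OF bound abs sumg])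
  also have "\<dots> = (1 / 3) ^ Suc m * (1 / (1 - 1 / 3))"
    by (subst suminf_mult[OF geo]) (simp add: suminf_geometric)
  also have "\<dots> = (1 / 2) * (1 / 3) ^ m" by simp
  finally have "\<bar>suminf e\<bar> \<ge> (1 / 2) * (1 / 3) ^ m"
    using ab s by linarith
  moreover have "(1 / 3 :: real) ^ n \<le> (1 / 3) ^ m"
    using \<open>m \<le> i\<close> \<open>i \<le> n\<close> by (intro power_decreasing) auto
  ultimately show False using close unfolding eq by simp
qed

context Metric_space
begin

text \<open>The open sets \<open>V k\<close> exhaust \<open>U\<close> with a margin: the limit lies
  in \<open>U\<close> exactly if, for some \<open>k\<close>, the sequence is eventually in
  \<open>V k\<close>. The margin, radius 2 against radius 1 over \<open>Suc k\<close>, keeps the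
  limit inside \<open>U\<close>.\<close>

lemma measurable_limitin:
  assumes f: "\<And>n. f n \<in> N \<rightarrow>\<^sub>M borel_on mtopology"
    and lim: "\<And>x. x \<in> space N \<Longrightarrow> limitin mtopology (\<lambda>n. f n x) (g x) sequentially"
  shows "g \<in> N \<rightarrow>\<^sub>M borel_on mtopology"
proof (rule measurable_borel_onI)
  show "g x \<in> topspace mtopology" if "x \<in> space N" for x
    using limitin_topspace[OF lim[OF that]] .
  fix U assume U: "openin mtopology U"
  define V where "V k = \<Union>{mball z (1 / Suc k) |z. z \<in> M \<and> mball z (2 / Suc k) \<subseteq> U}" for k
  have V: "openin mtopology (V k)" for k unfolding V_def by (intro openin_Union) auto
  have "g -` U \<inter> space N = (\<Union>k. \<Union>n0. \<Inter>n\<in>{n0..}. f n -` V k \<inter> space N)"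
  proof (intro set_eqI iffI)
    fix x assume x: "x \<in> g -` U \<inter> space N"
    then obtain r where r: "r > 0" "mball (g x) r \<subseteq> U" and gM: "g x \<in> M"
      using U unfolding openin_mtopology by blast
    obtain k where k: "2 / real (Suc k) < r"
      using reals_Archimedean[of "r / 2"] r by (auto simp: field_simps)
    have "mball (g x) (2 / real (Suc k)) \<subseteq> U" using k r(2) mball_subset_concentric[of "2 / real (Suc k)" r "g x"] by auto
    then have "mball (g x) (1 / real (Suc k)) \<subseteq> V k" using gM by (auto simp: V_def)
    moreover have "\<exists>n0. \<forall>n\<ge>n0. f n x \<in> mball (g x) (1 / real (Suc k))"
      using lim[of x] x by (auto simp: limitin_metric eventually_sequentially dist_commute commute)
    ultimately obtain n0 where "\<forall>n\<ge>n0. f n x \<in> V k" by blast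
    with x show "x \<in> (\<Union>k. \<Union>n0. \<Inter>n\<in>{n0..}. f n -` V k \<inter> space N)" by auto
  next
    fix x assume "x \<in> (\<Union>k. \<Union>n0. \<Inter>n\<in>{n0..}. f n -` V k \<inter> space N)"
    then obtain k n0 where *: "\<And>n. n \<ge> n0 \<Longrightarrow> f n x \<in> V k" and x: "x \<in> space N" by auto
    have "\<exists>n1. \<forall>n\<ge>n1. f n x \<in> M \<and> d (f n x) (g x) < 1 / real (Suc k)"
      using lim[OF x] unfolding limitin_metric eventually_sequentially by (auto simp del: of_nat_Suc)
    then obtain n1 where n1: "\<And>n. n \<ge> n1 \<Longrightarrow> f n x \<in> M \<and> d (f n x) (g x) < 1 / real (Suc k)" by blast
    define n where "n = max n0 n1"
    obtain z where z: "z \<in> M" "mball z (2 / Suc k) \<subseteq> U" "f n x \<in> mball z (1 / Suc k)"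
      using *[of n] by (auto simp: n_def V_def)
    have gM: "g x \<in> M" using limitin_topspace[OF lim[OF x]] by simp
    have "d z (g x) \<le> d z (f n x) + d (f n x) (g x)" using z gM n1[of n] by (intro triangle) (auto simp: n_def)
    also have "\<dots> < 2 / Suc k" using z(3) n1[of n] by (simp add: n_def field_simps)
    finally show "x \<in> g -` U \<inter> space N" using z gM x by auto
  qed
  moreover have "(\<Union>k. \<Union>n0. \<Inter>n\<in>{n0..}. f n -` V k \<inter> space N) \<in> sets N"
  proof -
    have fV: "f n -` V k \<inter> space N \<in> sets N" for n k
      using V by (intro measurable_sets[OF f]) auto
    have "(\<Inter>n\<in>{n0..}. f n -` V k \<inter> space N) \<in> sets N" for k n0
      using fV by (intro sets.countable_INT') auto
    then show ?thesis by blast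
  qed
  ultimately show "g -` U \<inter> space N \<in> sets N" by simp
qed


lemma measurable_limit_or_default:
  assumes complete: mcomplete and x0: "x0 \<in> M"
    and f: "\<And>n. f n \<in> N \<rightarrow>\<^sub>M borel_on mtopology" and C: "{u \<in> space N. MCauchy (\<lambda>n. f n u)} \<in> sets N"
  obtains g where "g \<in> N \<rightarrow>\<^sub>M borel_on mtopology"
    "\<And>u. u \<in> space N \<Longrightarrow> MCauchy (\<lambda>n. f n u) \<Longrightarrow> limitin mtopology (\<lambda>n. f n u) (g u) sequentially"
proof -
  define h where "h n u = (if MCauchy (\<lambda>n. f n u) then f n u else x0)" for n u
  have "\<exists>l. limitin mtopology (\<lambda>n. h n u) l sequentially" for u
  proof (cases "MCauchy (\<lambda>n. f n u)")
    case True
    then show ?thesis using complete by (auto simp: h_def mcomplete_def)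
  next
    case False
    then show ?thesis using x0 by (intro exI[of _ x0]) (simp add: h_def limitin_metric)
  qed
  then obtain g where g: "\<And>u. limitin mtopology (\<lambda>n. h n u) (g u) sequentially" by metis
  have hm: "h n \<in> N \<rightarrow>\<^sub>M borel_on mtopology" for n
    unfolding h_def using C x0 by (intro measurable_If f measurable_const) auto
  show ?thesis
  proof (rule that[of g])
    show "g \<in> N \<rightarrow>\<^sub>M borel_on mtopology" by (rule measurable_limitin[OF hm g])
    show "limitin mtopology (\<lambda>n. f n u) (g u) sequentially" if "MCauchy (\<lambda>n. f n u)" for u
      using g[of u] that by (simp add: h_def)
  qed
qed

text \<open>A countable family of Borel sets separating points is encoded by a real number, and the code
  has a measurable left inverse. Helly selection and Skorohod representation on the line then
  transfer to the metric space: almost sure convergence of the codes makes membership in each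
  set of the family eventually constant, and tightness supplies sets of small diameter.\<close>

theorem weakly_convergent_subsequence:
  fixes \<mu> :: "nat \<Rightarrow> 'a measure" and A :: "nat \<Rightarrow> 'a set"
  assumes complete: mcomplete
    and \<mu>: "\<And>j. prob_space (\<mu> j)" "\<And>j. sets (\<mu> j) = sets (borel_on mtopology)"
    and A: "\<And>i. A i \<in> sets (borel_on mtopology)"
    and cover: "\<And>x e. x \<in> M \<Longrightarrow> 0 < e \<Longrightarrow> \<exists>i. x \<in> A i \<and> (\<forall>y\<in>A i. \<forall>z\<in>A i. d y z \<le> e)"
    and tight: "\<And>e \<eta>. 0 < e \<Longrightarrow> 0 < \<eta> \<Longrightarrow> \<exists>I. finite I \<and> (\<forall>i\<in>I. \<forall>y\<in>A i. \<forall>z\<in>A i. d y z \<le> e) \<and>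
        (\<forall>j. measure (\<mu> j) (\<Union>i\<in>I. A i) \<ge> 1 - \<eta>)"
  shows "\<exists>\<nu> k. prob_space \<nu> \<and> sets \<nu> = sets (borel_on mtopology) \<and> strict_mono (k :: nat \<Rightarrow> nat) \<and>
    weakly_convergent_to mtopology (\<mu> \<circ> k) \<nu>"
proof -
  let ?B = "borel_on mtopology"
  have AM: "A i \<subseteq> M" for i using sets.sets_into_space[OF A[of i]] by simp
  interpret \<mu>: prob_space "\<mu> j" for j by (rule \<mu>)
  have sp\<mu>: "space (\<mu> j) = M" for j using sets_eq_imp_space_eq[OF \<mu>(2)[of j]] by simp
  obtain x0 where x0: "x0 \<in> M" using \<mu>.not_empty[of 0] sp\<mu> by auto
  define small where "small e i \<longleftrightarrow> (\<forall>y\<in>A i. \<forall>z\<in>A i. d y z \<le> e)" for e i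

  define code where "code x = (\<Sum>i. of_bool (x \<in> A i) * (1 / 3 :: real) ^ i)" for x
  have geo: "summable (\<lambda>i. (1 / 3 :: real) ^ i)" by (rule summable_geometric) simp
  have sm: "summable (\<lambda>i. of_bool (x \<in> A i) * (1 / 3 :: real) ^ i)" for x
    by (rule summable_comparison_test'[OF geo]) auto
  have code_range: "0 \<le> code x" "code x \<le> 3 / 2" for x
  proof -
    show "0 \<le> code x" unfolding code_def by (intro suminf_nonneg sm) auto
    have "code x \<le> (\<Sum>i. (1 / 3 :: real) ^ i)" unfolding code_def by (intro suminf_le sm geo) auto
    also have "\<dots> = 3 / 2" by (subst suminf_geometric) auto
    finally show "code x \<le> 3 / 2" .
  qed
  have code_close: "x \<in> A i \<longleftrightarrow> x' \<in> A i" if "\<bar>code x - code x'\<bar> < (1 / 2) * (1 / 3) ^ n" "i \<le> n" for x x' i n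
    using triadic_digits_eq[of "\<lambda>i. x \<in> A i" "\<lambda>i. x' \<in> A i" n i] that unfolding code_def by simp
  have [measurable]: "Measurable.pred ?B (\<lambda>x. x \<in> A i)" for i
    using A[of i] by (simp add: pred_def Int_def[symmetric] Int_absorb1[OF AM] conj_commute)
  have code_meas [measurable]: "code \<in> borel_measurable ?B"
    unfolding code_def by measurable

  \<comment> \<open>Membership in \<open>A i\<close> is read off the code through an open set of
    reals: codes of points outside \<open>A i\<close> stay at distance at least
    \<open>(1 / 2) * (1 / 3) ^ i\<close> from codes of points inside.\<close>
  define D where "D i = (\<Union>x\<in>A i. ball (code x) ((1 / 2) * (1 / 3) ^ i))" for i
  have D: "code x \<in> D i \<longleftrightarrow> x \<in> A i" for x i
  proof
    assume "code x \<in> D i"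
    then obtain x' where x': "x' \<in> A i" "\<bar>code x' - code x\<bar> < (1 / 2) * (1 / 3) ^ i"
      unfolding D_def by (auto simp: dist_real_def)
    then show "x \<in> A i" using code_close[OF x'(2) order_refl] by blast
  next
    assume "x \<in> A i"
    moreover have "code x \<in> ball (code x) ((1 / 2) * (1 / 3) ^ i)" by simp
    ultimately show "code x \<in> D i" unfolding D_def by blast
  qed
  have [measurable]: "D i \<in> sets borel" for i unfolding D_def by (intro borel_open open_UN) auto

  \<comment> \<open>The decoder at stage \<open>m\<close> picks a point of the first small nonempty
    set whose neighbourhood \<open>D i\<close> contains the given real. For the code of a point
    \<open>x\<close> that set contains \<open>x\<close>, so the choice is within
    \<open>1 / Suc m\<close> of it.\<close>
  define good where "good m y i \<longleftrightarrow> y \<in> D i \<and> small (1 / real (Suc m)) i \<and> A i \<noteq> {}" for m y i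
  define idx where "idx m y = (LEAST i. good m y i)" for m y
  define pt where "pt i = (if A i = {} then x0 else (SOME x. x \<in> A i))" for i
  have ptA: "pt i \<in> A i" if "A i \<noteq> {}" for i using that by (simp add: pt_def some_in_eq)
  have ptM: "pt i \<in> M" for i using ptA[of i] AM[of i] x0 by (cases "A i = {}") (auto simp: pt_def)
  define approx where "approx m y = pt (idx m y)" for m y
  have idx_meas [measurable]: "idx m \<in> borel \<rightarrow>\<^sub>M count_space UNIV" for m
    unfolding idx_def good_def by measurable
  have pt_meas: "pt \<in> count_space UNIV \<rightarrow>\<^sub>M ?B" using ptM by simp
  have approx_meas: "approx m \<in> borel \<rightarrow>\<^sub>M ?B" for m
    unfolding approx_def by (rule measurable_compose[OF idx_meas pt_meas])
  have approx_code: "d (approx m (code x)) x \<le> 1 / real (Suc m)" if x: "x \<in> M" for m x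
  proof -
    have "\<exists>i. good m (code x) i"
      using cover[OF x, of "1 / real (Suc m)"] by (auto simp: good_def D small_def)
    then have "good m (code x) (idx m (code x))" unfolding idx_def by (rule LeastI_ex)
    then show ?thesis using ptA by (auto simp: good_def D small_def approx_def)
  qed
  have "{u \<in> space borel. MCauchy (\<lambda>m. approx m u)} \<in> sets borel"
  proof -
    have eq: "MCauchy (\<lambda>m. approx m u) \<longleftrightarrow> (\<forall>k. \<exists>N. \<forall>i j. N \<le> i \<longrightarrow> N \<le> j \<longrightarrow> d (pt (idx i u)) (pt (idx j u)) < 1 / real (Suc k))" for u
    proof
      assume "MCauchy (\<lambda>m. approx m u)"
      then show "\<forall>k. \<exists>N. \<forall>i j. N \<le> i \<longrightarrow> N \<le> j \<longrightarrow> d (pt (idx i u)) (pt (idx j u)) < 1 / real (Suc k)"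
        by (auto simp: MCauchy_def approx_def simp del: of_nat_Suc)
    next
      assume R: "\<forall>k. \<exists>N. \<forall>i j. N \<le> i \<longrightarrow> N \<le> j \<longrightarrow> d (pt (idx i u)) (pt (idx j u)) < 1 / real (Suc k)"
      show "MCauchy (\<lambda>m. approx m u)"
        unfolding MCauchy_def approx_def
      proof (intro conjI allI impI)
        fix e :: real assume "e > 0"
        then obtain k where k: "1 / real (Suc k) < e" using reals_Archimedean[of e] by (auto simp: inverse_eq_divide)
        from R obtain N where "\<And>i j. N \<le> i \<Longrightarrow> N \<le> j \<Longrightarrow> d (pt (idx i u)) (pt (idx j u)) < 1 / real (Suc k)" by blast
        with k show "\<exists>N. \<forall>n n'. N \<le> n \<longrightarrow> N \<le> n' \<longrightarrow> d (pt (idx n u)) (pt (idx n' u)) < e"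
          by (meson less_trans)
      qed (use ptM in auto)
    qed
    have pm: "Measurable.pred borel (\<lambda>u. d (pt (idx i u)) (pt (idx j u)) < 1 / real (Suc k))" for i j k
    proof (rule measurable_compose_countable[where g = "idx i"])
      show "Measurable.pred borel (\<lambda>u. d (pt a) (pt (idx j u)) < 1 / real (Suc k))" for a
        by (rule measurable_compose[OF idx_meas]) simp
    qed measurable
    show ?thesis unfolding eq by (intro sets.sets_Collect_countable_All sets.sets_Collect_countable_Ex sets.sets_Collect_imp sets.sets_Collect_const)
        (use pm in \<open>auto simp: pred_def\<close>)
  qed
  then obtain decode where decode_meas: "decode \<in> borel \<rightarrow>\<^sub>M ?B" and
    decode: "\<And>u. u \<in> space borel \<Longrightarrow> MCauchy (\<lambda>m. approx m u) \<Longrightarrow> limitin mtopology (\<lambda>m. approx m u) (decode u) sequentially"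
    by (rule measurable_limit_or_default[OF complete x0 approx_meas]) (rule that, assumption, blast)
  have decode_code: "decode (code x) = x" if x: "x \<in> M" for x
  proof -
    have lim: "limitin mtopology (\<lambda>m. approx m (code x)) x sequentially"
      unfolding limitin_metric_dist_null
    proof (intro conjI x always_eventually allI)
      show "approx m (code x) \<in> M" for m using ptM by (simp add: approx_def)
      show "(\<lambda>m. d (approx m (code x)) x) \<longlonglongrightarrow> 0"
        by (rule real_tendsto_sandwich[OF _ _ tendsto_const LIMSEQ_Suc[OF lim_1_over_n]])
          (use approx_code[OF x] in auto)
    qed
    have "MCauchy (\<lambda>m. approx m (code x))"
      by (rule convergent_imp_MCauchy[OF _ lim]) (use ptM in \<open>auto simp: approx_def\<close>)
    from limitin_metric_unique[OF decode[OF _ this] lim] show ?thesis by simp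
  qed

  define law where "law j = distr (\<mu> j) borel code" for j
  have code_\<mu>: "code \<in> borel_measurable (\<mu> j)" for j
    using code_meas by (simp add: measurable_cong_sets[OF \<mu>(2) refl])
  have real_law: "real_distribution (law j)" for j
    unfolding law_def using code_\<mu> by (rule \<mu>.real_distribution_distr)
  \<comment> \<open>All codes lie in [0, 3/2], so their laws are tight on the line. The tightness of
    the original measures enters only in \<open>AEsmall\<close>, to keep the limit inside the
    space.\<close>
  have "tight law"
    unfolding tight_def
  proof (intro conjI allI impI real_law)
    fix \<epsilon> :: real assume "\<epsilon> > 0"
    have "measure (law j) {-1<..2} = 1" for j
    proof -
      have "measure (law j) {-1<..2} = measure (\<mu> j) (code -` {-1<..2} \<inter> space (\<mu> j))"
        unfolding law_def using code_\<mu> by (rule measure_distr) simp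
      also have "code -` {-1<..2} \<inter> space (\<mu> j) = space (\<mu> j)"
      proof -
        have "code x \<in> {-1<..2}" for x using code_range[of x] by simp
        then show ?thesis by auto
      qed
      finally show ?thesis by (simp add: \<mu>.prob_space)
    qed
    then show "\<exists>a b. a < b \<and> (\<forall>j. 1 - \<epsilon> < measure (law j) {a<..b})"
      using \<open>\<epsilon> > 0\<close> by (intro exI[of _ "-1"] exI[of _ 2]) auto
  qed
  from tight_imp_convergent_subsubsequence[OF this strict_mono_id] obtain k L where
    k: "strict_mono k" and L: "real_distribution L" and conv: "weak_conv_m (law \<circ> k) L"
    by (auto simp: comp_def id_def)
  have "real_distribution ((law \<circ> k) n)" for n using real_law by simp
  from Skorohod[OF this L conv] obtain \<Omega> :: "real measure" and Y Y' where
    sk: "prob_space \<Omega> \<and> (\<forall>n. Y n \<in> borel_measurable \<Omega>) \<and> (\<forall>n. distr \<Omega> borel (Y n) = (law \<circ> k) n) \<and>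
      Y' \<in> measurable \<Omega> lborel \<and> distr \<Omega> borel Y' = L \<and> (\<forall>u \<in> space \<Omega>. (\<lambda>n. Y n u) \<longlonglongrightarrow> (Y' u :: real))"
    by (elim exE)
  have Ym: "\<And>n. Y n \<in> borel_measurable \<Omega>" and Yd: "\<And>n. distr \<Omega> borel (Y n) = law (k n)"
    and Yc: "\<And>u. u \<in> space \<Omega> \<Longrightarrow> (\<lambda>n. Y n u) \<longlonglongrightarrow> Y' u" and "prob_space \<Omega>"
    using sk by auto
  interpret \<Omega>: prob_space \<Omega> by fact
  define f where "f n u = decode (Y n u)" for n u
  have fm [measurable]: "f n \<in> \<Omega> \<rightarrow>\<^sub>M ?B" for n
    unfolding f_def by (rule measurable_compose[OF Ym decode_meas])
  have fM: "f n u \<in> M" if "u \<in> space \<Omega>" for n u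
    using measurable_space[OF fm that, of n] by simp
  \<comment> \<open>Since \<open>decode\<close> inverts \<open>code\<close> on the space, decoding
    the Skorohod variables restores the original laws.\<close>
  have fd: "distr \<Omega> ?B (f n) = \<mu> (k n)" for n
  proof -
    have "distr \<Omega> ?B (f n) = distr (distr \<Omega> borel (Y n)) ?B decode"
      using distr_distr[OF decode_meas Ym] by (simp add: f_def[abs_def] comp_def)
    also have "\<dots> = distr (\<mu> (k n)) ?B (decode \<circ> code)"
      unfolding Yd law_def by (rule distr_distr[OF decode_meas code_\<mu>])
    also have "\<dots> = distr (\<mu> (k n)) (\<mu> (k n)) (\<lambda>x. x)"
      by (intro distr_cong) (auto simp: \<mu>(2) sp\<mu> decode_code)
    also have "\<dots> = \<mu> (k n)" by (rule distr_id)
    finally show ?thesis .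
  qed
  have prob_f: "measure \<Omega> {u \<in> space \<Omega>. f n u \<in> S} = measure (\<mu> (k n)) S" if "S \<in> sets ?B" for n S
    using measure_distr[OF fm that, of n] by (simp add: fd vimage_def Int_def conj_commute)
  \<comment> \<open>The Skorohod variables share only their laws with true codes. Being a code is
    expressed by the Borel condition \<open>code (decode y) = y\<close>, which depends on the law
    alone.\<close>
  have "AE u in \<Omega>. Y n u = code (f n u)" for n
  proof -
    have "AE x in \<mu> (k n). code (decode (code x)) = code x"
      by (rule AE_I2) (simp add: sp\<mu> decode_code)
    then have "AE y in distr (\<mu> (k n)) borel code. code (decode y) = y"
      using code_meas decode_meas
      by (subst AE_distr_iff[OF code_\<mu>]) (auto intro!: borel_measurable_eq measurable_compose[OF decode_meas code_meas])
    then have "AE y in distr \<Omega> borel (Y n). code (decode y) = y"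
      unfolding Yd law_def .
    from AE_distrD[OF Ym this] show ?thesis by eventually_elim (simp add: f_def)
  qed
  then have AEcode: "AE u in \<Omega>. \<forall>n. Y n u = code (f n u)" by (simp add: AE_all_countable)
  have AEstable: "AE u in \<Omega>. \<forall>i. \<exists>N. \<forall>n n'. N \<le> n \<longrightarrow> N \<le> n' \<longrightarrow> (f n u \<in> A i \<longleftrightarrow> f n' u \<in> A i)"
    using AEcode AE_space
  proof eventually_elim
    case (elim u)
    have "Cauchy (\<lambda>n. Y n u)" using Yc[OF elim(2)] by (rule LIMSEQ_imp_Cauchy)
    show ?case
    proof
      fix i
      have "(1 / 2) * (1 / 3 :: real) ^ i > 0" by simp
      from CauchyD[OF \<open>Cauchy (\<lambda>n. Y n u)\<close> this] obtain N where
        N: "\<And>n n'. N \<le> n \<Longrightarrow> N \<le> n' \<Longrightarrow> \<bar>Y n u - Y n' u\<bar> < (1 / 2) * (1 / 3) ^ i"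
        by auto
      have "f n u \<in> A i \<longleftrightarrow> f n' u \<in> A i" if "N \<le> n" "N \<le> n'" for n n'
        using code_close[of "f n u" "f n' u" i i] N[OF that] elim(1) by simp
      then show "\<exists>N. \<forall>n n'. N \<le> n \<longrightarrow> N \<le> n' \<longrightarrow> (f n u \<in> A i \<longleftrightarrow> f n' u \<in> A i)" by blast
    qed
  qed
  \<comment> \<open>Missing \<open>W l\<close> from time \<open>N\<close> on has probability at most
    \<open>1 / Suc l\<close>. These events increase with \<open>N\<close>, so their union obeys the
    same bound, and the intersection over \<open>l\<close> is null. Outside it some finite union
    \<open>W l\<close> is visited infinitely often, hence so is one of its sets.\<close>
  have AEsmall: "AE u in \<Omega>. \<exists>i. small e i \<and> (\<exists>\<^sub>\<infinity>n. f n u \<in> A i)" if e: "e > 0" for e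
  proof -
    have "\<forall>l. \<exists>I. finite I \<and> (\<forall>i\<in>I. small e i) \<and> (\<forall>j. measure (\<mu> j) (\<Union>i\<in>I. A i) \<ge> 1 - 1 / real (Suc l))"
      using tight[OF e] by (simp add: small_def)
    then obtain I where I: "\<And>l. finite (I l)" "\<And>l i. i \<in> I l \<Longrightarrow> small e i"
      "\<And>l j. measure (\<mu> j) (\<Union>i\<in>I l. A i) \<ge> 1 - 1 / real (Suc l)" by metis
    define W where "W l = (\<Union>i\<in>I l. A i)" for l
    have W: "W l \<in> sets ?B" for l unfolding W_def using A I(1) by (intro sets.finite_UN) auto
    define bad where "bad l N = {u \<in> space \<Omega>. \<forall>n\<ge>N. f n u \<notin> W l}" for l N
    have badm: "bad l N \<in> sets \<Omega>" for l N
    proof -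
      have "bad l N = space \<Omega> - (\<Union>n\<in>{N..}. f n -` W l \<inter> space \<Omega>)" by (auto simp: bad_def)
      also have "\<dots> \<in> sets \<Omega>" using W by (intro sets.Diff sets.top sets.countable_UN'') (auto intro: measurable_sets[OF fm])
      finally show ?thesis .
    qed
    have badp: "emeasure \<Omega> (bad l N) \<le> ennreal (1 / real (Suc l))" for l N
    proof -
      have "measure \<Omega> (bad l N) \<le> measure \<Omega> (space \<Omega> - (f N -` W l \<inter> space \<Omega>))"
        using W by (intro \<Omega>.finite_measure_mono) (auto simp: bad_def intro: measurable_sets[OF fm])
      also have "\<dots> = 1 - measure \<Omega> (f N -` W l \<inter> space \<Omega>)"
        using W by (intro \<Omega>.prob_compl) (auto intro: measurable_sets[OF fm])
      also have "measure \<Omega> (f N -` W l \<inter> space \<Omega>) = measure (\<mu> (k N)) (W l)"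
        using prob_f[OF W, of N l] by (simp add: vimage_def Int_def conj_commute)
      finally show ?thesis using I(3)[of l "k N"] by (simp add: W_def \<Omega>.emeasure_eq_measure ennreal_leI)
    qed
    define Bad where "Bad l = (\<Union>N. bad l N)" for l
    have Badm: "Bad l \<in> sets \<Omega>" for l unfolding Bad_def using badm by auto
    have Badp: "emeasure \<Omega> (Bad l) \<le> ennreal (1 / real (Suc l))" for l
    proof -
      have "emeasure \<Omega> (Bad l) = (SUP N. emeasure \<Omega> (bad l N))"
        unfolding Bad_def
      proof (rule SUP_emeasure_incseq[symmetric])
        show "range (bad l) \<subseteq> sets \<Omega>" using badm by blast
        show "incseq (bad l)" unfolding incseq_def bad_def by (blast intro: order_trans)
      qed
      also have "\<dots> \<le> ennreal (1 / real (Suc l))" by (rule SUP_least) (rule badp)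
      finally show ?thesis .
    qed
    have "emeasure \<Omega> (\<Inter>l. Bad l) \<le> ennreal (1 / real (Suc l))" for l
      by (rule order_trans[OF emeasure_mono Badp]) (use Badm in auto)
    moreover have "(\<lambda>l. ennreal (1 / real (Suc l))) \<longlonglongrightarrow> ennreal 0"
      by (intro tendsto_ennrealI LIMSEQ_Suc lim_1_over_n)
    ultimately have "emeasure \<Omega> (\<Inter>l. Bad l) \<le> ennreal 0"
      by (intro LIMSEQ_le_const) auto
    then have "(\<Inter>l. Bad l) \<in> null_sets \<Omega>" using Badm by (auto simp: null_sets_def)
    from AE_not_in[OF this] AE_space show ?thesis
    proof eventually_elim
      case (elim u)
      then obtain l where "u \<notin> Bad l" by auto
      then have "\<forall>N. \<exists>n\<ge>N. f n u \<in> W l" using elim(2) by (auto simp: Bad_def bad_def)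
      then have "\<exists>\<^sub>\<infinity>n. \<exists>i\<in>I l. f n u \<in> A i" unfolding W_def INFM_nat_le by simp
      then obtain i where "i \<in> I l" "\<exists>\<^sub>\<infinity>n. f n u \<in> A i" using frequently_bex_finite_distrib[OF I(1)[of l], of "\<lambda>n i. f n u \<in> A i" cofinite] by blast
      then show ?case using I(2) by blast
    qed
  qed
  have "AE u in \<Omega>. \<forall>m. \<exists>i. small (1 / real (Suc m)) i \<and> (\<exists>\<^sub>\<infinity>n. f n u \<in> A i)"
    by (subst AE_all_countable) (intro allI AEsmall, simp)
  with AEstable AE_space have AECauchy: "AE u in \<Omega>. MCauchy (\<lambda>n. f n u)"
  proof eventually_elim
    case (elim u)
    show ?case
      unfolding MCauchy_def
    proof (intro conjI allI impI)
      show "range (\<lambda>n. f n u) \<subseteq> M" using fM[OF elim(2)] by auto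
      fix e :: real assume "e > 0"
      then obtain m where m: "1 / real (Suc m) < e" using reals_Archimedean[of e] by (auto simp: inverse_eq_divide)
      obtain i where i: "small (1 / real (Suc m)) i" "\<exists>\<^sub>\<infinity>n. f n u \<in> A i" using elim(3) by blast
      obtain N where N: "\<And>n n'. N \<le> n \<Longrightarrow> N \<le> n' \<Longrightarrow> f n u \<in> A i \<longleftrightarrow> f n' u \<in> A i" using elim(1) by blast
      obtain n0 where n0: "N \<le> n0" "f n0 u \<in> A i" using i(2) unfolding INFM_nat_le by blast
      have "d (f n u) (f n' u) < e" if "N \<le> n" "N \<le> n'" for n n'
        using N[OF that(1) n0(1)] N[OF that(2) n0(1)] n0(2) i(1) m unfolding small_def by (meson le_less_trans)
      then show "\<exists>N. \<forall>n n'. N \<le> n \<longrightarrow> N \<le> n' \<longrightarrow> d (f n u) (f n' u) < e" by blast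
    qed
  qed
  \<comment> \<open>On a null set the sequence is replaced by the constant \<open>x0\<close>, so
    that it is Cauchy at every point and its limit is a measurable map on the whole space.\<close>
  obtain N0 where N0: "N0 \<in> null_sets \<Omega>" "{u \<in> space \<Omega>. \<not> MCauchy (\<lambda>n. f n u)} \<subseteq> N0"
    using AECauchy unfolding eventually_ae_filter by auto
  define f' where "f' n u = (if u \<in> N0 then x0 else f n u)" for n u
  have f'm: "f' n \<in> \<Omega> \<rightarrow>\<^sub>M ?B" for n
    unfolding f'_def using N0(1) x0 by (intro measurable_If_set fm measurable_const) (auto simp: sets.Int_space_eq2)
  have f'Cauchy: "MCauchy (\<lambda>n. f' n u)" if "u \<in> space \<Omega>" for u
  proof (cases "u \<in> N0")
    case True
    then show ?thesis using x0 by (auto simp: f'_def MCauchy_def)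
  next
    case False
    then have "MCauchy (\<lambda>n. f n u)" using that N0(2) by blast
    then show ?thesis using False by (simp add: f'_def)
  qed
  then have eq: "{u \<in> space \<Omega>. MCauchy (\<lambda>n. f' n u)} = space \<Omega>" by auto
  obtain g where gm: "g \<in> \<Omega> \<rightarrow>\<^sub>M ?B" and
    g: "\<And>u. u \<in> space \<Omega> \<Longrightarrow> limitin mtopology (\<lambda>n. f' n u) (g u) sequentially"
  proof (rule measurable_limit_or_default[OF complete x0 f'm])
    show "{u \<in> space \<Omega>. MCauchy (\<lambda>n. f' n u)} \<in> sets \<Omega>" by (simp add: eq)
    fix g assume "g \<in> \<Omega> \<rightarrow>\<^sub>M ?B"
      and "\<And>u. u \<in> space \<Omega> \<Longrightarrow> MCauchy (\<lambda>n. f' n u) \<Longrightarrow> limitin mtopology (\<lambda>n. f' n u) (g u) sequentially"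
    then show thesis using f'Cauchy by (intro that) auto
  qed
  show ?thesis
  proof (intro exI[of _ "distr \<Omega> ?B g"] exI[of _ k] conjI k)
    show "prob_space (distr \<Omega> ?B g)" using gm by (rule \<Omega>.prob_space_distr)
    show "sets (distr \<Omega> ?B g) = sets ?B" by simp
    show "weakly_convergent_to mtopology (\<mu> \<circ> k) (distr \<Omega> ?B g)"
      unfolding weakly_convergent_to_def
    proof (intro allI impI)
      fix \<phi> :: "'a \<Rightarrow> real"
      assume \<phi>: "continuous_map mtopology euclideanreal \<phi>" and "bounded (\<phi> ` topspace mtopology)"
      then obtain C where C: "\<And>x. x \<in> M \<Longrightarrow> \<bar>\<phi> x\<bar> \<le> C" by (auto simp: bounded_iff)
      have \<phi>m: "\<phi> \<in> borel_measurable ?B" using \<phi> by (rule continuous_map_borel_measurable)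
      have gM: "g u \<in> M" if "u \<in> space \<Omega>" for u using measurable_space[OF gm that] by simp
      have "(\<lambda>n. \<integral>u. \<phi> (f n u) \<partial>\<Omega>) \<longlonglongrightarrow> (\<integral>u. \<phi> (g u) \<partial>\<Omega>)"
      proof (rule integral_dominated_convergence[where w = "\<lambda>_. C"])
        show "(\<lambda>u. \<phi> (g u)) \<in> borel_measurable \<Omega>" by (rule measurable_compose[OF gm \<phi>m])
        show "(\<lambda>u. \<phi> (f n u)) \<in> borel_measurable \<Omega>" for n by (rule measurable_compose[OF fm \<phi>m])
        show "AE u in \<Omega>. norm (\<phi> (f n u)) \<le> C" for n using C fM by (auto intro!: AE_I2)
        show "AE u in \<Omega>. (\<lambda>n. \<phi> (f n u)) \<longlonglongrightarrow> \<phi> (g u)"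
          using AE_not_in[OF N0(1)] AE_space
        proof eventually_elim
          case (elim u)
          have "limitin mtopology (\<lambda>n. f n u) (g u) sequentially"
            using g[OF elim(2)] elim(1) by (simp add: f'_def)
          from continuous_map_limit[OF \<phi> this] show ?case by (simp add: comp_def)
        qed
      qed simp
      moreover have "(\<integral>x. \<phi> x \<partial>(\<mu> \<circ> k) n) = (\<integral>u. \<phi> (f n u) \<partial>\<Omega>)" for n
        using integral_distr[OF fm \<phi>m, of n] by (simp add: fd)
      moreover have "(\<integral>x. \<phi> x \<partial>distr \<Omega> ?B g) = (\<integral>u. \<phi> (g u) \<partial>\<Omega>)"
        by (rule integral_distr[OF gm \<phi>m])
      ultimately show "(\<lambda>n. \<integral>x. \<phi> x \<partial>(\<mu> \<circ> k) n) \<longlonglongrightarrow> (\<integral>x. \<phi> x \<partial>distr \<Omega> ?B g)" by simp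
    qed
  qed
qed

end

section \<open>Laws on the space of continuous functions\<close>

declare mspace_cfunspace [simp del]

lemma sets_completion_Collect_cong:
  assumes "AE x in M. P x \<longleftrightarrow> Q x" "{x \<in> space M. Q x} \<in> sets M"
  shows "{x \<in> space (completion M). P x} \<in> sets (completion M)"
proof (rule completion.in_sets_AE)
  show "AE x in completion M. x \<in> {x \<in> space M. Q x} \<longleftrightarrow> x \<in> {x \<in> space (completion M). P x}"
    using AE_completion[OF assms(1)] by eventually_elim auto
qed (use assms(2) in auto)

lemma sets_Collect_Ball_countable:
  assumes "countable D" "\<And>t. t \<in> D \<Longrightarrow> {\<omega> \<in> space M. P t \<omega>} \<in> sets M"
  shows "{\<omega> \<in> space M. \<forall>t\<in>D. P t \<omega>} \<in> sets M"
proof -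
  have "{\<omega> \<in> space M. \<forall>t\<in>D. P t \<omega>} = space M - (\<Union>t\<in>D. space M - {\<omega> \<in> space M. P t \<omega>})" by auto
  also have "\<dots> \<in> sets M" using assms by (intro sets.Diff sets.top sets.countable_UN') auto
  finally show ?thesis .
qed

lemma (in prob_space) Lp_le_tail_1:
  assumes f: "Lp_le M p a f" and p: "p \<ge> 1" and y: "y > 0"
  shows "prob {\<omega>\<in>space M. y < \<bar>f \<omega>\<bar>} \<le> a / y"
proof -
  have "(a / y) powr 1 = a / y" using Lp_leD(1)[OF f] y by simp
  moreover have "Lp_le M 1 a f" using Lp_le_exponent_mono[OF f, of 1] p by simp
  ultimately show ?thesis using Lp_le_tail[of 1 a f y] y by simp
qed

context compact_semimetric
begin

lemma continuous_iff:
  "continuous_map (semi_topology w) euclideanreal f \<longleftrightarrow>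
     (\<forall>t. \<forall>e>0. \<exists>\<delta>>0. \<forall>s. w t s < \<delta> \<longrightarrow> \<bar>f s - f t\<bar> < e)"
proof
  assume f: "continuous_map (semi_topology w) euclideanreal f"
  show "\<forall>t. \<forall>e>0. \<exists>\<delta>>0. \<forall>s. w t s < \<delta> \<longrightarrow> \<bar>f s - f t\<bar> < e"
  proof (intro allI impI)
    fix t and e :: real assume "e > 0"
    have "openin (semi_topology w) {x \<in> topspace (semi_topology w). f x \<in> ball (f t) e}"
      using f by (rule openin_continuous_map_preimage) simp
    with \<open>e > 0\<close> show "\<exists>\<delta>>0. \<forall>s. w t s < \<delta> \<longrightarrow> \<bar>f s - f t\<bar> < e"
      unfolding openin_semi_topology by (auto simp: dist_real_def abs_minus_commute)
  qed
next
  assume R: "\<forall>t. \<forall>e>0. \<exists>\<delta>>0. \<forall>s. w t s < \<delta> \<longrightarrow> \<bar>f s - f t\<bar> < e"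
  show "continuous_map (semi_topology w) euclideanreal f"
    unfolding continuous_map_def
  proof (intro conjI allI impI)
    fix U :: "real set" assume "openin euclideanreal U"
    then have "open U" by simp
    show "openin (semi_topology w) {x \<in> topspace (semi_topology w). f x \<in> U}"
      unfolding openin_semi_topology
    proof clarsimp
      fix x assume "f x \<in> U"
      then obtain e where e: "e > 0" "ball (f x) e \<subseteq> U" using \<open>open U\<close> open_contains_ball by blast
      from R e(1) obtain \<delta> where "\<delta> > 0" "\<And>s. w x s < \<delta> \<Longrightarrow> \<bar>f s - f x\<bar> < e" by blast
      with e(2) show "\<exists>e>0. \<forall>y. w x y < e \<longrightarrow> f y \<in> U"
        by (intro exI[of _ \<delta>]) (auto simp: subset_iff dist_real_def abs_minus_commute)
    qed
  qed simp
qed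

lemma uniformly_continuous:
  assumes f: "continuous_map (semi_topology w) euclideanreal f" and e: "e > 0"
  obtains \<delta> where "\<delta> > 0" "\<And>t s. w t s < \<delta> \<Longrightarrow> \<bar>f t - f s\<bar> < e"
proof -
  have "\<forall>t. \<exists>\<delta>>0. \<forall>s. w t s < \<delta> \<longrightarrow> \<bar>f s - f t\<bar> < e / 2"
    using f e unfolding continuous_iff by (metis half_gt_zero)
  then obtain \<delta> where \<delta>: "\<And>t. \<delta> t > 0" "\<And>t s. w t s < \<delta> t \<Longrightarrow> \<bar>f s - f t\<bar> < e / 2" by metis
  define \<U> where "\<U> = range (\<lambda>t. {s. w t s < \<delta> t / 2})"
  have "\<forall>U\<in>\<U>. openin (semi_topology w) U"
    unfolding \<U>_def by (intro ballI) (elim rangeE, simp only: openin_ball)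
  moreover have "UNIV \<subseteq> \<Union>\<U>" using \<delta>(1) w_refl by (auto simp: \<U>_def)
  moreover have "compactin (semi_topology w) UNIV" using compact by (simp add: compact_space_def)
  ultimately obtain \<F> where \<F>: "finite \<F>" "\<F> \<subseteq> \<U>" "\<Union>\<F> = UNIV"
    unfolding compactin_def by (meson top.extremum_unique)
  from \<F>(1,2) obtain A where A: "finite A" "\<F> = (\<lambda>t. {s. w t s < \<delta> t / 2}) ` A"
    unfolding \<U>_def by (auto dest: finite_subset_image)
  define \<delta>0 where "\<delta>0 = Min (insert 1 ((\<lambda>t. \<delta> t / 2) ` A))"
  have "\<delta>0 > 0" using A(1) \<delta>(1) by (auto simp: \<delta>0_def)
  moreover have "\<bar>f t - f s\<bar> < e" if ts: "w t s < \<delta>0" for t s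
  proof -
    have "t \<in> \<Union>\<F>" using \<F>(3) by simp
    then obtain u where u: "u \<in> A" "w u t < \<delta> u / 2" unfolding A(2) by auto
    have "\<delta>0 \<le> \<delta> u / 2" unfolding \<delta>0_def using A(1) u(1) by (intro Min_le) auto
    then have "w u s < \<delta> u" using w_triangle[of u s t] u(2) ts by linarith
    moreover have "w u t < \<delta> u" using u(2) \<delta>(1)[of u] by linarith
    ultimately show ?thesis using \<delta>(2)[of u s] \<delta>(2)[of u t] by linarith
  qed
  ultimately show ?thesis using that by blast
qed

section \<open>The metric of \<open>C(T,w)\<close> and its countable family of cells\<close>

abbreviation "CF \<equiv> cfunspace (semi_topology w) euclidean_metric :: ('t \<Rightarrow> real) metric"

lemma mspace_CF: "mspace CF = {f. continuous_map (semi_topology w) euclideanreal f}"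
proof -
  have "compactin (semi_topology w) (topspace (semi_topology w))" using compact by (simp add: compact_space_def)
  from compactin_mspace_cfunspace[OF this, of euclidean_metric] show ?thesis by simp
qed

lemma topspace_C_space: "topspace (C_space w) = {f. continuous_map (semi_topology w) euclideanreal f}"
  by (simp add: C_space_def mspace_CF )

lemma mdist_CF_le:
  assumes "f \<in> mspace CF" "g \<in> mspace CF"
  shows "mdist CF f g \<le> a \<longleftrightarrow> (\<forall>t. \<bar>f t - g t\<bar> \<le> a)"
  using cfunspace_mdist_le[OF assms] by (simp add: dist_real_def)

lemma Metric_space_CF: "Metric_space (mspace CF) (mdist CF)"
  by (rule Metric_space_mspace_mdist)

lemma C_space_eq: "C_space w = Metric_space.mtopology (mspace CF) (mdist CF)"
  by (simp only: C_space_def mtopology_of_def)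

lemma mcomplete_CF: "Metric_space.mcomplete (mspace CF) (mdist CF)"
proof -
  have "Met_TC.mcomplete (TYPE(real))" by (simp add: mcomplete_iff_complete complete_UNIV)
  then show ?thesis
    using Met_TC.mcomplete_cfunspace[where ?'a = real, of "semi_topology w"]
    unfolding mcomplete_of_def euclidean_metric_def Met_TC.Self_def by simp
qed

lemma continuous_map_eval: "continuous_map (C_space w) euclideanreal (\<lambda>f. f t)"
proof -
  interpret CF: Metric_space "mspace CF" "mdist CF" by (rule Metric_space_CF)
  show ?thesis
    unfolding continuous_map_def
  proof (intro conjI allI impI)
    fix U :: "real set" assume "openin euclideanreal U"
    then have U: "open U" by simp
    show "openin (C_space w) {f \<in> topspace (C_space w). f t \<in> U}"
      unfolding C_space_eq CF.openin_mtopology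
    proof (intro conjI allI impI)
      fix f assume "f \<in> {f \<in> topspace CF.mtopology. f t \<in> U}"
      then have f: "f \<in> mspace CF" "f t \<in> U" by auto
      obtain e where e: "e > 0" "ball (f t) e \<subseteq> U" using U f(2) open_contains_ball by blast
      have "CF.mball f e \<subseteq> {f \<in> topspace CF.mtopology. f t \<in> U}"
      proof
        fix g assume "g \<in> CF.mball f e"
        then have g: "g \<in> mspace CF" "mdist CF f g < e" by (auto)
        then have "\<bar>f t - g t\<bar> < e"
          using mdist_CF_le[OF f(1) g(1), of "mdist CF f g"] by (meson le_less_trans order_refl)
        then have "g t \<in> U" using e(2) by (auto simp: dist_real_def)
        with g(1) show "g \<in> {f \<in> topspace CF.mtopology. f t \<in> U}" by simp
      qed
      with e(1) show "\<exists>r>0. CF.mball f r \<subseteq> {f \<in> topspace CF.mtopology. f t \<in> U}" by blast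
    qed auto
  qed simp
qed

text \<open>Functions with a prescribed oscillation and with values quantised on a finite net. There
  are countably many such sets of any given precision, they are Borel and cover the space, which is
  what the compactness theorem asks for. The factor 2 lets the strict condition on \<open>w\<close>
  include points at distance exactly \<open>(1 / 2) ^ k\<close>, the net radius.\<close>

definition cell :: "nat \<times> nat \<times> ('t \<Rightarrow> int) \<Rightarrow> ('t \<Rightarrow> real) set" where
  "cell = (\<lambda>(m, k, z). {f. continuous_map (semi_topology w) euclideanreal f \<and>
     (\<forall>t t'. w t t' < 2 * (1 / 2) ^ k \<longrightarrow> \<bar>f t - f t'\<bar> \<le> 1 / real (Suc m)) \<and>
     (\<forall>s\<in>net k. \<lfloor>f s * real (Suc m)\<rfloor> = z s)})"

definition cell_indices :: "(nat \<times> nat \<times> ('t \<Rightarrow> int)) set" where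
  "cell_indices = Sigma UNIV (\<lambda>m. Sigma UNIV (\<lambda>k. net k \<rightarrow>\<^sub>E UNIV))"

lemma countable_cell_indices: "countable cell_indices"
  unfolding cell_indices_def by (intro countable_SIGMA countable_PiE) (auto simp: net)

text \<open>Of the three units \<open>1 / Suc m\<close>, two are the oscillations of
  \<open>f\<close> and \<open>g\<close> between \<open>t\<close> and its nearest net point, and one
  is the quantisation error there.\<close>

lemma cell_diameter:
  assumes "f \<in> cell (m, k, z)" "g \<in> cell (m, k, z)"
  shows "mdist CF f g \<le> 3 / real (Suc m)"
proof -
  have "\<bar>f t - g t\<bar> \<le> 3 / real (Suc m)" for t
  proof -
    let ?s = "nearest k t"
    have "w ?s t < 2 * (1 / 2) ^ k" using nearest(2)[of k t] by (rule le_less_trans) simp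
    then have 1: "\<bar>f ?s - f t\<bar> \<le> 1 / real (Suc m)" "\<bar>g ?s - g t\<bar> \<le> 1 / real (Suc m)"
      using assms unfolding cell_def by blast+
    have "\<lfloor>f ?s * real (Suc m)\<rfloor> = \<lfloor>g ?s * real (Suc m)\<rfloor>"
      using assms nearest(1)[of k t] unfolding cell_def by auto
    then have "\<bar>f ?s * real (Suc m) - g ?s * real (Suc m)\<bar> < 1" by linarith
    then have "\<bar>f ?s - g ?s\<bar> * real (Suc m) < 1"
      by (simp add: left_diff_distrib[symmetric] abs_mult del: of_nat_Suc)
    then have "\<bar>f ?s - g ?s\<bar> < 1 / real (Suc m)" by (simp add: less_divide_eq)
    moreover have "3 / real (Suc m) = 3 * (1 / real (Suc m))" by simp
    ultimately show ?thesis using 1 by linarith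
  qed
  moreover have "f \<in> mspace CF" "g \<in> mspace CF" using assms by (auto simp: cell_def mspace_CF)
  ultimately show ?thesis by (simp add: mdist_CF_le )
qed

lemma cell_subset: "cell i \<subseteq> mspace CF"
  unfolding mspace_CF by (cases i) (auto simp: cell_def)

lemma cell_cover:
  assumes f: "continuous_map (semi_topology w) euclideanreal f"
  obtains k z where "(m, k, z) \<in> cell_indices" "f \<in> cell (m, k, z)"
proof -
  obtain \<delta> where \<delta>: "\<delta> > 0" "\<And>t s. w t s < \<delta> \<Longrightarrow> \<bar>f t - f s\<bar> < 1 / real (Suc m)"
    using uniformly_continuous[OF f, of "1 / real (Suc m)"] by auto
  obtain k where k: "(1 / 2) ^ k < \<delta> / 2" using real_arch_pow_inv[of "\<delta> / 2" "1 / 2"] \<delta>(1) by auto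
  let ?z = "\<lambda>s\<in>net k. \<lfloor>f s * real (Suc m)\<rfloor>"
  have "f \<in> cell (m, k, ?z)"
    unfolding cell_def using f \<delta>(2) k by (auto intro!: less_imp_le simp del: of_nat_Suc)
  then show ?thesis using that[of k ?z] by (auto simp: cell_indices_def)
qed

text \<open>The oscillation condition ranges over uncountably many pairs, but each pair defines a
  closed set, so the intersection is closed. The condition on values concerns the finite net
  only.\<close>

lemma cell_measurable: "cell i \<in> sets (borel_on (C_space w))"
proof -
  obtain m k z where i: "i = (m, k, z)" by (cases i)
  define R where "R = {(t, t'). w t t' < 2 * (1 / 2) ^ k}"
  define F where "F = (\<lambda>(t, t'). {f \<in> topspace (C_space w). f t - f t' \<in> {- (1 / real (Suc m))..1 / real (Suc m)}})"
  have cl: "closedin (C_space w) (F r)" for r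
    unfolding F_def case_prod_unfold
    by (intro closedin_continuous_map_preimage[where Y = euclideanreal] continuous_map_diff continuous_map_eval) auto
  \<comment> \<open>Nonemptiness of \<open>R\<close> keeps the intersection inside the
    space.\<close>
  have "(t, t) \<in> R" for t by (simp add: R_def)
  then have "R \<noteq> {}" by blast
  then have "closedin (C_space w) (\<Inter>r\<in>R. F r)" using cl by (intro closedin_Inter) auto
  then have 1: "(\<Inter>r\<in>R. F r) \<in> sets (borel_on (C_space w))"
  proof -
    assume "closedin (C_space w) (\<Inter>r\<in>R. F r)"
    then have "(\<Inter>r\<in>R. F r) = space (borel_on (C_space w)) - (topspace (C_space w) - (\<Inter>r\<in>R. F r))"
      by (auto dest: closedin_subset)
    also have "\<dots> \<in> sets (borel_on (C_space w))"
      using \<open>closedin (C_space w) (\<Inter>r\<in>R. F r)\<close> by (intro sets.Diff sets.top openin_sets_borel_on) auto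
    finally show ?thesis .
  qed
  have [measurable]: "(\<lambda>f. f t) \<in> borel_measurable (borel_on (C_space w))" for t :: 't
    by (rule continuous_map_borel_measurable[OF continuous_map_eval])
  have 2: "{f \<in> space (borel_on (C_space w)). \<forall>s\<in>net k. \<lfloor>f s * real (Suc m)\<rfloor> = z s} \<in> sets (borel_on (C_space w))"
    using net(1)[of k] by measurable
  have "cell i = (\<Inter>r\<in>R. F r) \<inter> {f \<in> space (borel_on (C_space w)). \<forall>s\<in>net k. \<lfloor>f s * real (Suc m)\<rfloor> = z s}"
    using \<open>R \<noteq> {}\<close> unfolding i cell_def F_def R_def
    by (auto simp: topspace_C_space abs_le_iff simp del: of_nat_Suc) (smt (verit))+
  with 1 2 show ?thesis by simp
qed

definition dense_set :: "'t set" where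
  "dense_set = (\<Union>k. net k)"

lemma countable_dense_set: "countable dense_set"
  unfolding dense_set_def by (auto intro: countable_finite net)

lemma dense_set:
  assumes "e > 0"
  shows "\<exists>s\<in>dense_set. w t s < e"
proof -
  obtain k where "(1 / 2) ^ k < e" using real_arch_pow_inv[of e "1 / 2"] assms by auto
  then have "w t (nearest k t) < e" using nearest(2)[of k t] w_sym[of t] by simp
  then show ?thesis using nearest(1)[of k t] by (auto simp: dense_set_def)
qed

lemma dense_approx:
  assumes f: "continuous_map (semi_topology w) euclideanreal f" and e: "e > 0"
  shows "\<exists>s\<in>dense_set. w t s < e \<and> \<bar>f s - f t\<bar> < e"
proof -
  obtain \<delta> where \<delta>: "\<delta> > 0" "\<And>s. w t s < \<delta> \<Longrightarrow> \<bar>f s - f t\<bar> < e"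
    using f e unfolding continuous_iff by blast
  obtain s where "s \<in> dense_set" "w t s < min \<delta> e" using dense_set[of "min \<delta> e" t] \<delta>(1) e by auto
  then show ?thesis using \<delta>(2) by auto
qed

text \<open>For continuous functions countably many pairs suffice, so that membership of a random
  path in a cell can be tested by countably many random variables.\<close>

lemma cell_iff_dense:
  assumes f: "continuous_map (semi_topology w) euclideanreal f"
  shows "f \<in> cell (m, k, z) \<longleftrightarrow>
     (\<forall>t\<in>dense_set. \<forall>t'\<in>dense_set. w t t' < 2 * (1 / 2) ^ k \<longrightarrow> \<bar>f t - f t'\<bar> \<le> 1 / real (Suc m)) \<and>
     (\<forall>s\<in>net k. \<lfloor>f s * real (Suc m)\<rfloor> = z s)" (is "_ \<longleftrightarrow> ?R")
proof
  assume R: ?R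
  have "\<bar>f t - f t'\<bar> \<le> 1 / real (Suc m)" if tt: "w t t' < 2 * (1 / 2) ^ k" for t t'
  proof (rule field_le_epsilon)
    fix e :: real assume e: "e > 0"
    define \<epsilon> where "\<epsilon> = min (e / 2) ((2 * (1 / 2) ^ k - w t t') / 2)"
    have \<epsilon>: "\<epsilon> > 0" "2 * \<epsilon> \<le> e" "2 * \<epsilon> \<le> 2 * (1 / 2) ^ k - w t t'"
      using e tt by (simp_all add: \<epsilon>_def min_def)
    obtain s where s: "s \<in> dense_set" "w t s < \<epsilon>" "\<bar>f s - f t\<bar> < \<epsilon>" using dense_approx[OF f \<epsilon>(1)] by blast
    obtain s' where s': "s' \<in> dense_set" "w t' s' < \<epsilon>" "\<bar>f s' - f t'\<bar> < \<epsilon>" using dense_approx[OF f \<epsilon>(1)] by blast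
    have "w s s' < 2 * (1 / 2) ^ k"
      using w_triangle[of s s' t] w_triangle[of t s' t'] w_sym[of s t] s(2) s'(2) \<epsilon>(3) by linarith
    then have "\<bar>f s - f s'\<bar> \<le> 1 / real (Suc m)" using R s(1) s'(1) by blast
    then show "\<bar>f t - f t'\<bar> \<le> 1 / real (Suc m) + e" using s(3) s'(3) \<epsilon>(2) by linarith
  qed
  then show "f \<in> cell (m, k, z)" using f R by (simp add: cell_def del: of_nat_Suc)
qed (auto simp: cell_def simp del: of_nat_Suc)

text \<open>A countable union, hence measurability of a path map needs to be checked on cells
  only.\<close>

lemma open_eq_Union_cells:
  assumes U: "openin (C_space w) U"
  shows "U = (\<Union>i\<in>{i \<in> cell_indices. cell i \<subseteq> U}. cell i)"
proof (intro set_eqI iffI)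
  interpret CF: Metric_space "mspace CF" "mdist CF" by (rule Metric_space_CF)
  fix f assume f: "f \<in> U"
  then obtain r where r: "r > 0" "CF.mball f r \<subseteq> U" and fC: "f \<in> mspace CF"
    using U unfolding C_space_eq CF.openin_mtopology by blast
  obtain m where m: "3 / real (Suc m) < r"
    using reals_Archimedean[of "r / 3"] r by (auto simp: field_simps)
  have fcont: "continuous_map (semi_topology w) euclideanreal f" using fC unfolding mspace_CF by simp
  obtain k z where kz: "(m, k, z) \<in> cell_indices" "f \<in> cell (m, k, z)" using cell_cover[OF fcont, of m] by blast
  have "cell (m, k, z) \<subseteq> CF.mball f r"
  proof
    fix g assume g: "g \<in> cell (m, k, z)"
    then have "mdist CF f g < r" using cell_diameter[OF kz(2) g] m by linarith
    then show "g \<in> CF.mball f r" using fC cell_subset g by (auto)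
  qed
  then have "cell (m, k, z) \<subseteq> U" using r(2) by blast
  with kz show "f \<in> (\<Union>i\<in>{i \<in> cell_indices. cell i \<subseteq> U}. cell i)" by blast
qed auto

lemma path_map_cont: "continuous_map (semi_topology w) euclideanreal (path_map w X \<omega>)"
  by (simp add: path_map_def)

text \<open>Almost surely the path is continuous and its membership in a cell agrees with a
  countable condition on \<open>X\<close>. The exceptional set is null, and the completion absorbs
  it.\<close>

lemma measurable_path_map:
  assumes X: "\<And>t. (\<lambda>\<omega>. X \<omega> t) \<in> borel_measurable M"
    and cont: "AE \<omega> in M. continuous_map (semi_topology w) euclideanreal (X \<omega>)"
  shows "path_map w X \<in> completion M \<rightarrow>\<^sub>M borel_on (C_space w)"
proof (rule measurable_borel_onI)
  show "path_map w X \<omega> \<in> topspace (C_space w)" for \<omega>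
    by (simp add: topspace_C_space path_map_cont)
  note [measurable] = X
  have cell: "{\<omega> \<in> space (completion M). path_map w X \<omega> \<in> cell i} \<in> sets (completion M)" for i
  proof -
    obtain m k z where i: "i = (m, k, z)" by (cases i)
    let ?Q = "\<lambda>\<omega>. (\<forall>t\<in>dense_set. \<forall>t'\<in>dense_set. w t t' < 2 * (1 / 2) ^ k \<longrightarrow> \<bar>X \<omega> t - X \<omega> t'\<bar> \<le> 1 / real (Suc m)) \<and>
       (\<forall>s\<in>net k. \<lfloor>X \<omega> s * real (Suc m)\<rfloor> = z s)"
    have "{\<omega> \<in> space M. ?Q \<omega>} \<in> sets M"
    proof (rule sets.sets_Collect_conj)
      show "{\<omega> \<in> space M. \<forall>t\<in>dense_set. \<forall>t'\<in>dense_set. w t t' < 2 * (1 / 2) ^ k \<longrightarrow> \<bar>X \<omega> t - X \<omega> t'\<bar> \<le> 1 / real (Suc m)} \<in> sets M"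
        by (intro sets_Collect_Ball_countable countable_dense_set) measurable
      show "{\<omega> \<in> space M. \<forall>s\<in>net k. \<lfloor>X \<omega> s * real (Suc m)\<rfloor> = z s} \<in> sets M"
        using net(1)[of k] by measurable
    qed
    moreover have "AE \<omega> in M. path_map w X \<omega> \<in> cell i \<longleftrightarrow> ?Q \<omega>"
      using cont
    proof eventually_elim
      case (elim \<omega>)
      then have "path_map w X \<omega> = X \<omega>" by (simp add: path_map_def)
      with cell_iff_dense[OF elim] show ?case unfolding i by simp
    qed
    ultimately show ?thesis by (intro sets_completion_Collect_cong)
  qed
  fix U assume U: "openin (C_space w) U"
  have "path_map w X -` U \<inter> space (completion M) =
      (\<Union>i\<in>{i \<in> cell_indices. cell i \<subseteq> U}. {\<omega> \<in> space (completion M). path_map w X \<omega> \<in> cell i})"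
    by (subst open_eq_Union_cells[OF U]) auto
  also have "\<dots> \<in> sets (completion M)"
  proof (rule sets.countable_UN')
    show "countable {i \<in> cell_indices. cell i \<subseteq> U}"
      by (rule countable_subset[OF _ countable_cell_indices]) auto
    show "(\<lambda>i. {\<omega> \<in> space (completion M). path_map w X \<omega> \<in> cell i}) ` {i \<in> cell_indices. cell i \<subseteq> U} \<subseteq> sets (completion M)"
      using cell by blast
  qed
  finally show "path_map w X -` U \<inter> space (completion M) \<in> sets (completion M)" .
qed

lemma continuous_bounded:
  assumes "continuous_map (semi_topology w) euclideanreal f"
  obtains C where "\<And>t. \<bar>f t\<bar> \<le> C"
proof -
  have "compactin (semi_topology w) UNIV" using compact by (simp add: compact_space_def)
  from image_compactin[OF this assms] have "compact (range f)" by simp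
  then have "bounded (range f)" by (rule compact_imp_bounded)
  then show ?thesis using that by (auto simp: bounded_iff)
qed

text \<open>A continuous path is bounded because the index set is compact, so the real supremum is
  genuine; density then reduces it to countably many points.\<close>

lemma sup_field_le_iff:
  assumes f: "continuous_map (semi_topology w) euclideanreal (X \<omega>)"
  shows "sup_field X \<omega> \<le> a \<longleftrightarrow> (\<forall>t\<in>dense_set. \<bar>X \<omega> t\<bar> \<le> a)"
proof -
  obtain C where C: "\<And>t. \<bar>X \<omega> t\<bar> \<le> C" using continuous_bounded[OF f] by blast
  have "sup_field X \<omega> \<le> a \<longleftrightarrow> (\<forall>t. \<bar>X \<omega> t\<bar> \<le> a)"
    unfolding sup_field_def using C by (subst cSUP_le_iff) (auto simp: bdd_above_def)
  also have "\<dots> \<longleftrightarrow> (\<forall>t\<in>dense_set. \<bar>X \<omega> t\<bar> \<le> a)"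
  proof (intro iffI allI)
    fix t assume R: "\<forall>t\<in>dense_set. \<bar>X \<omega> t\<bar> \<le> a"
    show "\<bar>X \<omega> t\<bar> \<le> a"
    proof (rule field_le_epsilon)
      fix e :: real assume "e > 0"
      then obtain s where "s \<in> dense_set" "\<bar>X \<omega> s - X \<omega> t\<bar> < e" using dense_approx[OF f] by blast
      then show "\<bar>X \<omega> t\<bar> \<le> a + e" using R[rule_format, of s] by linarith
    qed
  qed auto
  finally show ?thesis .
qed

lemma measurable_sup_field:
  assumes X: "\<And>t. (\<lambda>\<omega>. X \<omega> t) \<in> borel_measurable M"
    and cont: "AE \<omega> in M. continuous_map (semi_topology w) euclideanreal (X \<omega>)"
  shows "sup_field X \<in> borel_measurable (completion M)"
  unfolding borel_measurable_iff_le
proof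
  fix a
  note [measurable] = X
  have "{\<omega> \<in> space M. \<forall>t\<in>dense_set. \<bar>X \<omega> t\<bar> \<le> a} \<in> sets M"
    by (intro sets_Collect_Ball_countable countable_dense_set) measurable
  moreover have "AE \<omega> in M. sup_field X \<omega> \<le> a \<longleftrightarrow> (\<forall>t\<in>dense_set. \<bar>X \<omega> t\<bar> \<le> a)"
    using cont by eventually_elim (rule sup_field_le_iff)
  ultimately show "{\<omega> \<in> space (completion M). sup_field X \<omega> \<le> a} \<in> sets (completion M)"
    by (intro sets_completion_Collect_cong)
qed


definition cells :: "nat \<Rightarrow> nat \<Rightarrow> int \<Rightarrow> (nat \<times> nat \<times> ('t \<Rightarrow> int)) set" where
  "cells m k J = (\<lambda>z. (m, k, z)) ` (net k \<rightarrow>\<^sub>E {- J..J})"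

lemma finite_cells: "finite (cells m k J)"
  unfolding cells_def by (intro finite_imageI finite_PiE) (auto simp: net)

lemma cells_subset: "cells m k J \<subseteq> cell_indices"
  by (auto simp: cells_def cell_indices_def)

text \<open>The finiteness half of the Arzela-Ascoli criterion: a common oscillation and a common
  bound confine a function to finitely many cells. The added 1 allows for rounding by the
  floor.\<close>

lemma in_cells:
  assumes f: "continuous_map (semi_topology w) euclideanreal f"
    and osc: "\<And>t t'. w t t' < 2 * (1 / 2) ^ k \<Longrightarrow> \<bar>f t - f t'\<bar> \<le> 1 / real (Suc m)"
    and bound: "\<And>t. \<bar>f t\<bar> \<le> L" and J: "L * real (Suc m) + 1 \<le> real_of_int J"
  shows "f \<in> (\<Union>i\<in>cells m k J. cell i)"
proof -
  let ?z = "\<lambda>s\<in>net k. \<lfloor>f s * real (Suc m)\<rfloor>"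
  have "\<lfloor>f s * real (Suc m)\<rfloor> \<in> {- J..J}" for s
  proof -
    have "\<bar>f s * real (Suc m)\<bar> \<le> L * real (Suc m)"
      using mult_right_mono[OF bound[of s], of "real (Suc m)"] by (simp add: abs_mult)
    then show ?thesis using J by (simp only: atLeastAtMost_iff abs_le_iff) linarith
  qed
  then have "?z \<in> net k \<rightarrow>\<^sub>E {- J..J}" by (intro PiE_I) auto
  moreover have "f \<in> cell (m, k, ?z)" using f osc by (simp add: cell_def)
  ultimately show ?thesis unfolding cells_def by blast
qed

end

section \<open>Regularity and concentration of a chained field\<close>

context entropy_chaining
begin

lemma AE_continuous:
  assumes "separable_field M w X"
  shows "AE \<omega> in M. continuous_map (semi_topology w) euclideanreal (X \<omega>)"
  using separable_bounds(1)[OF assms] AE_tail_sum_tendsto_0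
proof eventually_elim
  case (elim \<omega>)
  show ?case
    unfolding continuous_iff
  proof (intro allI impI)
    fix t and e :: real assume "e > 0"
    then have "e / 4 > 0" by simp
    from LIMSEQ_D[OF elim(2) this] obtain m where m: "\<bar>tail_sum m \<omega>\<bar> < e / 4" by auto
    show "\<exists>\<delta>>0. \<forall>s. w t s < \<delta> \<longrightarrow> \<bar>X \<omega> s - X \<omega> t\<bar> < e"
    proof (intro exI[of _ "modulus m"] conjI modulus_pos allI impI)
      fix s assume "w t s < modulus m"
      then have "\<bar>X \<omega> t - X \<omega> s\<bar> \<le> 4 * tail_sum m \<omega>" using elim(1) by blast
      with m show "\<bar>X \<omega> s - X \<omega> t\<bar> < e" by linarith
    qed
  qed
qed

lemma Lp_le_sup_field:
  assumes sep: "separable_field M w X" and q: "q \<in> I"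
  shows "Lp_le (completion M) q (B * (\<tau> q / c) * (\<sigma> * E 0 + rest 0)) (sup_field X)"
proof (rule Lp_le_cong_abs[OF Lp_le_completion[OF Lp_le_max_bound[OF q]]])
  show "sup_field X \<in> borel_measurable (completion M)"
    by (rule measurable_sup_field[OF measurable_X AE_continuous[OF sep]])
  show "0 \<le> q" using I(2)[OF q] by simp
  show "AE \<omega> in completion M. \<bar>sup_field X \<omega>\<bar> \<le> \<bar>max_bound \<omega>\<bar>"
    using AE_completion[OF separable_bounds(2)[OF sep]]
  proof eventually_elim
    case (elim \<omega>)
    have "sup_field X \<omega> \<le> max_bound \<omega>"
      unfolding sup_field_def using elim by (intro cSUP_least) auto
    moreover have "bdd_above (range (\<lambda>t. \<bar>X \<omega> t\<bar>))" using elim by (auto simp: bdd_above_def)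
    then have "\<bar>X \<omega> undefined\<bar> \<le> sup_field X \<omega>" unfolding sup_field_def by (intro cSUP_upper) auto
    ultimately show ?case by simp
  qed
qed

text \<open>The path lies in the cells unless \<open>tail_sum l\<close> exceeds \<open>y\<close> or
  \<open>max_bound\<close> exceeds \<open>L\<close>. The two subtracted terms are the Chebyshev
  bounds for these events with exponent 1, and neither depends on the particular field.\<close>

lemma law_cells_ge:
  assumes sep: "separable_field M w X" and p: "p \<in> I" and y: "4 * y \<le> 1 / real (Suc m)" "y > 0" and L: "L > 0"
    and k: "2 * (1 / 2) ^ k \<le> modulus l" and J: "L * real (Suc m) + 1 \<le> real_of_int J"
  shows "measure (law_on_C M w X) (\<Union>i\<in>cells m k J. cell i) \<ge>
     1 - B * (\<tau> p / c) * rest l / y - B * (\<tau> p / c) * (\<sigma> * E 0 + rest 0) / L"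
proof -
  have p1: "p \<ge> 1" by (rule I(2)[OF p])
  define U where "U = (\<Union>i\<in>cells m k J. cell i)"
  have U: "U \<in> sets (borel_on (C_space w))"
    unfolding U_def using finite_cells cell_measurable by (intro sets.finite_UN) auto
  interpret C: prob_space "completion M" by (rule prob_space_completion)
  note pm = measurable_path_map[OF measurable_X AE_continuous[OF sep]]
  have tail1: "prob {\<omega> \<in> space M. y < \<bar>tail_sum l \<omega>\<bar>} \<le> B * (\<tau> p / c) * rest l / y"
    by (rule Lp_le_tail_1[OF Lp_le_tail_sum[OF p] p1 y(2)])
  have tail2: "prob {\<omega> \<in> space M. L < \<bar>max_bound \<omega>\<bar>} \<le> B * (\<tau> p / c) * (\<sigma> * E 0 + rest 0) / L"
    by (rule Lp_le_tail_1[OF Lp_le_max_bound[OF p] p1 L])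
  note [measurable] = Lp_leD(2)[OF Lp_le_tail_sum[OF p]] Lp_leD(2)[OF Lp_le_max_bound[OF p]]
  define G1 where "G1 = {\<omega> \<in> space M. y < \<bar>tail_sum l \<omega>\<bar>}"
  define G2 where "G2 = {\<omega> \<in> space M. L < \<bar>max_bound \<omega>\<bar>}"
  have G: "G1 \<in> sets M" "G2 \<in> sets M" unfolding G1_def G2_def by measurable
  have "1 - prob G1 - prob G2 \<le> prob (space M - (G1 \<union> G2))"
    using G measure_Un_le[OF G] by (subst prob_compl) auto
  also have "\<dots> = measure (completion M) (space M - (G1 \<union> G2))"
    using G by (intro measure_completion[symmetric]) auto
  also have "\<dots> \<le> measure (completion M) (path_map w X -` U \<inter> space (completion M))"
  proof (rule C.finite_measure_mono_AE)
    show "path_map w X -` U \<inter> space (completion M) \<in> sets (completion M)" by (rule measurable_sets[OF pm U])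
    have "AE \<omega> in M. \<omega> \<in> space M - (G1 \<union> G2) \<longrightarrow> \<omega> \<in> path_map w X -` U \<inter> space (completion M)"
      using AE_continuous[OF sep] separable_bounds[OF sep]
    proof eventually_elim
      case (elim \<omega>)
      show ?case
      proof
        assume "\<omega> \<in> space M - (G1 \<union> G2)"
        then have \<omega>: "\<omega> \<in> space M" "\<bar>tail_sum l \<omega>\<bar> \<le> y" "\<bar>max_bound \<omega>\<bar> \<le> L"
          by (auto simp: G1_def G2_def)
        have "X \<omega> \<in> U"
          unfolding U_def
        proof (rule in_cells[OF elim(1) _ _ J])
          show "\<bar>X \<omega> t - X \<omega> t'\<bar> \<le> 1 / real (Suc m)" if "w t t' < 2 * (1 / 2) ^ k" for t t'
          proof -
            have "\<bar>X \<omega> t - X \<omega> t'\<bar> \<le> 4 * tail_sum l \<omega>" using elim(2) that k by (meson less_le_trans)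
            then show ?thesis using \<omega>(2) y(1) by linarith
          qed
          show "\<bar>X \<omega> t\<bar> \<le> L" for t using elim(3) \<omega>(3) by (meson abs_le_D1 order_trans)
        qed
        then show "\<omega> \<in> path_map w X -` U \<inter> space (completion M)"
          using elim(1) \<omega>(1) by (simp add: path_map_def)
      qed
    qed
    then show "AE \<omega> in completion M. \<omega> \<in> space M - (G1 \<union> G2) \<longrightarrow> \<omega> \<in> path_map w X -` U \<inter> space (completion M)"
      by (rule AE_completion)
  qed
  also have "\<dots> = measure (law_on_C M w X) U"
    unfolding law_on_C_def using pm U by (rule measure_distr[symmetric])
  finally show ?thesis using tail1 tail2 unfolding U_def G1_def G2_def by linarith
qed

end

section \<open>Sums over increasing index tuples\<close>

declare One_nat_def [simp del]

text \<open>Averaging over a probability space contracts the \<open>L p\<close> norm: Jensen's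
  inequality on each fibre, then Fubini. Fibres of infinite norm satisfy the pointwise bound
  trivially.\<close>

lemma (in prob_space) Lp_le_integral_snd:
  fixes f :: "'b \<times> 'a \<Rightarrow> real"
  assumes N: "sigma_finite_measure N" and f: "Lp_le (N \<Otimes>\<^sub>M M) p a f" and p: "p \<ge> 1"
  shows "Lp_le N p a (\<lambda>z. \<integral>x. f (z, x) \<partial>M)"
proof -
  note [measurable] = Lp_leD(2)[OF f]
  interpret N: sigma_finite_measure N by (rule N)
  have Dm: "(\<lambda>z. \<integral>x. f (z, x) \<partial>M) \<in> borel_measurable N"
    by measurable
  have le: "ennreal (\<bar>\<integral>x. f (z, x) \<partial>M\<bar> powr p) \<le> (\<integral>\<^sup>+x. ennreal (\<bar>f (z, x)\<bar> powr p) \<partial>M)"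
    if z: "z \<in> space N" for z
  proof (cases "(\<integral>\<^sup>+x. ennreal (\<bar>f (z, x)\<bar> powr p) \<partial>M) = \<infinity>")
    case False
    define I where "I = enn2real (\<integral>\<^sup>+x. ennreal (\<bar>f (z, x)\<bar> powr p) \<partial>M)"
    have I: "(\<integral>\<^sup>+x. ennreal (\<bar>f (z, x)\<bar> powr p) \<partial>M) = ennreal I" "I \<ge> 0"
      using False by (simp_all add: I_def less_top)
    have "(\<lambda>x. f (z, x)) \<in> borel_measurable M" using z by measurable
    then have L: "Lp_le M p (I powr (1 / p)) (\<lambda>x. f (z, x))"
      using I p by (simp add: Lp_le_def powr_powr)
    have "\<bar>\<integral>x. f (z, x) \<partial>M\<bar> \<le> (\<integral>x. \<bar>f (z, x)\<bar> \<partial>M)"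
      by (rule integral_abs_bound)
    also have "\<dots> \<le> I powr (1 / p)"
      by (rule Lp_le_integrable[OF L p])
    finally have "\<bar>\<integral>x. f (z, x) \<partial>M\<bar> powr p \<le> (I powr (1 / p)) powr p"
      using p by (intro powr_mono2) auto
    also have "\<dots> = I" using p I by (simp add: powr_powr)
    finally show ?thesis using I by (simp add: ennreal_leI)
  qed simp
  have "(\<integral>\<^sup>+z. ennreal (\<bar>\<integral>x. f (z, x) \<partial>M\<bar> powr p) \<partial>N) \<le> (\<integral>\<^sup>+z. \<integral>\<^sup>+x. ennreal (\<bar>f (z, x)\<bar> powr p) \<partial>M \<partial>N)"
    by (intro nn_integral_mono le)
  also have "\<dots> = (\<integral>\<^sup>+y. ennreal (\<bar>f y\<bar> powr p) \<partial>(N \<Otimes>\<^sub>M M))"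
    by (rule nn_integral_fst) measurable
  also have "\<dots> \<le> ennreal (a powr p)" by (rule Lp_leD[OF f])
  finally show ?thesis
    using Dm Lp_leD(1)[OF f] by (simp add: Lp_le_def)
qed

lemma Lp_le_distr_iff:
  assumes "g \<in> M \<rightarrow>\<^sub>M N" "f \<in> borel_measurable N"
  shows "Lp_le (distr M N g) p a f \<longleftrightarrow> Lp_le M p a (\<lambda>\<omega>. f (g \<omega>))"
  using assms measurable_compose[OF assms] by (simp add: Lp_le_def nn_integral_distr)

definition usum :: "nat \<Rightarrow> ((nat \<Rightarrow> 'x) \<Rightarrow> real) \<Rightarrow> nat \<Rightarrow> (nat \<Rightarrow> 'x) \<Rightarrow> real" where
  "usum d f n y = (\<Sum>i\<in>index_tuples d n. f (\<lambda>k\<in>{1..d}. y (i k)))"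

lemma finite_index_tuples [simp]: "finite (index_tuples d n)"
  unfolding index_tuples_def
  by (rule finite_subset[of _ "{1..d} \<rightarrow>\<^sub>E {1..n}"]) (auto intro: finite_PiE)

lemma index_tuplesD:
  assumes "i \<in> index_tuples d n" "k \<in> {1..d}"
  shows "i k \<in> {1..n}"
  using assms by (auto simp: index_tuples_def PiE_iff)

lemma index_tuples_0: "index_tuples 0 n = {\<lambda>_. undefined}"
  by (auto simp: index_tuples_def strict_mono_on_def)

lemma bij_betw_index_tuples_Suc:
  "bij_betw (\<lambda>(k, i). i(Suc d := k)) (Sigma {1..n} (\<lambda>k. index_tuples d (k - 1))) (index_tuples (Suc d) n)"
proof (rule bij_betwI[where g = "\<lambda>j. (j (Suc d), j(Suc d := undefined))"])
  show "(\<lambda>(k, i). i(Suc d := k)) \<in> Sigma {1..n} (\<lambda>k. index_tuples d (k - 1)) \<rightarrow> index_tuples (Suc d) n"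
  proof clarify
    fix k i assume k: "k \<in> {1..n}" and i: "i \<in> index_tuples d (k - 1)"
    have m: "strict_mono_on {1..d} i" using i by (simp add: index_tuples_def)
    have lt: "i j < k" if "j \<in> {1..d}" for j using index_tuplesD[OF i that] k by auto
    have "strict_mono_on {1..Suc d} (i(Suc d := k))"
      unfolding strict_mono_on_def
    proof clarify
      fix r s assume rs: "r \<in> {1..Suc d}" "s \<in> {1..Suc d}" "r < s"
      then have r: "r \<in> {1..d}" by auto
      show "(i(Suc d := k)) r < (i(Suc d := k)) s"
      proof (cases "s = Suc d")
        case False
        then show ?thesis using rs r strict_mono_onD[OF m, of r s] by auto
      qed (use lt[OF r] r in auto)
    qed
    moreover have "i(Suc d := k) \<in> {1..Suc d} \<rightarrow>\<^sub>E {1..n}"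
    proof (rule PiE_I)
      fix j assume "j \<in> {1..Suc d}"
      then show "(i(Suc d := k)) j \<in> {1..n}"
        using k index_tuplesD[OF i, of j] by (cases "j = Suc d") auto
    next
      fix j assume "j \<notin> {1..Suc d}"
      then have "j \<notin> {1..d}" by auto
      moreover have "i \<in> extensional {1..d}" using i by (auto simp: index_tuples_def PiE_def)
      ultimately show "(i(Suc d := k)) j = undefined" using \<open>j \<notin> {1..Suc d}\<close> by (auto simp: extensional_def)
    qed
    ultimately show "i(Suc d := k) \<in> index_tuples (Suc d) n" by (simp add: index_tuples_def)
  qed
  show "(\<lambda>j. (j (Suc d), j(Suc d := undefined))) \<in> index_tuples (Suc d) n \<rightarrow> Sigma {1..n} (\<lambda>k. index_tuples d (k - 1))"
  proof (intro funcsetI SigmaI)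
    fix j assume j: "j \<in> index_tuples (Suc d) n"
    show "j (Suc d) \<in> {1..n}" using index_tuplesD[OF j] by auto
    have m: "strict_mono_on {1..Suc d} j" using j by (simp add: index_tuples_def)
    have "j l \<in> {1..j (Suc d) - 1}" if "l \<in> {1..d}" for l
      using that index_tuplesD[OF j, of l] strict_mono_onD[OF m, of l "Suc d"] by auto
    moreover have "j \<in> extensional {1..Suc d}" using j by (auto simp: index_tuples_def PiE_def)
    ultimately have "j(Suc d := undefined) \<in> {1..d} \<rightarrow>\<^sub>E {1..j (Suc d) - 1}"
      by (auto simp: PiE_iff extensional_def)
    moreover have "strict_mono_on {1..d} (j(Suc d := undefined))"
      using m by (auto simp: strict_mono_on_def)
    ultimately show "j(Suc d := undefined) \<in> index_tuples d (j (Suc d) - 1)"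
      by (simp add: index_tuples_def)
  qed
  show "(\<lambda>j. (j (Suc d), j(Suc d := undefined))) ((\<lambda>(k, i). i(Suc d := k)) x) = x"
    if "x \<in> Sigma {1..n} (\<lambda>k. index_tuples d (k - 1))" for x
    using that by (auto simp: index_tuples_def PiE_iff extensional_def fun_eq_iff)
qed (auto simp: fun_eq_iff)

text \<open>Grouping by the largest index \<open>k\<close> leaves \<open>d\<close> indices that are
  at most \<open>k - 1\<close>, so the summand depends on the first \<open>k\<close> coordinates
  only.\<close>

lemma usum_Suc:
  "usum (Suc d) f n y = (\<Sum>k\<in>{1..n}. usum d (\<lambda>z. f (z(Suc d := y k))) (k - 1) y)"
proof -
  have *: "(\<lambda>k'\<in>{1..Suc d}. y ((i(Suc d := k)) k')) = (\<lambda>k'\<in>{1..d}. y (i k'))(Suc d := y k)" for i k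
    by (auto simp: fun_eq_iff)
  have "usum (Suc d) f n y = (\<Sum>(k, i)\<in>Sigma {1..n} (\<lambda>k. index_tuples d (k - 1)). f ((\<lambda>k'\<in>{1..d}. y (i k'))(Suc d := y k)))"
    unfolding usum_def
    by (subst sum.reindex_bij_betw[OF bij_betw_index_tuples_Suc, symmetric])
      (simp only: case_prod_unfold *)
  also have "\<dots> = (\<Sum>k\<in>{1..n}. usum d (\<lambda>z. f (z(Suc d := y k))) (k - 1) y)"
    unfolding usum_def by (subst sum.Sigma) auto
  finally show ?thesis .
qed

lemma usum_cong_coordinates:
  assumes "\<And>l. l \<in> {1..n} \<Longrightarrow> y l = y' l"
  shows "usum d f n y = usum d f n y'"
proof -
  have "(\<lambda>k\<in>{1..d}. y (i k)) = (\<lambda>k\<in>{1..d}. y' (i k))" if "i \<in> index_tuples d n" for i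
    using index_tuplesD[OF that] assms by (auto simp: fun_eq_iff)
  then show ?thesis by (simp add: usum_def)
qed

section \<open>Product laws and integration over single coordinates\<close>

locale sample_law = prob_space Q for Q :: "'x measure"
begin

abbreviation P :: "nat \<Rightarrow> (nat \<Rightarrow> 'x) measure" where
  "P n \<equiv> PiM {1..n} (\<lambda>_. Q)"

sublocale PQ: product_prob_space "\<lambda>_::nat. Q" UNIV
  by unfold_locales

lemma prob_space_P: "prob_space (P n)"
  by (intro prob_space_PiM) unfold_locales

lemma sigma_finite_P: "sigma_finite_measure (P n)"
  using prob_space_P by (rule prob_space_imp_sigma_finite)

lemma pair_sigma_finite_PQ: "pair_sigma_finite (P n) Q"
  by (intro pair_sigma_finite.intro sigma_finite_P) unfold_locales

lemma pair_sigma_finite_QP: "pair_sigma_finite Q (P n)"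
  by (intro pair_sigma_finite.intro sigma_finite_P) unfold_locales

lemma measurable_append [measurable]:
  "(\<lambda>(z, x). z(Suc d := x)) \<in> P d \<Otimes>\<^sub>M Q \<rightarrow>\<^sub>M P (Suc d)"
  unfolding case_prod_unfold
  by (rule measurable_fun_upd[where J = "{1..d}"]) (auto simp: atLeastAtMostSuc_conv)

lemma distr_append: "distr (P d \<Otimes>\<^sub>M Q) (P (Suc d)) (\<lambda>(z, x). z(Suc d := x)) = P (Suc d)"
proof -
  interpret QP: pair_sigma_finite Q "P d" by (rule pair_sigma_finite_QP)
  interpret PQ': pair_sigma_finite "P d" Q by (rule pair_sigma_finite_PQ)
  have ins: "insert (Suc d) {1..d} = {1..Suc d}" by auto
  have "distr (P d \<Otimes>\<^sub>M Q) (P (Suc d)) (\<lambda>(z, x). z(Suc d := x))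
      = distr (distr (Q \<Otimes>\<^sub>M P d) (P d \<Otimes>\<^sub>M Q) (\<lambda>(x, y). (y, x))) (P (Suc d)) (\<lambda>(z, x). z(Suc d := x))"
    by (subst PQ'.distr_pair_swap) (rule refl)
  also have "\<dots> = distr (Q \<Otimes>\<^sub>M P d) (P (Suc d)) (\<lambda>(x, z). z(Suc d := x))"
    by (subst distr_distr) (auto simp: comp_def case_prod_unfold)
  also have "\<dots> = P (Suc d)"
    using distr_pair_PiM_eq_PiM[of "{1..d}" "\<lambda>_. Q" "Suc d"] prob_space_axioms by (simp add: ins)
  finally show ?thesis .
qed

lemma AE_append:
  assumes "AE y in P (Suc d). R y"
  shows "AE z in P d. AE x in Q. R (z(Suc d := x))" "AE x in Q. AE z in P d. R (z(Suc d := x))"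
proof -
  interpret QP: pair_sigma_finite Q "P d" by (rule pair_sigma_finite_QP)
  interpret PQ': pair_sigma_finite "P d" Q by (rule pair_sigma_finite_PQ)
  have *: "AE w in P d \<Otimes>\<^sub>M Q. R ((\<lambda>(z, x). z(Suc d := x)) w)"
    using assms by (subst (asm) distr_append[symmetric]) (rule AE_distrD[OF measurable_append])
  from PQ'.AE_pair[OF this] show "AE z in P d. AE x in Q. R (z(Suc d := x))" by simp
  have "AE w in Q \<Otimes>\<^sub>M P d. R ((\<lambda>(x, z). z(Suc d := x)) w)"
  proof -
    have "AE w in distr (Q \<Otimes>\<^sub>M P d) (P d \<Otimes>\<^sub>M Q) (\<lambda>(x, y). (y, x)). R ((\<lambda>(z, x). z(Suc d := x)) w)"
      using * by (subst PQ'.distr_pair_swap[symmetric])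
    from AE_distrD[OF measurable_pair_swap' this] show ?thesis by (simp add: case_prod_unfold)
  qed
  from QP.AE_pair[OF this] show "AE x in Q. AE z in P d. R (z(Suc d := x))" by simp
qed

lemma nn_integral_append:
  assumes [measurable]: "f \<in> borel_measurable (P (Suc d))"
  shows "(\<integral>\<^sup>+ y. f y \<partial>P (Suc d)) = (\<integral>\<^sup>+ z. \<integral>\<^sup>+ x. f (z(Suc d := x)) \<partial>Q \<partial>P d)"
    "(\<integral>\<^sup>+ y. f y \<partial>P (Suc d)) = (\<integral>\<^sup>+ x. \<integral>\<^sup>+ z. f (z(Suc d := x)) \<partial>P d \<partial>Q)"
proof -
  interpret PQ': pair_sigma_finite "P d" Q by (rule pair_sigma_finite_PQ)
  have "(\<integral>\<^sup>+ y. f y \<partial>P (Suc d)) = (\<integral>\<^sup>+ w. f ((\<lambda>(z, x). z(Suc d := x)) w) \<partial>(P d \<Otimes>\<^sub>M Q))"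
    by (subst distr_append[symmetric], subst nn_integral_distr) auto
  note eq = this
  show "(\<integral>\<^sup>+ y. f y \<partial>P (Suc d)) = (\<integral>\<^sup>+ z. \<integral>\<^sup>+ x. f (z(Suc d := x)) \<partial>Q \<partial>P d)"
    unfolding eq by (subst nn_integral_fst[symmetric]) auto
  show "(\<integral>\<^sup>+ y. f y \<partial>P (Suc d)) = (\<integral>\<^sup>+ x. \<integral>\<^sup>+ z. f (z(Suc d := x)) \<partial>P d \<partial>Q)"
    unfolding eq by (subst PQ'.nn_integral_snd[symmetric]) auto
qed

lemma integrable_append:
  fixes f :: "(nat \<Rightarrow> 'x) \<Rightarrow> real"
  assumes "integrable (P (Suc d)) f"
  shows "integrable (P d \<Otimes>\<^sub>M Q) (\<lambda>w. f ((\<lambda>(z, x). z(Suc d := x)) w))"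
proof -
  have [measurable]: "f \<in> borel_measurable (P (Suc d))" using assms by auto
  show ?thesis
    using assms by (subst (asm) distr_append[symmetric]) (subst (asm) integrable_distr_eq, auto)
qed

lemma integral_append:
  fixes f :: "(nat \<Rightarrow> 'x) \<Rightarrow> real"
  assumes f: "integrable (P (Suc d)) f"
  shows "AE x in Q. integrable (P d) (\<lambda>z. f (z(Suc d := x)))"
    "AE z in P d. integrable Q (\<lambda>x. f (z(Suc d := x)))"
    "integrable (P d) (\<lambda>z. \<integral>x. f (z(Suc d := x)) \<partial>Q)"
    "(\<integral>y. f y \<partial>P (Suc d)) = (\<integral>z. \<integral>x. f (z(Suc d := x)) \<partial>Q \<partial>P d)"
proof -
  interpret PQ': pair_sigma_finite "P d" Q by (rule pair_sigma_finite_PQ)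
  have [measurable]: "f \<in> borel_measurable (P (Suc d))" using f by auto
  note int = integrable_append[OF f]
  show "AE z in P d. integrable Q (\<lambda>x. f (z(Suc d := x)))"
    using PQ'.AE_integrable_fst'[OF int] by simp
  show "integrable (P d) (\<lambda>z. \<integral>x. f (z(Suc d := x)) \<partial>Q)"
    using PQ'.integrable_fst'[OF int] by simp
  have "(\<integral>y. f y \<partial>P (Suc d)) = (\<integral>w. f ((\<lambda>(z, x). z(Suc d := x)) w) \<partial>(P d \<Otimes>\<^sub>M Q))"
    by (subst distr_append[symmetric], subst integral_distr) auto
  also have "\<dots> = (\<integral>z. \<integral>x. f (z(Suc d := x)) \<partial>Q \<partial>P d)"
    using PQ'.integral_fst'[OF int] by simp
  finally show "(\<integral>y. f y \<partial>P (Suc d)) = (\<integral>z. \<integral>x. f (z(Suc d := x)) \<partial>Q \<partial>P d)" .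
  interpret QP: pair_sigma_finite Q "P d" by (rule pair_sigma_finite_QP)
  have "integrable (Q \<Otimes>\<^sub>M P d) (\<lambda>(x, z). f (z(Suc d := x)))"
    using PQ'.integrable_product_swap[OF int] by (simp add: case_prod_unfold)
  from QP.AE_integrable_fst'[OF this] show "AE x in Q. integrable (P d) (\<lambda>z. f (z(Suc d := x)))" by simp
qed

lemma measurable_resample [measurable]:
  assumes "k \<in> {1..N}"
  shows "(\<lambda>(y, x). y(k := x)) \<in> P N \<Otimes>\<^sub>M Q \<rightarrow>\<^sub>M P N"
  unfolding case_prod_unfold
  by (rule measurable_fun_upd[where J = "{1..N}"]) (use assms in auto)

text \<open>Replacing coordinate \<open>k\<close> by an independent copy preserves the law.
  Integrating over the copy acts as the conditional expectation given the other coordinates, with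
  all of them kept in one product space.\<close>

lemma distr_resample:
  assumes k: "k \<in> {1..N}"
  shows "distr (P N \<Otimes>\<^sub>M Q) (P N) (\<lambda>(y, x). y(k := x)) = P N"
proof (rule PQ.PiM_eqI)
  interpret PN: prob_space "P N" by (rule prob_space_P)
  interpret PQ': pair_sigma_finite "P N" Q by (rule pair_sigma_finite_PQ)
  fix A :: "nat \<Rightarrow> 'x set" assume A: "\<And>i. i \<in> {1..N} \<Longrightarrow> A i \<in> sets Q"
  define B where "B i = (if i = k then space Q else A i)" for i
  have B: "B i \<in> sets Q" if "i \<in> {1..N}" for i using A that by (auto simp: B_def)
  have pre: "(\<lambda>(y, x). y(k := x)) -` Pi\<^sub>E {1..N} A \<inter> space (P N \<Otimes>\<^sub>M Q) = Pi\<^sub>E {1..N} B \<times> A k"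
    using k sets.sets_into_space[OF A]
    apply (auto simp: space_pair_measure space_PiM PiE_iff B_def extensional_def Ball_def split: if_splits)
    apply blast
    done
  have "emeasure (distr (P N \<Otimes>\<^sub>M Q) (P N) (\<lambda>(y, x). y(k := x))) (Pi\<^sub>E {1..N} A) = emeasure (P N \<Otimes>\<^sub>M Q) (Pi\<^sub>E {1..N} B \<times> A k)"
    using A k by (subst emeasure_distr) (auto simp: pre intro!: sets_PiM_I_finite)
  also have "\<dots> = emeasure (P N) (Pi\<^sub>E {1..N} B) * emeasure Q (A k)"
    using A B k by (intro emeasure_pair_measure_Times sets_PiM_I_finite) auto
  also have "\<dots> = (\<Prod>i\<in>{1..N}. emeasure Q (B i)) * emeasure Q (A k)"
    using B by (subst PQ.emeasure_PiM) auto
  also have "\<dots> = (\<Prod>i\<in>{1..N} - {k}. emeasure Q (A i)) * emeasure Q (A k)"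
    using k by (subst prod.remove[of _ k]) (auto simp: B_def emeasure_space_1 intro!: prod.cong arg_cong2[where f = "(*)"])
  also have "\<dots> = (\<Prod>i\<in>{1..N}. emeasure Q (A i))"
    using k by (subst (2) prod.remove[of _ k]) (auto simp: mult.commute)
  finally show "emeasure (distr (P N \<Otimes>\<^sub>M Q) (P N) (\<lambda>(y, x). y(k := x))) (Pi\<^sub>E {1..N} A) = (\<Prod>i\<in>{1..N}. emeasure Q (A i))" .
qed auto

lemma distr_select:
  assumes i: "i \<in> index_tuples d n" "n \<le> N"
  shows "distr (P N) (P d) (\<lambda>y. \<lambda>k\<in>{1..d}. y (i k)) = P d"
proof -
  have "strict_mono_on {1..d} i" using i by (simp add: index_tuples_def)
  then have "inj_on i {1..d}" by (rule strict_mono_on_imp_inj_on)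
  moreover have "i \<in> {1..d} \<rightarrow> {1..N}" using index_tuplesD[OF i(1)] i(2) by fastforce
  ultimately show ?thesis
    using distr_PiM_reindex[of "{1..N}" "\<lambda>_. Q" i "{1..d}"] prob_space_axioms by simp
qed

lemma measurable_select [measurable]:
  assumes i: "i \<in> index_tuples d n" "n \<le> N"
  shows "(\<lambda>y. \<lambda>k\<in>{1..d}. y (i k)) \<in> P N \<rightarrow>\<^sub>M P d"
  using index_tuplesD[OF i(1)] i(2) by (intro measurable_restrict measurable_component_singleton) fastforce

definition merged :: "nat \<Rightarrow> nat set \<Rightarrow> (nat \<Rightarrow> 'x) \<times> (nat \<Rightarrow> 'x) \<Rightarrow> nat \<Rightarrow> 'x" where
  "merged d A = (\<lambda>(x, y). \<lambda>k\<in>{1..d}. if k \<in> A then x k else y k)"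

lemma measurable_merged [measurable]: "merged d A \<in> P d \<Otimes>\<^sub>M P d \<rightarrow>\<^sub>M P d"
  unfolding merged_def case_prod_unfold by (intro measurable_restrict) auto

lemma distr_merged: "distr (P d \<Otimes>\<^sub>M P d) (P d) (merged d A) = P d"
proof (rule PQ.PiM_eqI)
  interpret Pd: prob_space "P d" by (rule prob_space_P)
  fix B :: "nat \<Rightarrow> 'x set" assume B: "\<And>i. i \<in> {1..d} \<Longrightarrow> B i \<in> sets Q"
  define B1 where "B1 i = (if i \<in> A then B i else space Q)" for i
  define B2 where "B2 i = (if i \<in> A then space Q else B i)" for i
  have B12: "B1 i \<in> sets Q" "B2 i \<in> sets Q" if "i \<in> {1..d}" for i using B that by (auto simp: B1_def B2_def)
  have sub: "B i \<subseteq> space Q" if "i \<in> {1..d}" for i using sets.sets_into_space[OF B[OF that]] .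
  have pre: "merged d A -` Pi\<^sub>E {1..d} B \<inter> space (P d \<Otimes>\<^sub>M P d) = Pi\<^sub>E {1..d} B1 \<times> Pi\<^sub>E {1..d} B2"
    using sub
    apply (auto simp: merged_def space_pair_measure space_PiM PiE_iff B1_def B2_def Ball_def split: if_splits)
    apply blast+
    done
  have "emeasure (distr (P d \<Otimes>\<^sub>M P d) (P d) (merged d A)) (Pi\<^sub>E {1..d} B) = emeasure (P d \<Otimes>\<^sub>M P d) (Pi\<^sub>E {1..d} B1 \<times> Pi\<^sub>E {1..d} B2)"
    using B by (subst emeasure_distr) (auto simp: pre intro!: sets_PiM_I_finite)
  also have "\<dots> = emeasure (P d) (Pi\<^sub>E {1..d} B1) * emeasure (P d) (Pi\<^sub>E {1..d} B2)"
    using B12 by (intro Pd.emeasure_pair_measure_Times sets_PiM_I_finite) auto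
  also have "\<dots> = (\<Prod>i\<in>{1..d}. emeasure Q (B1 i) * emeasure Q (B2 i))"
    using B12 PQ.emeasure_PiM[of "{1..d}" B1] PQ.emeasure_PiM[of "{1..d}" B2] by (simp add: prod.distrib)
  also have "\<dots> = (\<Prod>i\<in>{1..d}. emeasure Q (B i))"
    by (intro prod.cong) (auto simp: B1_def B2_def emeasure_space_1)
  finally show "emeasure (distr (P d \<Otimes>\<^sub>M P d) (P d) (merged d A)) (Pi\<^sub>E {1..d} B) = (\<Prod>i\<in>{1..d}. emeasure Q (B i))" .
qed auto


text \<open>Vanishing of all conditional expectations given fewer than \<open>r\<close> coordinates, arranged for
  induction on the number of arguments.\<close>

fun degenerate :: "nat \<Rightarrow> nat \<Rightarrow> ((nat \<Rightarrow> 'x) \<Rightarrow> real) \<Rightarrow> bool" where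
  "degenerate 0 r f \<longleftrightarrow> (0 < r \<longrightarrow> f (\<lambda>_. undefined) = 0)"
| "degenerate (Suc d) r f \<longleftrightarrow>
     (AE x in Q. degenerate d (r - 1) (\<lambda>z. f (z(Suc d := x)))) \<and>
     degenerate d r (\<lambda>z. \<integral>x. f (z(Suc d := x)) \<partial>Q)"

lemma borel_measurable_usum [measurable]:
  assumes "f \<in> borel_measurable (P d)" "n \<le> N"
  shows "usum d f n \<in> borel_measurable (P N)"
  unfolding usum_def using measurable_compose[OF measurable_select assms(1)] assms(2)
  by (intro borel_measurable_sum) auto

lemma usum_append_measurable:
  assumes [measurable]: "f \<in> borel_measurable (P (Suc d))" and n: "n \<le> N"
  shows "(\<lambda>(y, x). usum d (\<lambda>z. f (z(Suc d := x))) n y) \<in> borel_measurable (P N \<Otimes>\<^sub>M Q)"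
proof -
  have "(\<lambda>w. f ((\<lambda>k\<in>{1..d}. fst w (i k))(Suc d := snd w))) \<in> borel_measurable (P N \<Otimes>\<^sub>M Q)"
    if i: "i \<in> index_tuples d n" for i
  proof -
    have [measurable]: "(\<lambda>y. \<lambda>k\<in>{1..d}. y (i k)) \<in> P N \<rightarrow>\<^sub>M P d"
      using i n by (rule measurable_select)
    have "(\<lambda>w. (\<lambda>(z, x). z(Suc d := x)) (\<lambda>k\<in>{1..d}. fst w (i k), snd w)) \<in> P N \<Otimes>\<^sub>M Q \<rightarrow>\<^sub>M P (Suc d)"
      by (intro measurable_compose[OF _ measurable_append]) measurable
    from measurable_compose[OF this assms(1)] show ?thesis by simp
  qed
  then show ?thesis
    unfolding usum_def case_prod_unfold by (intro borel_measurable_sum) auto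
qed

lemma usum_resample:
  assumes "n < k"
  shows "usum d f n (y(k := x)) = usum d f n y"
  using assms by (intro usum_cong_coordinates) auto

lemma nn_integral_resample:
  assumes k: "k \<in> {1..N}" and [measurable]: "G \<in> borel_measurable (P N)"
  shows "(\<integral>\<^sup>+y. G y \<partial>P N) = (\<integral>\<^sup>+x. \<integral>\<^sup>+y. G (y(k := x)) \<partial>P N \<partial>Q)"
proof -
  interpret PQ': pair_sigma_finite "P N" Q by (rule pair_sigma_finite_PQ)
  note [measurable] = measurable_resample[OF k]
  have "(\<integral>\<^sup>+y. G y \<partial>P N) = (\<integral>\<^sup>+ w. G ((\<lambda>(y, x). y(k := x)) w) \<partial>(P N \<Otimes>\<^sub>M Q))"
    by (subst distr_resample[OF k, symmetric], subst nn_integral_distr) auto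
  also have "\<dots> = (\<integral>\<^sup>+x. \<integral>\<^sup>+y. G (y(k := x)) \<partial>P N \<partial>Q)"
    by (subst PQ'.nn_integral_snd[symmetric]) auto
  finally show ?thesis .
qed

lemma integral_resample:
  fixes G :: "(nat \<Rightarrow> 'x) \<Rightarrow> real"
  assumes k: "k \<in> {1..N}" and G: "integrable (P N) G"
  shows "(\<integral>y. G y \<partial>P N) = (\<integral>y. \<integral>x. G (y(k := x)) \<partial>Q \<partial>P N)"
proof -
  interpret PQ': pair_sigma_finite "P N" Q by (rule pair_sigma_finite_PQ)
  note [measurable] = measurable_resample[OF k]
  have [measurable]: "G \<in> borel_measurable (P N)" using G by auto
  have int: "integrable (P N \<Otimes>\<^sub>M Q) (\<lambda>w. G ((\<lambda>(y, x). y(k := x)) w))"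
    using G by (subst (asm) distr_resample[OF k, symmetric]) (subst (asm) integrable_distr_eq, auto)
  have "(\<integral>y. G y \<partial>P N) = (\<integral>w. G ((\<lambda>(y, x). y(k := x)) w) \<partial>(P N \<Otimes>\<^sub>M Q))"
    by (subst distr_resample[OF k, symmetric], subst integral_distr) auto
  also have "\<dots> = (\<integral>y. \<integral>x. G (y(k := x)) \<partial>Q \<partial>P N)"
    using PQ'.integral_fst'[OF int] by simp
  finally show ?thesis .
qed

text \<open>The function \<alpha> gives the \<open>L p\<close> norm of the section with the last
  argument fixed. It allows a bound for almost every fixed last argument to be integrated over that
  argument.\<close>

lemma Lp_le_section:
  assumes f: "Lp_le (P (Suc d)) p a f" and p: "p > 0"
  obtains \<alpha> where "AE x in Q. Lp_le (P d) p (\<alpha> x) (\<lambda>z. f (z(Suc d := x)))"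
    "\<alpha> \<in> borel_measurable Q" "(\<integral>\<^sup>+x. ennreal (\<alpha> x powr p) \<partial>Q) \<le> ennreal (a powr p)"
proof -
  note [measurable] = Lp_leD(2)[OF f]
  interpret PQ': pair_sigma_finite "P d" Q by (rule pair_sigma_finite_PQ)
  interpret QP: pair_sigma_finite Q "P d" by (rule pair_sigma_finite_QP)
  define I where "I x = (\<integral>\<^sup>+z. ennreal (\<bar>f (z(Suc d := x))\<bar> powr p) \<partial>P d)" for x
  define \<alpha> where "\<alpha> x = enn2real (I x) powr (1 / p)" for x
  have m: "(\<lambda>(x, z). ennreal (\<bar>f (z(Suc d := x))\<bar> powr p)) \<in> borel_measurable (Q \<Otimes>\<^sub>M P d)"
  proof -
    have "(\<lambda>w. f ((\<lambda>(z, x). z(Suc d := x)) (snd w, fst w))) \<in> borel_measurable (Q \<Otimes>\<^sub>M P d)"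
      by measurable
    then show ?thesis unfolding case_prod_unfold by measurable
  qed
  have Im [measurable]: "I \<in> borel_measurable Q"
    unfolding I_def using sigma_finite_measure.borel_measurable_nn_integral[OF sigma_finite_P m] by simp
  have le: "(\<integral>\<^sup>+x. I x \<partial>Q) \<le> ennreal (a powr p)"
  proof -
    have "(\<integral>\<^sup>+x. I x \<partial>Q) = (\<integral>\<^sup>+y. ennreal (\<bar>f y\<bar> powr p) \<partial>P (Suc d))"
      unfolding I_def by (rule nn_integral_append(2)[symmetric]) measurable
    then show ?thesis using Lp_leD(3)[OF f] by simp
  qed
  then have "(\<integral>\<^sup>+x. I x \<partial>Q) \<noteq> \<infinity>" by (auto simp: top_unique)
  then have fin: "AE x in Q. I x \<noteq> \<infinity>"
    by (intro nn_integral_PInf_AE) auto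
  have eq: "ennreal (\<alpha> x powr p) = I x" if "I x \<noteq> \<infinity>" for x
    using that p by (simp add: \<alpha>_def powr_powr less_top)
  show ?thesis
  proof (rule that[of \<alpha>])
    show "\<alpha> \<in> borel_measurable Q" unfolding \<alpha>_def by measurable
    have "(\<integral>\<^sup>+x. ennreal (\<alpha> x powr p) \<partial>Q) = (\<integral>\<^sup>+x. I x \<partial>Q)"
      by (intro nn_integral_cong_AE) (use fin in \<open>auto elim!: eventually_mono simp: eq\<close>)
    with le show "(\<integral>\<^sup>+x. ennreal (\<alpha> x powr p) \<partial>Q) \<le> ennreal (a powr p)" by simp
    have meas: "(\<lambda>z. f (z(Suc d := x))) \<in> borel_measurable (P d)" if x: "x \<in> space Q" for x
    proof -
      have "(\<lambda>z. (\<lambda>(z, x). z(Suc d := x)) (z, x)) \<in> P d \<rightarrow>\<^sub>M P (Suc d)"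
        using x by (intro measurable_compose[OF _ measurable_append]) measurable
      from measurable_compose[OF this Lp_leD(2)[OF f]] show ?thesis by simp
    qed
    show "AE x in Q. Lp_le (P d) p (\<alpha> x) (\<lambda>z. f (z(Suc d := x)))"
      using fin AE_space
    proof eventually_elim
      case (elim x)
      then show ?case
        using meas[of x] eq[of x] by (simp add: Lp_le_def I_def[symmetric]) (simp add: \<alpha>_def)
    qed
  qed
qed

lemma Lp_le_partial_integral:
  assumes f: "Lp_le (P (Suc d)) p a f" and p: "p \<ge> 1"
  shows "Lp_le (P d) p a (\<lambda>z. \<integral>x. f (z(Suc d := x)) \<partial>Q)"
proof -
  have "Lp_le (P d \<Otimes>\<^sub>M Q) p a (\<lambda>w. f ((\<lambda>(z, x). z(Suc d := x)) w))"
    using f by (subst (asm) distr_append[symmetric], subst (asm) Lp_le_distr_iff)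
      (auto intro: Lp_leD(2)[OF f])
  from Lp_le_integral_snd[OF sigma_finite_P this p] show ?thesis by simp
qed

end

section \<open>Moments of degenerate sums\<close>

context sample_law
begin

lemma integral_usum_append:
  assumes f: "integrable (P (Suc d)) f" and n: "n \<le> N"
  shows "AE y in P N. (\<integral>x. usum d (\<lambda>z. f (z(Suc d := x))) n y \<partial>Q) = usum d (\<lambda>z. \<integral>x. f (z(Suc d := x)) \<partial>Q) n y"
    "AE y in P N. integrable Q (\<lambda>x. usum d (\<lambda>z. f (z(Suc d := x))) n y)"
proof -
  have "AE y in P N. \<forall>i\<in>index_tuples d n. integrable Q (\<lambda>x. f ((\<lambda>k\<in>{1..d}. y (i k))(Suc d := x)))"
  proof (rule AE_finite_allI)
    fix i assume i: "i \<in> index_tuples d n"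
    have "AE z in distr (P N) (P d) (\<lambda>y. \<lambda>k\<in>{1..d}. y (i k)). integrable Q (\<lambda>x. f (z(Suc d := x)))"
      unfolding distr_select[OF i n] by (rule integral_append(2)[OF f])
    from AE_distrD[OF measurable_select[OF i n] this]
    show "AE y in P N. integrable Q (\<lambda>x. f ((\<lambda>k\<in>{1..d}. y (i k))(Suc d := x)))" .
  qed simp
  note ae = this
  show "AE y in P N. (\<integral>x. usum d (\<lambda>z. f (z(Suc d := x))) n y \<partial>Q) = usum d (\<lambda>z. \<integral>x. f (z(Suc d := x)) \<partial>Q) n y"
    using ae by eventually_elim (simp add: usum_def Bochner_Integration.integral_sum)
  show "AE y in P N. integrable Q (\<lambda>x. usum d (\<lambda>z. f (z(Suc d := x))) n y)"
    using ae by eventually_elim (simp add: usum_def)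
qed

text \<open>Origin of the 7: in one induction step the martingale part contributes
  \<open>2 * sqrt (8 * p)\<close> and the sum of lower order contributes 1.\<close>

lemma two_sqrt_8_le:
  fixes p :: real
  assumes "p \<ge> 2"
  shows "2 * sqrt (8 * p) + 1 \<le> 7 * sqrt p"
proof -
  have "sqrt 8 \<le> 3" by (rule real_le_lsqrt) (auto simp: power2_eq_square)
  moreover have "sqrt p \<ge> 1" using assms by simp
  ultimately have "sqrt 8 * sqrt p \<le> 3 * sqrt p" by (intro mult_right_mono) auto
  moreover have "sqrt (8 * p) = sqrt 8 * sqrt p" by (rule real_sqrt_mult)
  ultimately show ?thesis using \<open>sqrt p \<ge> 1\<close> by linarith
qed

text \<open>Coordinate \<open>k\<close> occurs only as the last argument, the remaining sum using
  smaller indices. It can therefore be frozen, the bound for fixed argument applied with the same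
  \<open>C\<close>, and the coordinate integrated afterwards.\<close>

lemma Lp_le_usum_append:
  assumes f: "Lp_le (P (Suc d)) p a f" and p: "p \<ge> 1" and k: "k \<in> {1..N}" and C: "C \<ge> 0"
    and IH: "AE x in Q. \<forall>\<alpha>. Lp_le (P d) p \<alpha> (\<lambda>z. f (z(Suc d := x))) \<longrightarrow>
      Lp_le (P N) p (C * \<alpha>) (usum d (\<lambda>z. f (z(Suc d := x))) (k - 1))"
  shows "Lp_le (P N) p (C * a) (\<lambda>y. usum d (\<lambda>z. f (z(Suc d := y k))) (k - 1) y)"
proof -
  obtain \<alpha> where \<alpha>: "AE x in Q. Lp_le (P d) p (\<alpha> x) (\<lambda>z. f (z(Suc d := x)))"
    and [measurable]: "\<alpha> \<in> borel_measurable Q" and \<alpha>le: "(\<integral>\<^sup>+x. ennreal (\<alpha> x powr p) \<partial>Q) \<le> ennreal (a powr p)"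
    using Lp_le_section[OF f] p by auto
  let ?G = "\<lambda>y. usum d (\<lambda>z. f (z(Suc d := y k))) (k - 1) y"
  have kN: "k - 1 \<le> N" using k by auto
  have "(\<lambda>y. (y, y k)) \<in> P N \<rightarrow>\<^sub>M P N \<Otimes>\<^sub>M Q" using k by measurable
  from measurable_compose[OF this usum_append_measurable[OF Lp_leD(2)[OF f] kN]]
  have G [measurable]: "?G \<in> borel_measurable (P N)" by simp
  have "(\<integral>\<^sup>+y. ennreal (\<bar>?G y\<bar> powr p) \<partial>P N) = (\<integral>\<^sup>+x. \<integral>\<^sup>+y. ennreal (\<bar>?G (y(k := x))\<bar> powr p) \<partial>P N \<partial>Q)"
    by (rule nn_integral_resample[OF k]) measurable
  also have "\<dots> = (\<integral>\<^sup>+x. \<integral>\<^sup>+y. ennreal (\<bar>usum d (\<lambda>z. f (z(Suc d := x))) (k - 1) y\<bar> powr p) \<partial>P N \<partial>Q)"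
    using k by (simp add: usum_resample)
  also have "\<dots> \<le> (\<integral>\<^sup>+x. ennreal (C powr p) * ennreal (\<alpha> x powr p) \<partial>Q)"
  proof (rule nn_integral_mono_AE)
    show "AE x in Q. (\<integral>\<^sup>+y. ennreal (\<bar>usum d (\<lambda>z. f (z(Suc d := x))) (k - 1) y\<bar> powr p) \<partial>P N) \<le> ennreal (C powr p) * ennreal (\<alpha> x powr p)"
      using \<alpha> IH
    proof eventually_elim
      case (elim x)
      then have "Lp_le (P N) p (C * \<alpha> x) (usum d (\<lambda>z. f (z(Suc d := x))) (k - 1))" by blast
      from Lp_leD(3)[OF this] show ?case
        using C Lp_leD(1)[OF elim(1)] by (simp add: ennreal_mult[symmetric] powr_mult)
    qed
  qed
  also have "\<dots> = ennreal (C powr p) * (\<integral>\<^sup>+x. ennreal (\<alpha> x powr p) \<partial>Q)"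
    by (rule nn_integral_cmult) measurable
  also have "\<dots> \<le> ennreal (C powr p) * ennreal (a powr p)"
    by (intro mult_left_mono \<alpha>le) auto
  also have "\<dots> = ennreal ((C * a) powr p)"
    using C Lp_leD(1)[OF f] by (simp add: ennreal_mult[symmetric] powr_mult)
  finally show ?thesis
    using G C Lp_leD(1)[OF f] by (simp add: Lp_le_def)
qed

text \<open>Splitting off the conditional mean over the last coordinate turns the sum over
  \<open>i 1 < \<dots> < i d\<close> into a martingale indexed by the largest index plus a sum of lower order.\<close>

lemma usum_bound:
  assumes p: "p \<ge> 2" and N: "N \<ge> 1"
  shows "Lp_le (P d) p a f \<Longrightarrow> degenerate d r f \<Longrightarrow> n \<le> N \<Longrightarrow>
    Lp_le (P N) p ((7 * sqrt p) ^ d * real N powr (real d - real r / 2) * a) (usum d f n)"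
proof (induction d arbitrary: a f r n)
  case 0
  interpret P0: prob_space "P 0" by (rule prob_space_P)
  interpret PN: prob_space "P N" by (rule prob_space_P)
  let ?c = "f (\<lambda>_. undefined)"
  have us: "usum 0 f n = (\<lambda>_. ?c)"
    by (auto simp: usum_def index_tuples_0 restrict_def fun_eq_iff)
  show ?case
  proof (cases "r = 0")
    case True
    have "(\<integral>\<^sup>+y. ennreal (\<bar>f y\<bar> powr p) \<partial>P 0) = ennreal (\<bar>?c\<bar> powr p)"
      using PQ.nn_integral_empty[of "\<lambda>y. ennreal (\<bar>f y\<bar> powr p)"] by simp
    then show ?thesis
      using Lp_leD[OF 0(1)] True N by (simp add: us Lp_le_def PN.emeasure_space_1)
  next
    case False
    then show ?thesis
      using 0(2) Lp_leD(1)[OF 0(1)] by (simp add: us Lp_le_def)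
  qed
next
  case (Suc d)
  interpret PN: prob_space "P N" by (rule prob_space_P)
  interpret PS: prob_space "P (Suc d)" by (rule prob_space_P)
  note f = Suc.prems(1)
  have fint: "integrable (P (Suc d)) f" using PS.Lp_le_integrable[OF f] p by simp
  have a: "a \<ge> 0" by (rule Lp_leD[OF f])
  define Df where "Df = (\<lambda>z. \<integral>x. f (z(Suc d := x)) \<partial>Q)"
  define D1 where "D1 k y = usum d (\<lambda>z. f (z(Suc d := y k))) (k - 1) y" for k y
  define D2 where "D2 k = usum d Df (k - 1)" for k
  define A where "A r = (7 * sqrt p) ^ d * real N powr (real d - real r / 2)" for r :: nat
  \<comment> \<open>Freezing one argument lowers the degeneracy to \<open>r - 1\<close> and raises
    the exponent of \<open>N\<close> by at most 1/2. \<open>B\<close> also dominates the averaged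
    kernel, and the truncated case \<open>r = 0\<close>, because \<open>N \<ge> 1\<close>.\<close>
  define B where "B = (7 * sqrt p) ^ d * real N powr (real d - real r / 2 + 1 / 2) * a"
  have A0: "A r \<ge> 0" for r unfolding A_def using p by auto
  have AB: "A (r - 1) * a \<le> B" "A r * a \<le> B"
    unfolding A_def B_def using p N a
    by (auto intro!: mult_right_mono mult_left_mono powr_mono simp: of_nat_diff add_divide_distrib split: nat_diff_split)
  have Df: "Lp_le (P d) p a Df"
    unfolding Df_def by (rule Lp_le_partial_integral[OF f]) (use p in simp)
  have degen: "AE x in Q. degenerate d (r - 1) (\<lambda>z. f (z(Suc d := x)))" "degenerate d r Df"
    using Suc.prems(2) by (auto simp: Df_def)
  have D1: "Lp_le (P N) p (A (r - 1) * a) (D1 k)" if k: "k \<in> {1..n}" for k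
    unfolding D1_def
  proof (rule Lp_le_usum_append[OF f])
    show "AE x in Q. \<forall>\<alpha>. Lp_le (P d) p \<alpha> (\<lambda>z. f (z(Suc d := x))) \<longrightarrow>
      Lp_le (P N) p (A (r - 1) * \<alpha>) (usum d (\<lambda>z. f (z(Suc d := x))) (k - 1))"
      using degen(1)
    proof eventually_elim
      case (elim x)
      show ?case
        unfolding A_def
      proof (intro allI impI)
        fix \<alpha> assume "Lp_le (P d) p \<alpha> (\<lambda>z. f (z(Suc d := x)))"
        then show "Lp_le (P N) p ((7 * sqrt p) ^ d * real N powr (real d - real (r - 1) / 2) * \<alpha>)
            (usum d (\<lambda>z. f (z(Suc d := x))) (k - 1))"
          by (rule Suc.IH[OF _ elim]) (use k Suc.prems(3) in auto)
      qed
    qed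
  qed (use p k Suc.prems(3) A0 in auto)
  have D2: "Lp_le (P N) p (A r * a) (D2 k)" if k: "k \<in> {1..n}" for k
    unfolding D2_def A_def by (rule Suc.IH[OF Df degen(2)]) (use k Suc.prems(3) in auto)
  \<comment> \<open>\<open>D2 k\<close> is the conditional mean of \<open>D1 k\<close> given the
    coordinates below \<open>k\<close>, so \<open>D k\<close> is a martingale difference.\<close>
  define D where "D k y = D1 k y - D2 k y" for k y
  have D: "Lp_le (P N) p (2 * B) (D k)" if k: "k \<in> {1..n}" for k
    unfolding D_def using Lp_le_mono[OF Lp_le_diff[OF D1[OF k] D2[OF k]], of "2 * B"] AB p by simp
  have Dcong: "D k y = D k y'" if "\<And>l. l \<in> {1..k} \<Longrightarrow> y l = y' l" "k \<ge> 1" for k y y'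
  proof -
    have "usum d h (k - 1) y = usum d h (k - 1) y'" for h
      using that by (intro usum_cong_coordinates) auto
    then show ?thesis using that(1)[of k] that(2) by (simp add: D_def D1_def D2_def)
  qed
  have D_mean: "AE y in P N. (\<integral>x. D k (y(k := x)) \<partial>Q) = 0" if k: "k \<in> {1..n}" for k
  proof -
    have kN: "k - 1 \<le> N" using k Suc.prems(3) by auto
    from integral_usum_append[OF fint kN] show ?thesis
    proof eventually_elim
      case (elim y)
      have "D k (y(k := x)) = usum d (\<lambda>z. f (z(Suc d := x))) (k - 1) y - usum d Df (k - 1) y" for x
        using k by (simp add: D_def D1_def D2_def usum_resample)
      then show ?case using elim by (simp add: Df_def prob_space)
    qed
  qed
  define S where "S m y = (\<Sum>k\<in>{1..m}. D k y)" for m :: nat and y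
  have S: "Lp_le (P N) p (sqrt (8 * p * real m) * (2 * B)) (S m)" if "m \<le> n" for m
    using that
  proof (induction m)
    case 0
    then show ?case by (simp add: S_def Lp_le_zero)
  next
    case (Suc m)
    have k: "Suc m \<in> {1..n}" "Suc m \<in> {1..N}" using Suc.prems \<open>n \<le> N\<close> by auto
    have Sm: "Lp_le (P N) p (sqrt (8 * p * real m) * (2 * B)) (S m)" using Suc by simp
    have res: "S m (y(Suc m := x)) = S m y" for y x
      unfolding S_def by (intro sum.cong refl Dcong) auto
    \<comment> \<open>\<open>S m\<close> does not depend on coordinate \<open>Suc m\<close>, over
      which the new difference has mean zero. A product that is not integrable has integral 0 by
      convention.\<close>
    have orth: "(\<integral>y. sgn (S m y) * \<bar>S m y\<bar> powr (p - 1) * D (Suc m) y \<partial>P N) = 0"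
    proof (cases "integrable (P N) (\<lambda>y. sgn (S m y) * \<bar>S m y\<bar> powr (p - 1) * D (Suc m) y)")
      case True
      have "(\<integral>y. sgn (S m y) * \<bar>S m y\<bar> powr (p - 1) * D (Suc m) y \<partial>P N)
        = (\<integral>y. \<integral>x. sgn (S m y) * \<bar>S m y\<bar> powr (p - 1) * D (Suc m) (y(Suc m := x)) \<partial>Q \<partial>P N)"
        by (subst integral_resample[OF k(2) True]) (simp add: res)
      also have "\<dots> = 0"
      proof (rule integral_eq_zero_AE)
        show "AE y in P N. (\<integral>x. sgn (S m y) * \<bar>S m y\<bar> powr (p - 1) * D (Suc m) (y(Suc m := x)) \<partial>Q) = 0"
          using D_mean[OF k(1)] by eventually_elim simp
      qed
      finally show ?thesis .
    qed (rule not_integrable_integral_eq)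
    have B0: "B \<ge> 0" unfolding B_def using p a by auto
    have "(sqrt (8 * p * real m) * (2 * B))\<^sup>2 + 8 * p * (2 * B)\<^sup>2 = 8 * p * real (Suc m) * (2 * B)\<^sup>2"
      using p by (simp add: power_mult_distrib algebra_simps)
    also have "\<dots> = (sqrt (8 * p * real (Suc m)) * (2 * B))\<^sup>2"
      using p by (simp add: power_mult_distrib)
    finally have "sqrt ((sqrt (8 * p * real m) * (2 * B))\<^sup>2 + 8 * p * (2 * B)\<^sup>2) = sqrt (8 * p * real (Suc m)) * (2 * B)"
      using B0 p by (intro real_sqrt_unique) auto
    moreover have "S (Suc m) = (\<lambda>y. S m y + D (Suc m) y)" by (simp add: S_def fun_eq_iff)
    ultimately show ?case
      using Lp_le_add_orthogonal[OF Sm D[OF k(1)] p orth] by simp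
  qed
  have E: "Lp_le (P N) p (\<Sum>k\<in>{1..n}. A r * a) (\<lambda>y. \<Sum>k\<in>{1..n}. D2 k y)"
    using p by (intro Lp_le_sum D2) auto
  have eq: "usum (Suc d) f n = (\<lambda>y. S n y + (\<Sum>k\<in>{1..n}. D2 k y))"
    by (simp add: usum_Suc S_def D_def D1_def sum_subtractf fun_eq_iff)
  have "Lp_le (P N) p (sqrt (8 * p * real n) * (2 * B) + (\<Sum>k\<in>{1..n}. A r * a)) (usum (Suc d) f n)"
    unfolding eq using p by (intro Lp_le_add S E) auto
  moreover have "sqrt (8 * p * real n) * (2 * B) + (\<Sum>k\<in>{1..n}. A r * a)
      \<le> (7 * sqrt p) ^ Suc d * real N powr (real (Suc d) - real r / 2) * a"
  proof -
    have B0: "B \<ge> 0" unfolding B_def using p a by auto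
    \<comment> \<open>Both parts have the same order in \<open>N\<close>: the martingale gains
      \<open>sqrt N\<close> over \<open>B\<close>, and the lower sum gains \<open>N\<close> over
      \<open>A r * a\<close>.\<close>
    define V where "V = (7 * sqrt p) ^ d * real N powr (real (Suc d) - real r / 2) * a"
    have V0: "V \<ge> 0" unfolding V_def using p a by auto
    have "sqrt (real N) * real N powr (real d - real r / 2 + 1 / 2) = real N powr (1 / 2 + (real d - real r / 2 + 1 / 2))"
      unfolding powr_add by (simp add: powr_half_sqrt)
    also have "1 / 2 + (real d - real r / 2 + 1 / 2) = real (Suc d) - real r / 2" by simp
    finally have e1: "sqrt (real N) * real N powr (real d - real r / 2 + 1 / 2) = real N powr (real (Suc d) - real r / 2)" .
    have "sqrt (real N) * B = (7 * sqrt p) ^ d * (sqrt (real N) * real N powr (real d - real r / 2 + 1 / 2)) * a"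
      unfolding B_def by (simp only: mult_ac)
    then have "sqrt (real N) * B = V"
      unfolding e1 V_def .
    moreover have e2: "real N * real N powr (real d - real r / 2) = real N powr (real (Suc d) - real r / 2)"
      using N powr_mult_base[of "real N" "real d - real r / 2"] by (simp add: add_diff_eq)
    have "real N * (A r * a) = (7 * sqrt p) ^ d * (real N * real N powr (real d - real r / 2)) * a"
      unfolding A_def by (simp only: mult_ac)
    then have "real N * (A r * a) = V"
      unfolding e2 V_def .
    moreover have "sqrt (8 * p * real n) * (2 * B) \<le> sqrt (8 * p * real N) * (2 * B)"
      using B0 p Suc.prems(3) by (intro mult_right_mono) auto
    moreover have "sqrt (8 * p * real N) * (2 * B) = 2 * sqrt (8 * p) * (sqrt (real N) * B)"
      by (simp add: real_sqrt_mult)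
    moreover have "real n * (A r * a) \<le> real N * (A r * a)"
      using A0[of r] a Suc.prems(3) by (intro mult_right_mono) auto
    ultimately have "sqrt (8 * p * real n) * (2 * B) + (\<Sum>k\<in>{1..n}. A r * a) \<le> (2 * sqrt (8 * p) + 1) * V"
      by (simp add: distrib_right)
    also have "\<dots> \<le> 7 * sqrt p * V"
      using V0 two_sqrt_8_le[OF p] by (rule mult_right_mono[rotated])
    also have "\<dots> = (7 * sqrt p) ^ Suc d * real N powr (real (Suc d) - real r / 2) * a"
      by (simp add: V_def)
    finally show ?thesis .
  qed
  ultimately show ?case by (rule Lp_le_mono) (use p in simp)
qed


text \<open>The conditional expectation of \<open>f\<close> given the coordinates in
  \<open>A\<close>.\<close>

definition partial_mean :: "nat \<Rightarrow> nat set \<Rightarrow> ((nat \<Rightarrow> 'x) \<Rightarrow> real) \<Rightarrow> (nat \<Rightarrow> 'x) \<Rightarrow> real" where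
  "partial_mean d A f x = (\<integral>y. f (merged d A (x, y)) \<partial>P d)"

lemma integrable_merged:
  fixes f :: "(nat \<Rightarrow> 'x) \<Rightarrow> real"
  assumes f: "integrable (P d) f"
  shows "integrable (P d \<Otimes>\<^sub>M P d) (\<lambda>w. f (merged d A w))"
    "AE x in P d. integrable (P d) (\<lambda>y. f (merged d A (x, y)))"
proof -
  interpret PP: pair_sigma_finite "P d" "P d" by (intro pair_sigma_finite.intro sigma_finite_P)
  have [measurable]: "f \<in> borel_measurable (P d)" using f by auto
  show *: "integrable (P d \<Otimes>\<^sub>M P d) (\<lambda>w. f (merged d A w))"
    using f by (subst (asm) distr_merged[of d A, symmetric]) (subst (asm) integrable_distr_eq, auto)
  show "AE x in P d. integrable (P d) (\<lambda>y. f (merged d A (x, y)))"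
    using PP.AE_integrable_fst'[OF *] .
qed

lemma integral_partial_mean:
  assumes f: "integrable (P d) f"
  shows "integrable (P d) (partial_mean d A f)" "(\<integral>x. partial_mean d A f x \<partial>P d) = (\<integral>x. f x \<partial>P d)"
proof -
  interpret PP: pair_sigma_finite "P d" "P d" by (intro pair_sigma_finite.intro sigma_finite_P)
  have [measurable]: "f \<in> borel_measurable (P d)" using f by auto
  note int = integrable_merged(1)[OF f, of A]
  show "integrable (P d) (partial_mean d A f)"
    unfolding partial_mean_def using PP.integrable_fst'[OF int] by simp
  have "(\<integral>x. f x \<partial>P d) = (\<integral>w. f (merged d A w) \<partial>(P d \<Otimes>\<^sub>M P d))"
    by (subst distr_merged[of d A, symmetric], subst integral_distr) auto
  then show "(\<integral>x. partial_mean d A f x \<partial>P d) = (\<integral>x. f x \<partial>P d)"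
    unfolding partial_mean_def using PP.integral_fst'[OF int] by simp
qed

lemma merged_append_in:
  "merged (Suc d) (insert (Suc d) A) (z(Suc d := x), y(Suc d := u)) = (merged d A (z, y))(Suc d := x)"
  by (auto simp: merged_def fun_eq_iff)

lemma merged_append_notin:
  "Suc d \<notin> A \<Longrightarrow> merged (Suc d) A (z(Suc d := x), y(Suc d := u)) = (merged d A (z, y))(Suc d := u)"
  by (auto simp: merged_def fun_eq_iff)

lemma partial_mean_append_in:
  assumes "integrable (P (Suc d)) (\<lambda>y. f (merged (Suc d) (insert (Suc d) A) (z(Suc d := x), y)))"
  shows "partial_mean (Suc d) (insert (Suc d) A) f (z(Suc d := x)) = partial_mean d A (\<lambda>z. f (z(Suc d := x))) z"
  unfolding partial_mean_def by (subst integral_append(4)[OF assms]) (simp add: merged_append_in prob_space)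

lemma partial_mean_append_notin:
  assumes "integrable (P (Suc d)) (\<lambda>y. f (merged (Suc d) A (z(Suc d := x), y)))" "Suc d \<notin> A"
  shows "partial_mean (Suc d) A f (z(Suc d := x)) = partial_mean d A (\<lambda>z. \<integral>u. f (z(Suc d := u)) \<partial>Q) z"
  unfolding partial_mean_def using assms(2) by (subst integral_append(4)[OF assms(1)]) (simp add: merged_append_notin)

text \<open>The recursion of \<open>degenerate\<close> splits according to the last coordinate: sets
  that contain it give the condition on sections, with one coordinate fewer to fix, and the others
  give the condition on the averaged kernel.\<close>

lemma degenerateI:
  assumes "integrable (P d) f"
    and "\<And>A. A \<subseteq> {1..d} \<Longrightarrow> card A < r \<Longrightarrow> AE x in P d. partial_mean d A f x = 0"
  shows "degenerate d r f"
  using assms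
proof (induction d arbitrary: f r)
  case 0
  interpret P0: prob_space "P 0" by (rule prob_space_P)
  show ?case
  proof (cases "r = 0")
    case False
    have "merged 0 {} w = (\<lambda>_. undefined)" for w by (cases w) (auto simp: merged_def)
    then have "partial_mean 0 {} f x = f (\<lambda>_. undefined)" for x
      using P0.prob_space by (simp add: partial_mean_def)
    then have "AE x in P 0. f (\<lambda>_. undefined) = 0"
      using 0(2)[of "{}"] False by simp
    then show ?thesis by simp
  qed simp
next
  case (Suc d)
  note f = Suc.prems(1)
  have fin: "finite {A. A \<subseteq> {1..d} \<and> card A < r}" for r :: nat by simp
  have "AE x in Q. \<forall>A\<in>{A. A \<subseteq> {1..d} \<and> card A < r - 1}. AE z in P d. partial_mean d A (\<lambda>z. f (z(Suc d := x))) z = 0"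
  proof (rule AE_finite_allI[OF fin])
    fix A assume A: "A \<in> {A. A \<subseteq> {1..d} \<and> card A < r - 1}"
    then have "finite A" by (auto intro: finite_subset)
    moreover have "Suc d \<notin> A" using A by auto
    ultimately have A': "insert (Suc d) A \<subseteq> {1..Suc d}" "card (insert (Suc d) A) < r"
      using A by auto
    have "AE y in P (Suc d). partial_mean (Suc d) (insert (Suc d) A) f y = 0 \<and>
        integrable (P (Suc d)) (\<lambda>y'. f (merged (Suc d) (insert (Suc d) A) (y, y')))"
      using Suc.prems(2)[OF A'] integrable_merged(2)[OF f, of "insert (Suc d) A"] by eventually_elim simp
    from AE_append(2)[OF this]
    show "AE x in Q. AE z in P d. partial_mean d A (\<lambda>z. f (z(Suc d := x))) z = 0"
    proof eventually_elim
      case (elim x)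
      then show ?case
        by (rule eventually_mono) (erule conjE, subst partial_mean_append_in[symmetric], assumption+)
    qed
  qed
  with integral_append(1)[OF f] have "AE x in Q. degenerate d (r - 1) (\<lambda>z. f (z(Suc d := x)))"
    by eventually_elim (rule Suc.IH, auto simp del: fun_upd_apply)
  moreover have "degenerate d r (\<lambda>z. \<integral>x. f (z(Suc d := x)) \<partial>Q)"
  proof (rule Suc.IH[OF integral_append(3)[OF f]])
    fix A assume A: "A \<subseteq> {1..d}" "card A < r"
    then have nin: "Suc d \<notin> A" and A': "A \<subseteq> {1..Suc d}" by auto
    have "AE y in P (Suc d). partial_mean (Suc d) A f y = 0 \<and>
        integrable (P (Suc d)) (\<lambda>y'. f (merged (Suc d) A (y, y')))"
      using Suc.prems(2)[OF A' A(2)] integrable_merged(2)[OF f, of A] by eventually_elim simp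
    from AE_append(1)[OF this]
    show "AE z in P d. partial_mean d A (\<lambda>z. \<integral>x. f (z(Suc d := x)) \<partial>Q) z = 0"
    proof eventually_elim
      case (elim z)
      then have "AE x in Q. partial_mean d A (\<lambda>z. \<integral>x. f (z(Suc d := x)) \<partial>Q) z = 0"
        by (rule eventually_mono) (erule conjE, subst partial_mean_append_notin[symmetric], assumption, rule nin, assumption)
      then show ?case by simp
    qed
  qed
  ultimately show ?case by simp
qed

text \<open>The rank is defined by the initial segments of the arguments. A permutation that carries
  the segment of length \<open>card A\<close> onto \<open>A\<close> preserves the product law and,
  by symmetry, the kernel.\<close>

lemma AE_partial_mean_permute:
  assumes sym: "\<And>\<pi> x. \<pi> permutes {1..d} \<Longrightarrow> x \<in> space (P d) \<Longrightarrow> f (x \<circ> \<pi>) = f x"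
    and f: "integrable (P d) f"
    and A: "A \<subseteq> {1..d}"
    and ae: "AE x in P d. partial_mean d {1..card A} f x = 0"
  shows "AE x in P d. partial_mean d A f x = 0"
proof -
  let ?C = "{1..card A}"
  have finA: "finite A" using A finite_subset by blast
  have cA: "card A \<le> d" using card_mono[OF _ A] by simp
  obtain g where g: "bij_betw g ?C A" using finA finite_same_card_bij[of ?C A] by auto
  have "card ({1..d} - ?C) = card ({1..d} - A)"
    using cA A finA by (simp add: card_Diff_subset)
  then obtain h where h: "bij_betw h ({1..d} - ?C) ({1..d} - A)"
    using finite_same_card_bij[of "{1..d} - ?C" "{1..d} - A"] by auto
  define \<pi> where "\<pi> i = (if i \<in> ?C then g i else if i \<in> {1..d} then h i else i)" for i
  have "bij_betw \<pi> ?C A" using g by (rule bij_betw_cong[THEN iffD1, rotated]) (simp add: \<pi>_def)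
  moreover have "bij_betw \<pi> ({1..d} - ?C) ({1..d} - A)"
    using h by (rule bij_betw_cong[THEN iffD1, rotated]) (simp add: \<pi>_def)
  ultimately have "bij_betw \<pi> (?C \<union> ({1..d} - ?C)) (A \<union> ({1..d} - A))"
    by (rule bij_betw_combine) auto
  moreover have "?C \<union> ({1..d} - ?C) = {1..d}" "A \<union> ({1..d} - A) = {1..d}"
    using cA A by auto
  ultimately have bij: "bij_betw \<pi> {1..d} {1..d}" by simp
  have \<pi>: "\<pi> permutes {1..d}"
    using bij by (rule bij_imp_permutes) (use cA in \<open>auto simp: \<pi>_def\<close>)
  have mem: "\<pi> k \<in> A \<longleftrightarrow> k \<in> ?C" if "k \<in> {1..d}" for k
    using that bij_betwE[OF g] bij_betwE[OF h] by (auto simp: \<pi>_def)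
  define T where "T = (\<lambda>y::nat \<Rightarrow> 'x. \<lambda>k\<in>{1..d}. y (\<pi> k))"
  have inj: "inj_on \<pi> {1..d}" and fn: "\<pi> \<in> {1..d} \<rightarrow> {1..d}"
    using bij by (auto simp: bij_betw_def)
  have Tm [measurable]: "T \<in> P d \<rightarrow>\<^sub>M P d"
    unfolding T_def using fn by (intro measurable_restrict measurable_component_singleton) auto
  have dT: "distr (P d) (P d) T = P d"
    unfolding T_def using distr_PiM_reindex[of "{1..d}" "\<lambda>_. Q" \<pi> "{1..d}"] prob_space_axioms inj fn by simp
  have key: "f (merged d A (x, y)) = f (merged d ?C (T x, T y))"
    if x: "x \<in> space (P d)" and y: "y \<in> space (P d)" for x y
  proof -
    have m: "merged d A (x, y) \<in> space (P d)"
      using measurable_space[OF measurable_merged, of "(x, y)" d A] x y by (simp add: space_pair_measure)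
    have "merged d A (x, y) \<circ> \<pi> = merged d ?C (T x, T y)"
    proof (rule ext)
      fix k
      show "(merged d A (x, y) \<circ> \<pi>) k = merged d ?C (T x, T y) k"
      proof (cases "k \<in> {1..d}")
        case True
        then show ?thesis using fn mem[OF True] by (auto simp: merged_def T_def)
      next
        case False
        then have "\<pi> k = k" using \<pi> by (rule permutes_not_in[rotated])
        then show ?thesis using False by (auto simp: merged_def)
      qed
    qed
    then show ?thesis using sym[OF \<pi> m] by simp
  qed
  have "AE x in P d. integrable (P d) (\<lambda>y. f (merged d ?C (x, y))) \<and> partial_mean d ?C f x = 0"
    using ae integrable_merged(2)[OF f] by eventually_elim simp
  then have "AE x in distr (P d) (P d) T. integrable (P d) (\<lambda>y. f (merged d ?C (x, y))) \<and> partial_mean d ?C f x = 0"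
    by (simp only: dT)
  from AE_distrD[OF Tm this] AE_space show ?thesis
  proof eventually_elim
    case (elim x)
    have m: "(\<lambda>y. f (merged d ?C (T x, y))) \<in> borel_measurable (P d)" using elim by auto
    have "partial_mean d A f x = (\<integral>y. f (merged d ?C (T x, T y)) \<partial>P d)"
      unfolding partial_mean_def using elim by (intro Bochner_Integration.integral_cong) (auto simp: key)
    also have "\<dots> = (\<integral>y. f (merged d ?C (T x, y)) \<partial>distr (P d) (P d) T)"
      by (subst integral_distr[OF Tm]) (use m in auto)
    also have "\<dots> = partial_mean d ?C f (T x)"
      by (simp add: dT partial_mean_def)
    finally show ?case using elim by simp
  qed
qed

end

section \<open>U-statistics of independent samples\<close>

lemma (in sample_law) Lp_le_partial_mean:
  assumes f: "Lp_le (P d) p a f" and p: "p \<ge> 1"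
  shows "Lp_le (P d) p a (partial_mean d A f)"
proof -
  interpret Pd: prob_space "P d" by (rule prob_space_P)
  have "Lp_le (P d \<Otimes>\<^sub>M P d) p a (\<lambda>w. f (merged d A w))"
    using f by (subst (asm) distr_merged[of d A, symmetric], subst (asm) Lp_le_distr_iff)
      (auto intro: Lp_leD(2)[OF f])
  from Pd.Lp_le_integral_snd[OF sigma_finite_P this p] show ?thesis
    unfolding partial_mean_def .
qed

locale iid_sample = prob_space M for M :: "'a measure" +
  fixes S :: "'x measure" and \<xi> :: "nat \<Rightarrow> 'a \<Rightarrow> 'x"
  assumes iid: "iid_sequence M S \<xi>"
begin

definition "Q = distr M S (\<xi> 1)"

lemma measurable_\<xi> [measurable]: "i \<ge> 1 \<Longrightarrow> \<xi> i \<in> M \<rightarrow>\<^sub>M S"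
  using iid by (auto simp: iid_sequence_def indep_vars_def2)

lemma sets_Q [measurable_cong, simp]: "sets Q = sets S"
  by (simp add: Q_def)

lemma space_Q [simp]: "space Q = space S"
  by (simp add: Q_def)

sublocale law: sample_law Q
  unfolding sample_law_def Q_def by (rule prob_space_distr) simp

abbreviation sample :: "nat \<Rightarrow> 'a \<Rightarrow> nat \<Rightarrow> 'x" where
  "sample N \<omega> \<equiv> \<lambda>i\<in>{1..N}. \<xi> i \<omega>"

lemma sets_P: "sets (law.P N) = sets (PiM {1..N} (\<lambda>_. S))"
  by (intro sets_PiM_cong) auto

lemma measurable_sample [measurable]: "sample N \<in> M \<rightarrow>\<^sub>M law.P N"
  by (intro measurable_restrict) (auto simp: measurable_cong_sets[OF refl sets_Q])

lemma distr_sample: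
  assumes "N \<ge> 1"
  shows "distr M (law.P N) (sample N) = law.P N"
proof -
  have ne: "{1..N} \<noteq> {}" using assms by auto
  have "indep_vars (\<lambda>_. S) \<xi> {1..N}"
    using iid by (auto simp: iid_sequence_def intro: indep_vars_subset)
  then have "distr M (PiM {1..N} (\<lambda>_. S)) (sample N) = PiM {1..N} (\<lambda>i. distr M S (\<xi> i))"
    by (subst (asm) indep_vars_iff_distr_eq_PiM'[OF ne]) auto
  also have "\<dots> = law.P N"
  proof (rule PiM_cong)
    fix i assume "i \<in> {1..N}"
    then have "1 \<le> i" by simp
    then show "distr M S (\<xi> i) = Q"
      using iid unfolding iid_sequence_def Q_def by blast
  qed simp
  also have "distr M (PiM {1..N} (\<lambda>_. S)) (sample N) = distr M (law.P N) (sample N)"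
    by (intro distr_cong) (auto simp: sets_P)
  finally show ?thesis .
qed

lemma kernel_var_eq: "kernel_var \<xi> d f \<omega> = f (sample d \<omega>)"
  by (simp add: kernel_var_def)

lemma Lp_le_kernel_var:
  assumes "d \<ge> 1" "f \<in> borel_measurable (law.P d)"
  shows "Lp_le (law.P d) p a f \<longleftrightarrow> Lp_le M p a (kernel_var \<xi> d f)"
  using Lp_le_distr_iff[OF measurable_sample assms(2)] distr_sample[OF assms(1)]
  by (simp add: kernel_var_eq[abs_def])

lemma integral_kernel_var:
  assumes "d \<ge> 1" "f \<in> borel_measurable (law.P d)"
  shows "(\<integral>\<omega>. kernel_var \<xi> d f \<omega> \<partial>M) = (\<integral>y. f y \<partial>law.P d)"
  using integral_distr[OF measurable_sample assms(2)] distr_sample[OF assms(1)]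
  by (simp add: kernel_var_eq)

lemma U_stat_eq_usum: "U_stat \<xi> d f n \<omega> = usum d f n (sample n \<omega>) / real (n choose d)"
proof -
  have "(\<lambda>k\<in>{1..d}. sample n \<omega> (i k)) = (\<lambda>k\<in>{1..d}. \<xi> (i k) \<omega>)" if "i \<in> index_tuples d n" for i
    using index_tuplesD[OF that] by (auto simp: fun_eq_iff)
  then show ?thesis by (simp add: U_stat_def usum_def)
qed

text \<open>The powers of \<open>n\<close> multiply to \<open>n ^ d\<close>, and dividing by the
  binomial coefficient, which is at least \<open>(n / d) ^ d\<close>, leaves
  \<open>d ^ d\<close>.\<close>

lemma Lp_le_normed_U_stat:
  assumes d: "d \<ge> 1" and n: "n > d" and f: "Lp_le (law.P d) p a f" and p: "p \<ge> 2"
    and deg: "law.degenerate d r f"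
  shows "Lp_le M p ((7 * real d * sqrt p) ^ d * a) (\<lambda>\<omega>. real n powr (real r / 2) * U_stat \<xi> d f n \<omega>)"
proof -
  have n1: "n \<ge> 1" using n by simp
  have a: "a \<ge> 0" by (rule Lp_leD[OF f])
  note us = law.usum_bound[OF p n1 f deg order_refl]
  let ?c = "real n powr (real r / 2) / real (n choose d)"
  have "Lp_le M p ((7 * sqrt p) ^ d * real n powr (real d - real r / 2) * a) (\<lambda>\<omega>. usum d f n (sample n \<omega>))"
    using us by (subst (asm) distr_sample[OF n1, symmetric], subst (asm) Lp_le_distr_iff)
      (auto intro: law.borel_measurable_usum Lp_leD(2)[OF f])
  from Lp_le_cmult[OF this, of ?c]
  have L: "Lp_le M p (?c * ((7 * sqrt p) ^ d * real n powr (real d - real r / 2) * a))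
      (\<lambda>\<omega>. real n powr (real r / 2) * U_stat \<xi> d f n \<omega>)"
    by (simp add: U_stat_eq_usum)
  have ch: "(real n / real d) ^ d \<le> real (n choose d)"
    using binomial_ge_n_over_k_pow_k[of d n, where ?'a = real] n by simp
  have chpos: "real (n choose d) > 0" using n by simp
  have "real n powr (real r / 2) * real n powr (real d - real r / 2) = real n ^ d"
    using n1 by (simp add: powr_add[symmetric] powr_realpow)
  also have "\<dots> = real d ^ d * (real n / real d) ^ d"
    using d by (simp add: power_divide)
  also have "\<dots> \<le> real d ^ d * real (n choose d)"
    by (intro mult_left_mono ch) auto
  finally have "?c * real n powr (real d - real r / 2) \<le> real d ^ d"
    using chpos by (simp add: divide_le_eq)
  then have "(?c * real n powr (real d - real r / 2)) * ((7 * sqrt p) ^ d * a) \<le> real d ^ d * ((7 * sqrt p) ^ d * a)"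
    using a p by (intro mult_right_mono) auto
  also have "\<dots> = (7 * real d * sqrt p) ^ d * a"
    by (simp add: power_mult_distrib)
  finally show ?thesis
    using p by (intro Lp_le_mono[OF L]) (auto simp: mult_ac)
qed

lemma integral_U_stat:
  assumes d: "d \<ge> 1" and n: "n > d" and f: "integrable (law.P d) f" and mean: "(\<integral>y. f y \<partial>law.P d) = 0"
  shows "(\<integral>\<omega>. U_stat \<xi> d f n \<omega> \<partial>M) = 0"
proof -
  have n1: "n \<ge> 1" using n by simp
  have fm [measurable]: "f \<in> borel_measurable (law.P d)" using f by auto
  have sel: "integrable (law.P n) (\<lambda>y. f (\<lambda>k\<in>{1..d}. y (i k)))"
    "(\<integral>y. f (\<lambda>k\<in>{1..d}. y (i k)) \<partial>law.P n) = 0"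
    if i: "i \<in> index_tuples d n" for i
  proof -
    note m = law.measurable_select[OF i order_refl]
    show "integrable (law.P n) (\<lambda>y. f (\<lambda>k\<in>{1..d}. y (i k)))"
      using f integrable_distr_eq[OF m fm] by (simp only: law.distr_select[OF i order_refl])
    show "(\<integral>y. f (\<lambda>k\<in>{1..d}. y (i k)) \<partial>law.P n) = 0"
      using mean integral_distr[OF m fm] by (simp only: law.distr_select[OF i order_refl])
  qed
  have "(\<integral>\<omega>. U_stat \<xi> d f n \<omega> \<partial>M) = (\<integral>\<omega>. usum d f n (sample n \<omega>) \<partial>M) / real (n choose d)"
    by (simp add: U_stat_eq_usum)
  also have "(\<integral>\<omega>. usum d f n (sample n \<omega>) \<partial>M) = (\<integral>y. usum d f n y \<partial>law.P n)"
    using integral_distr[OF measurable_sample law.borel_measurable_usum[OF fm order_refl[of n]]] distr_sample[OF n1] by simp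
  also have "\<dots> = 0"
    unfolding usum_def by (subst Bochner_Integration.integral_sum) (auto simp: sel)
  finally show ?thesis by simp
qed

text \<open>Minimality of the rank excludes a positive variance of the projection on the first
  \<open>card A\<close> arguments, and a centred function with vanishing second moment is zero
  almost everywhere. Symmetry transports this to \<open>A\<close>. The empty set lies outside the
  range of the rank and is settled by centring.\<close>

lemma AE_partial_mean_below_rank:
  assumes d: "d \<ge> 1" and ker: "measurable_symmetric_kernel d S f" and var: "0 < var_of M (kernel_var \<xi> d f)"
    and mean: "(\<integral>\<omega>. kernel_var \<xi> d f \<omega> \<partial>M) = 0" and f: "Lp_le (law.P d) 2 a f"
    and A: "A \<subseteq> {1..d}" "card A < hoeffding_rank M \<xi> d f"
  shows "AE x in law.P d. law.partial_mean d A f x = 0"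
proof -
  interpret Pd: prob_space "law.P d" by (rule law.prob_space_P)
  have fm [measurable]: "f \<in> borel_measurable (law.P d)" by (rule Lp_leD[OF f])
  have fint: "integrable (law.P d) f" using Pd.Lp_le_integrable[OF f] by simp
  have fmean: "(\<integral>y. f y \<partial>law.P d) = 0" using mean integral_kernel_var[OF d fm] by simp
  let ?c = "card A"
  let ?g = "law.partial_mean d {1..?c} f"
  have kp: "kernel_projection M \<xi> d f c (\<lambda>k. \<xi> k \<omega>) = law.partial_mean d {1..c} f (sample d \<omega>)"
    if \<omega>: "\<omega> \<in> space M" for c \<omega>
  proof -
    have x: "sample d \<omega> \<in> space (law.P d)" using measurable_space[OF measurable_sample \<omega>] .
    have "(\<lambda>y. (sample d \<omega>, y)) \<in> law.P d \<rightarrow>\<^sub>M law.P d \<Otimes>\<^sub>M law.P d"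
      using x by (rule measurable_Pair1')
    from measurable_compose[OF this measurable_compose[OF law.measurable_merged fm]]
    have m: "(\<lambda>y. f (law.merged d {1..c} (sample d \<omega>, y))) \<in> borel_measurable (law.P d)" by simp
    have "(\<lambda>k\<in>{1..d}. if k \<le> c then \<xi> k \<omega> else \<xi> k \<omega>') = law.merged d {1..c} (sample d \<omega>, sample d \<omega>')" for \<omega>'
      by (auto simp: law.merged_def fun_eq_iff)
    then have "kernel_projection M \<xi> d f c (\<lambda>k. \<xi> k \<omega>) = (\<integral>\<omega>'. f (law.merged d {1..c} (sample d \<omega>, sample d \<omega>')) \<partial>M)"
      by (simp add: kernel_projection_def mean)
    also have "\<dots> = law.partial_mean d {1..c} f (sample d \<omega>)"
      using integral_distr[OF measurable_sample m] distr_sample[OF d] by (simp add: law.partial_mean_def)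
    finally show ?thesis .
  qed
  have top: "law.partial_mean d {1..d} f x = f x" if x: "x \<in> space (law.P d)" for x
  proof -
    have "law.merged d {1..d} (x, y) = x" for y
      using x by (auto simp: law.merged_def fun_eq_iff space_PiM PiE_iff extensional_def)
    then show ?thesis using Pd.prob_space by (simp add: law.partial_mean_def)
  qed
  let ?R = "\<lambda>c. c \<in> {1..d} \<and> 0 < var_of M (\<lambda>\<omega>. kernel_projection M \<xi> d f c (\<lambda>k. \<xi> k \<omega>))"
  have var_cong: "var_of M (\<lambda>\<omega>. kernel_projection M \<xi> d f c (\<lambda>k. \<xi> k \<omega>)) = var_of M (\<lambda>\<omega>. law.partial_mean d {1..c} f (sample d \<omega>))" for c
    unfolding var_of_def by (simp add: kp cong: Bochner_Integration.integral_cong)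
  have "var_of M (\<lambda>\<omega>. law.partial_mean d {1..d} f (sample d \<omega>)) = var_of M (kernel_var \<xi> d f)"
    unfolding var_of_def using measurable_space[OF measurable_sample]
    by (simp add: top kernel_var_eq cong: Bochner_Integration.integral_cong)
  then have "?R d" using var d by (simp add: var_cong)
  have cd: "?c \<le> d" using card_mono[OF _ A(1)] by simp
  have "\<not> ?R ?c" using A(2) unfolding hoeffding_rank_def by (rule not_less_Least)
  have L: "Lp_le (law.P d) 2 a ?g" by (rule law.Lp_le_partial_mean[OF f]) simp
  have gmean: "(\<integral>x. ?g x \<partial>law.P d) = 0" using law.integral_partial_mean(2)[OF fint] fmean by simp
  have "AE x in law.P d. ?g x = 0"
  proof (cases "?c = 0")
    case True
    have "law.merged d {} (x, y) = y" if "y \<in> space (law.P d)" for x y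
      using that by (auto simp: law.merged_def fun_eq_iff space_PiM PiE_iff extensional_def)
    then have "?g x = (\<integral>y. f y \<partial>law.P d)" for x
      using True by (auto simp: law.partial_mean_def intro!: Bochner_Integration.integral_cong)
    then show ?thesis by (simp add: fmean)
  next
    case False
    then have v: "\<not> 0 < var_of M (\<lambda>\<omega>. ?g (sample d \<omega>))"
      using \<open>\<not> ?R ?c\<close> cd by (auto simp: var_cong)
    have gm: "?g \<in> borel_measurable (law.P d)" by (rule Lp_leD[OF L])
    have "var_of M (\<lambda>\<omega>. ?g (sample d \<omega>)) = (\<integral>x. (?g x)\<^sup>2 \<partial>law.P d)"
    proof -
      have "(\<integral>\<omega>. ?g (sample d \<omega>) \<partial>M) = 0"
        using integral_distr[OF measurable_sample gm] distr_sample[OF d] gmean by simp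
      then show ?thesis
        using integral_distr[OF measurable_sample, of "\<lambda>x. (?g x)\<^sup>2" d] gm distr_sample[OF d]
        by (simp add: var_of_def)
    qed
    moreover have "0 \<le> (\<integral>x. (?g x)\<^sup>2 \<partial>law.P d)" by simp
    ultimately have "(\<integral>x. (?g x)\<^sup>2 \<partial>law.P d) = 0" using v by linarith
    moreover have "integrable (law.P d) (\<lambda>x. (?g x)\<^sup>2)"
      using Lp_le_integral(1)[OF L] by simp
    ultimately have "AE x in law.P d. (?g x)\<^sup>2 = 0"
      by (subst (asm) integral_nonneg_eq_0_iff_AE) auto
    then show ?thesis by simp
  qed
  moreover have "f (x \<circ> \<pi>) = f x" if "\<pi> permutes {1..d}" "x \<in> space (law.P d)" for \<pi> x
  proof -
    have "x \<in> space (PiM {1..d} (\<lambda>_. S))" using that(2) by (simp add: space_PiM)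
    then show ?thesis using ker that(1) by (auto simp: measurable_symmetric_kernel_def)
  qed
  ultimately show ?thesis by (intro law.AE_partial_mean_permute[OF _ fint A(1)]) auto
qed

end

text \<open>Tightness: the level \<open>l\<close>, the bound \<open>L\<close>, the net level
  \<open>k\<close> and the range \<open>J\<close> are chosen from the common parameters, so one
  finite set of cells carries mass at least \<open>1 - \<eta>\<close> under all the laws.\<close>

lemma (in compact_semimetric) weakly_compact_laws:
  fixes X :: "nat \<Rightarrow> 'a \<Rightarrow> 't \<Rightarrow> real"
  assumes chain: "\<And>n. n \<in> N \<Longrightarrow> entropy_chaining w M I \<tau> B \<sigma> c E (X n)"
    and sep: "\<And>n. n \<in> N \<Longrightarrow> separable_field M w (X n)"
  shows "weakly_compact_family (C_space w) {law_on_C M w (X n) | n. n \<in> N}"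
proof -
  have law: "prob_space (law_on_C M w (X n)) \<and> sets (law_on_C M w (X n)) = sets (borel_on (C_space w))"
    if n: "n \<in> N" for n
  proof -
    interpret E: entropy_chaining w M I \<tau> B \<sigma> c E "X n" by (rule chain[OF n])
    interpret C: prob_space "completion M" by (rule E.prob_space_completion)
    show ?thesis
      unfolding law_on_C_def
      using measurable_path_map[OF E.measurable_X E.AE_continuous[OF sep[OF n]]]
      by (auto intro: C.prob_space_distr)
  qed
  show ?thesis
    unfolding weakly_compact_family_def
  proof (intro conjI allI impI)
    show "\<forall>\<mu>\<in>{law_on_C M w (X n) |n. n \<in> N}. prob_space \<mu> \<and> sets \<mu> = sets (borel_on (C_space w))"
      using law by auto
    fix \<mu> :: "nat \<Rightarrow> ('t \<Rightarrow> real) measure"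
    assume "range \<mu> \<subseteq> {law_on_C M w (X n) |n. n \<in> N}"
    then have "\<forall>j. \<exists>n. n \<in> N \<and> \<mu> j = law_on_C M w (X n)" by blast
    then obtain \<iota> where \<iota>: "\<And>j. \<iota> j \<in> N" "\<And>j. \<mu> j = law_on_C M w (X (\<iota> j))" by metis
    interpret E: entropy_chaining w M I \<tau> B \<sigma> c E "X (\<iota> 0)" by (rule chain[OF \<iota>(1)])
    interpret CF: Metric_space "mspace CF" "mdist CF" by (rule Metric_space_CF)
    define A where "A i = cell (from_nat_into cell_indices i)" for i
    show "\<exists>\<nu> k. prob_space \<nu> \<and> sets \<nu> = sets (borel_on (C_space w)) \<and> strict_mono (k :: nat \<Rightarrow> nat) \<and>
        weakly_convergent_to (C_space w) (\<mu> \<circ> k) \<nu>"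
      unfolding C_space_eq
    proof (rule CF.weakly_convergent_subsequence[OF mcomplete_CF])
      show "prob_space (\<mu> j)" "sets (\<mu> j) = sets (borel_on CF.mtopology)" for j
        using law[OF \<iota>(1)] \<iota>(2) by (auto simp: C_space_eq)
      show "A i \<in> sets (borel_on CF.mtopology)" for i
        unfolding A_def C_space_eq[symmetric] by (rule cell_measurable)
      have enum: "\<exists>i. A i = cell z" if "z \<in> cell_indices" for z
        using from_nat_into_surj[OF countable_cell_indices that] by (auto simp: A_def)
      show "\<exists>i. f \<in> A i \<and> (\<forall>y\<in>A i. \<forall>z\<in>A i. mdist CF y z \<le> e)" if f: "f \<in> mspace CF" and e: "0 < e" for f e
      proof -
        obtain m where m: "3 / real (Suc m) < e"
          using reals_Archimedean[of "e / 3"] e by (auto simp: field_simps)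
        obtain k z where kz: "(m, k, z) \<in> cell_indices" "f \<in> cell (m, k, z)"
          using cell_cover[of f m] f unfolding mspace_CF by auto
        obtain i where i: "A i = cell (m, k, z)" using enum[OF kz(1)] by blast
        have "mdist CF x y \<le> e" if "x \<in> A i" "y \<in> A i" for x y
          using cell_diameter[of x m k z y] that m unfolding i by linarith
        then show ?thesis using kz(2) i by blast
      qed
      show "\<exists>F. finite F \<and> (\<forall>i\<in>F. \<forall>y\<in>A i. \<forall>z\<in>A i. mdist CF y z \<le> e) \<and>
          (\<forall>j. 1 - \<eta> \<le> measure (\<mu> j) (\<Union>i\<in>F. A i))" if e: "0 < e" and \<eta>: "0 < \<eta>" for e \<eta>
      proof -
        obtain p where p: "p \<in> I" using E.I(1) by blast
        define K where "K = B * (\<tau> p / c)"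
        obtain m where m: "3 / real (Suc m) < e"
          using reals_Archimedean[of "e / 3"] e by (auto simp: field_simps)
        \<comment> \<open>The 4 compensates the factor in the oscillation bound of
          \<open>separable_bounds\<close>.\<close>
        define y where "y = 1 / (4 * real (Suc m))"
        have y: "y > 0" "4 * y \<le> 1 / real (Suc m)" by (simp_all add: y_def del: of_nat_Suc)
        have "(\<lambda>l. K * E.rest l / y) \<longlonglongrightarrow> K * 0 / y"
          using y by (intro tendsto_intros E.rest_tendsto_0) auto
        then have "eventually (\<lambda>l. K * E.rest l / y < \<eta> / 2) sequentially"
          using \<eta> by (intro order_tendstoD(2)) auto
        then obtain l where l: "K * E.rest l / y < \<eta> / 2" by (auto simp: eventually_sequentially)
        define V where "V = K * (\<sigma> * E 0 + E.rest 0)"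
        \<comment> \<open>The summand 1 keeps \<open>L\<close> positive when \<open>V\<close>
          vanishes.\<close>
        define L where "L = 2 * \<bar>V\<bar> / \<eta> + 1"
        have L: "L > 0" using \<eta> by (simp add: L_def add_nonneg_pos)
        have "\<bar>V\<bar> \<le> \<eta> / 2 * L" using \<eta> by (simp add: L_def field_simps)
        then have VL: "V / L \<le> \<eta> / 2" using L by (simp add: divide_le_eq)
        obtain k where "(1 / 2) ^ k < modulus l / 2"
          using real_arch_pow_inv[of "modulus l / 2" "1 / 2"] modulus_pos[of l] by auto
        then have k: "2 * (1 / 2) ^ k \<le> modulus l" by simp
        obtain J :: int where J: "L * real (Suc m) + 1 \<le> real_of_int J"
          using ex_le_of_int by blast
        define F where "F = to_nat_on cell_indices ` cells m k J"
        have AF: "A (to_nat_on cell_indices z) = cell z" if "z \<in> cells m k J" for z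
        proof -
          have "z \<in> cell_indices" using that cells_subset by blast
          then show ?thesis unfolding A_def by (simp only: from_nat_into_to_nat_on[OF countable_cell_indices])
        qed
        have un: "(\<Union>i\<in>F. A i) = (\<Union>z\<in>cells m k J. cell z)"
          using AF by (auto simp: F_def)
        have "1 - \<eta> \<le> measure (\<mu> j) (\<Union>i\<in>F. A i)" for j
        proof -
          interpret Ej: entropy_chaining w M I \<tau> B \<sigma> c E "X (\<iota> j)" by (rule chain[OF \<iota>(1)])
          have "1 - K * E.rest l / y - V / L \<le> measure (\<mu> j) (\<Union>z\<in>cells m k J. cell z)"
            using Ej.law_cells_ge[OF sep[OF \<iota>(1)] p y(2,1) L k J] by (simp add: \<iota>(2) K_def V_def)
          then show ?thesis using l VL unfolding un by linarith
        qed
        moreover have "mdist CF x x' \<le> e" if "i \<in> F" "x \<in> A i" "x' \<in> A i" for i x x'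
        proof -
          obtain z where z: "z \<in> cells m k J" "i = to_nat_on cell_indices z" using \<open>i \<in> F\<close> by (auto simp: F_def)
          then obtain z' where "z = (m, k, z')" by (auto simp: cells_def)
          with that z AF[OF z(1)] have "mdist CF x x' \<le> 3 / real (Suc m)"
            by (auto intro: cell_diameter simp del: of_nat_Suc)
          with m show ?thesis by linarith
        qed
        moreover have "finite F" unfolding F_def by (intro finite_imageI finite_cells)
        ultimately show ?thesis by blast
      qed
    qed
  qed
qed

section \<open>Grand Lebesgue norms as families of moment bounds\<close>

lemma exp_ereal_mono: "x \<le> y \<Longrightarrow> exp_ereal x \<le> exp_ereal y"
  by (cases x; cases y) (auto simp: exp_ereal_def)

lemma exp_ereal_nonneg: "0 \<le> exp_ereal x"
  by (cases x) (auto simp: exp_ereal_def)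

text \<open>Putting \<open>sqrt p\<close> into \<open>ln x \<le> x / exp 1\<close> and using
  \<open>2 \<le> exp 1\<close> gives \<open>ln p \<le> sqrt p\<close>.\<close>

lemma sqrt_le_div_ln:
  fixes p :: real
  assumes "p \<ge> 2"
  shows "sqrt p \<le> p / ln p" "1 \<le> p / ln p"
proof -
  have ln0: "ln p > 0" using assms by simp
  have "ln (sqrt p) \<le> sqrt p / exp 1"
  proof -
    have "ln (sqrt p / exp 1) \<le> sqrt p / exp 1 - 1" using assms by (intro ln_le_minus_one) auto
    then show ?thesis using assms by (simp add: ln_div)
  qed
  then have "ln p \<le> 2 * (sqrt p / exp 1)" using assms by (simp add: ln_sqrt mult.commute)
  also have "\<dots> \<le> sqrt p"
    using assms exp_ge_add_one_self[of 1] by (simp add: divide_le_eq)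
  finally have "ln p \<le> sqrt p" .
  then have "sqrt p * ln p \<le> sqrt p * sqrt p" using assms by (intro mult_left_mono) auto
  then show "sqrt p \<le> p / ln p" using ln0 assms by (simp add: le_divide_eq)
  moreover have "1 \<le> sqrt p" using assms by simp
  ultimately show "1 \<le> p / ln p" by linarith
qed

locale grand_lebesgue =
  fixes d :: nat and b :: ereal and \<psi> :: "real \<Rightarrow> ennreal"
  assumes d: "d \<ge> 1" and b: "2 < b" and \<psi>: "\<psi> \<in> Psi b"
begin

definition exponents :: "real set" where
  "exponents = {p. 2 < p \<and> ereal p < b}"

definition tau_real :: "real \<Rightarrow> real" where
  "tau_real p = enn2real (tau d b \<psi> p)"

definition psi_real :: "real \<Rightarrow> real" where
  "psi_real p = enn2real (\<psi> p)"

lemma exponents_nonempty: "exponents \<noteq> {}"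
proof -
  obtain p where "ereal 2 < ereal p" "ereal p < b"
    using ereal_dense2[of 2 b] b by auto
  then show ?thesis by (auto simp: exponents_def)
qed

lemma exponents_dom2: "p \<in> exponents \<Longrightarrow> p \<in> dom2 b"
  by (auto simp: exponents_def dom2_def)

lemma psi_lower_bound:
  obtains c where "c > 0" "\<And>p. p \<in> dom2 b \<Longrightarrow> c \<le> psi_real p" "\<And>p. p \<in> dom2 b \<Longrightarrow> \<psi> p = ennreal (psi_real p)"
proof -
  obtain c where c: "c > 0" "\<And>p. 2 \<le> p \<Longrightarrow> c \<le> \<psi> p" using \<psi> by (auto simp: Psi_def)
  have fin: "\<psi> p < \<infinity>" if "p \<in> dom2 b" for p using \<psi> that by (auto simp: Psi_def)
  have "2 \<in> dom2 b" using b by (simp add: dom2_def)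
  then have "c < \<infinity>" using c(2)[of 2] fin[of 2] by (simp add: le_less_trans)
  show ?thesis
  proof (rule that[of "enn2real c"])
    show "enn2real c > 0" using c(1) \<open>c < \<infinity>\<close> by (simp add: enn2real_positive_iff)
    show "enn2real c \<le> psi_real p" if "p \<in> dom2 b" for p
      unfolding psi_real_def using c(2)[of p] fin[OF that] that by (intro enn2real_mono) (auto simp: dom2_def)
    show "\<psi> p = ennreal (psi_real p)" if "p \<in> dom2 b" for p
      unfolding psi_real_def using fin[OF that] by (simp add: less_top)
  qed
qed

text \<open>Chosen from \<open>b\<close> and \<psi> alone, so that the constants containing it are
  fixed before the probability space and the kernel.\<close>

definition lower :: real where
  "lower = (SOME c. c > 0 \<and> (\<forall>p\<in>dom2 b. c \<le> psi_real p))"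

lemma lower: "lower > 0" "p \<in> dom2 b \<Longrightarrow> lower \<le> psi_real p"
proof -
  have "\<exists>c. c > 0 \<and> (\<forall>p\<in>dom2 b. c \<le> psi_real p)" using psi_lower_bound by metis
  from someI_ex[OF this] show "lower > 0" "p \<in> dom2 b \<Longrightarrow> lower \<le> psi_real p"
    unfolding lower_def by auto
qed

lemma psi_eq: "p \<in> dom2 b \<Longrightarrow> \<psi> p = ennreal (psi_real p)"
  using psi_lower_bound by metis

lemma psi_pos: "p \<in> dom2 b \<Longrightarrow> 0 < psi_real p"
  using lower by (meson less_le_trans)

lemma tau_real_eq: "p \<in> dom2 b \<Longrightarrow> tau_real p = (p / ln p) ^ d * psi_real p"
  by (auto simp: tau_real_def tau_def psi_real_def dom2_def enn2real_mult)

lemma tau_eq: "p \<in> dom2 b \<Longrightarrow> tau d b \<psi> p = ennreal (tau_real p)"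
  using psi_eq[of p] psi_pos[of p] by (auto simp: tau_real_eq tau_def dom2_def ennreal_mult less_imp_le)

lemma tau_lower: "p \<in> dom2 b \<Longrightarrow> lower \<le> tau_real p"
proof -
  assume p: "p \<in> dom2 b"
  have "1 \<le> (p / ln p) ^ d" using sqrt_le_div_ln(2)[of p] p by (intro one_le_power) (auto simp: dom2_def)
  then have "1 * psi_real p \<le> (p / ln p) ^ d * psi_real p" using psi_pos[OF p] by (intro mult_right_mono) auto
  then show ?thesis using lower(2)[OF p] by (simp add: tau_real_eq p)
qed

lemma sqrt_power_psi_le: "p \<in> dom2 b \<Longrightarrow> sqrt p ^ d * psi_real p \<le> tau_real p"
  using sqrt_le_div_ln(1)[of p] psi_pos[of p]
  by (auto simp: tau_real_eq dom2_def intro!: mult_right_mono power_mono)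

lemma gls_norm_leI:
  assumes "\<And>p. p \<in> exponents \<Longrightarrow> Lp_le M p (a * g p) f" "\<And>p. p \<in> exponents \<Longrightarrow> \<tau> p = ennreal (g p)"
    "\<And>p. p \<in> exponents \<Longrightarrow> 0 < g p" "0 \<le> a"
  shows "gls_norm M b \<tau> f \<le> ennreal a"
  unfolding gls_norm_def exponents_def[symmetric]
proof (rule SUP_least)
  fix p assume p: "p \<in> exponents"
  then have "p > 0" by (simp add: exponents_def)
  then have "Lp_norm M p f \<le> ennreal (a * g p)"
    using assms(1)[OF p] assms(3)[OF p] assms(4) by (subst Lp_norm_le_iff) (auto dest: Lp_leD)
  then show "Lp_norm M p f / \<tau> p \<le> ennreal a"
    using assms(2,3)[OF p] assms(4)
    by (intro divide_le_posI_ennreal) (auto simp: ennreal_mult mult.commute)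
qed

lemma gls_norm_leD:
  assumes "gls_norm M b \<tau> f \<le> ennreal a" "p \<in> exponents" "\<tau> p = ennreal g" "0 < g" "0 \<le> a" "f \<in> borel_measurable M"
  shows "Lp_le M p (a * g) f"
proof -
  have p: "p > 0" using assms(2) by (simp add: exponents_def)
  have le: "Lp_norm M p f / ennreal g \<le> ennreal a"
    using assms(1-3) unfolding gls_norm_def exponents_def[symmetric] by (auto simp: SUP_le_iff)
  have "Lp_norm M p f = (Lp_norm M p f / ennreal g) * ennreal g"
    using assms(4) by (simp add: ennreal_divide_times)
  also have "\<dots> \<le> ennreal a * ennreal g" by (intro mult_right_mono le) simp
  also have "\<dots> = ennreal (a * g)" using assms(4,5) by (simp add: ennreal_mult)
  finally show ?thesis using assms p by (simp add: Lp_norm_le_iff)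
qed

end

section \<open>The normed deviations as a random field\<close>

locale U_statistic_field = grand_lebesgue d b \<psi> + iid_sample M S \<xi>
  for d :: nat and b :: ereal and \<psi> :: "real \<Rightarrow> ennreal"
    and M :: "'a measure" and S :: "'x measure" and \<xi> :: "nat \<Rightarrow> 'a \<Rightarrow> 'x" +
  fixes \<Phi> :: "(nat \<Rightarrow> 'x) \<Rightarrow> 't \<Rightarrow> real" and r :: nat
  assumes kernel: "measurable_symmetric_kernel d S (\<lambda>x. \<Phi> x t)"
    and nontrivial: "0 < var_of M (kernel_var \<xi> d (\<lambda>x. \<Phi> x t))"
    and rank: "hoeffding_rank M \<xi> d (\<lambda>x. \<Phi> x t) = r"
    and centered: "(\<integral>\<omega>. kernel_var \<xi> d (\<lambda>x. \<Phi> x t) \<omega> \<partial>M) = 0"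
    and sup_finite: "(SUP t. gls_norm M b \<psi> (kernel_var \<xi> d (\<lambda>x. \<Phi> x t))) < \<infinity>"
begin

definition sup_norm :: real where
  "sup_norm = enn2real (SUP t. gls_norm M b \<psi> (kernel_var \<xi> d (\<lambda>x. \<Phi> x t)))"

abbreviation w :: "'t \<Rightarrow> 't \<Rightarrow> real" where
  "w \<equiv> kernel_dist M \<xi> d b \<psi> \<Phi>"

lemma sup_norm_nonneg: "0 \<le> sup_norm"
  by (simp add: sup_norm_def)

lemma measurable_kernel [measurable]: "(\<lambda>x. \<Phi> x t) \<in> borel_measurable (law.P d)"
  using kernel[of t] unfolding measurable_symmetric_kernel_def measurable_cong_sets[OF sets_P refl, of d borel]
  by blast

lemma measurable_kernel_var [measurable]: "kernel_var \<xi> d (\<lambda>x. \<Phi> x t) \<in> borel_measurable M"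
  unfolding kernel_var_eq[abs_def] by (rule measurable_compose[OF measurable_sample measurable_kernel])

lemma Lp_le_kernel:
  assumes p: "p \<in> exponents"
  shows "Lp_le M p (sup_norm * psi_real p) (kernel_var \<xi> d (\<lambda>x. \<Phi> x t))"
proof (rule gls_norm_leD[OF _ p])
  have "gls_norm M b \<psi> (kernel_var \<xi> d (\<lambda>x. \<Phi> x t)) \<le> (SUP t. gls_norm M b \<psi> (kernel_var \<xi> d (\<lambda>x. \<Phi> x t)))"
    by (rule SUP_upper) simp
  also have "\<dots> = ennreal sup_norm"
    using sup_finite by (simp add: sup_norm_def)
  finally show "gls_norm M b \<psi> (kernel_var \<xi> d (\<lambda>x. \<Phi> x t)) \<le> ennreal sup_norm" .
qed (use p psi_eq psi_pos exponents_dom2 sup_norm_nonneg in auto)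

text \<open>The norm of a difference is at most \<open>2 * sup_norm\<close>, hence finite, and the
  conversion to a real in \<open>kernel_dist\<close> loses nothing.\<close>

lemma kernel_dist_eq:
  "gls_norm M b \<psi> (\<lambda>\<omega>. kernel_var \<xi> d (\<lambda>x. \<Phi> x t) \<omega> - kernel_var \<xi> d (\<lambda>x. \<Phi> x s) \<omega>) = ennreal (w t s)"
proof -
  have "gls_norm M b \<psi> (\<lambda>\<omega>. kernel_var \<xi> d (\<lambda>x. \<Phi> x t) \<omega> - kernel_var \<xi> d (\<lambda>x. \<Phi> x s) \<omega>) \<le> ennreal (2 * sup_norm)"
  proof (rule gls_norm_leI)
    fix p assume p: "p \<in> exponents"
    then have "p \<ge> 1" by (simp add: exponents_def)
    from Lp_le_diff[OF Lp_le_kernel[OF p] Lp_le_kernel[OF p] this]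
    show "Lp_le M p (2 * sup_norm * psi_real p) (\<lambda>\<omega>. kernel_var \<xi> d (\<lambda>x. \<Phi> x t) \<omega> - kernel_var \<xi> d (\<lambda>x. \<Phi> x s) \<omega>)"
      by (simp add: algebra_simps)
  qed (use psi_eq psi_pos exponents_dom2 sup_norm_nonneg in auto)
  then have "gls_norm M b \<psi> (\<lambda>\<omega>. kernel_var \<xi> d (\<lambda>x. \<Phi> x t) \<omega> - kernel_var \<xi> d (\<lambda>x. \<Phi> x s) \<omega>) < top"
    by (rule le_less_trans) simp
  then show ?thesis by (simp add: kernel_dist_def)
qed

lemma w_nonneg: "0 \<le> w t s"
  by (simp add: kernel_dist_def)

lemma Lp_le_kernel_diff:
  assumes p: "p \<in> exponents"
  shows "Lp_le M p (w t s * psi_real p) (\<lambda>\<omega>. kernel_var \<xi> d (\<lambda>x. \<Phi> x t) \<omega> - kernel_var \<xi> d (\<lambda>x. \<Phi> x s) \<omega>)"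
  by (rule gls_norm_leD[where \<tau> = \<psi> and g = "psi_real p", OF _ p])
    (auto simp: kernel_dist_eq w_nonneg psi_eq[symmetric] psi_pos exponents_dom2 p)

lemma compact_semimetric_w:
  assumes "compact_space (semi_topology w)"
  shows "compact_semimetric w"
proof
  show "w t t = 0" for t
  proof -
    have "gls_norm M b \<psi> (\<lambda>\<omega>. kernel_var \<xi> d (\<lambda>x. \<Phi> x t) \<omega> - kernel_var \<xi> d (\<lambda>x. \<Phi> x t) \<omega>) \<le> ennreal 0"
      by (rule gls_norm_leI[OF _ psi_eq]) (auto simp: Lp_le_zero psi_pos exponents_dom2)
    then show ?thesis by (simp add: kernel_dist_def)
  qed
  show "w t s = w s t" for t s
  proof -
    let ?D = "\<lambda>t s \<omega>. kernel_var \<xi> d (\<lambda>x. \<Phi> x t) \<omega> - kernel_var \<xi> d (\<lambda>x. \<Phi> x s) \<omega>"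
    have "Lp_norm M p (?D t s) = Lp_norm M p (?D s t)" for p
    proof -
      have "?D t s = (\<lambda>\<omega>. - ?D s t \<omega>)" by simp
      then show ?thesis by (simp only: Lp_norm_def abs_minus_cancel)
    qed
    then show ?thesis by (simp only: kernel_dist_def gls_norm_def)
  qed
  show "w t u \<le> w t s + w s u" for t u s
  proof -
    have "ennreal (w t u) \<le> ennreal (w t s + w s u)"
      unfolding kernel_dist_eq[symmetric]
    proof (rule gls_norm_leI)
      fix p assume p: "p \<in> exponents"
      then have "p \<ge> 1" by (simp add: exponents_def)
      from Lp_le_add[OF Lp_le_kernel_diff[OF p, of t s] Lp_le_kernel_diff[OF p, of s u] this]
      show "Lp_le M p ((w t s + w s u) * psi_real p) (\<lambda>\<omega>. kernel_var \<xi> d (\<lambda>x. \<Phi> x t) \<omega> - kernel_var \<xi> d (\<lambda>x. \<Phi> x u) \<omega>)"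
        by (simp add: distrib_right)
    qed (use psi_eq psi_pos exponents_dom2 w_nonneg in auto)
    then show ?thesis using w_nonneg[of t s] w_nonneg[of s u] by (subst (asm) ennreal_le_iff) auto
  qed
qed (use assms w_nonneg in auto)

lemma Lp_le_kernel_law:
  assumes "p \<in> exponents"
  shows "Lp_le (law.P d) p (sup_norm * psi_real p) (\<lambda>x. \<Phi> x t)"
  using Lp_le_kernel[OF assms] Lp_le_kernel_var[OF d measurable_kernel] by simp

lemma integrable_kernel: "integrable (law.P d) (\<lambda>x. \<Phi> x t)"
proof -
  interpret Pd: prob_space "law.P d" by (rule law.prob_space_P)
  obtain p where p: "p \<in> exponents" using exponents_nonempty by blast
  then have "p \<ge> 1" by (simp add: exponents_def)
  from Pd.Lp_le_integrable(1)[OF Lp_le_kernel_law[OF p] this] show ?thesis .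
qed

lemma AE_partial_mean_kernel:
  assumes "A \<subseteq> {1..d}" "card A < r"
  shows "AE x in law.P d. law.partial_mean d A (\<lambda>x. \<Phi> x t) x = 0"
proof -
  interpret Pd: prob_space "law.P d" by (rule law.prob_space_P)
  obtain p where p: "p \<in> exponents" using exponents_nonempty by blast
  then have "2 \<le> p" by (simp add: exponents_def)
  with Pd.Lp_le_exponent_mono[OF Lp_le_kernel_law[OF p], of 2]
  have "Lp_le (law.P d) 2 (sup_norm * psi_real p) (\<lambda>x. \<Phi> x t)" by simp
  from AE_partial_mean_below_rank[OF d kernel nontrivial centered this assms(1)] show ?thesis
    using assms(2) rank by simp
qed

lemma degenerate_kernel: "law.degenerate d r (\<lambda>x. \<Phi> x t)"
  by (rule law.degenerateI[OF integrable_kernel AE_partial_mean_kernel])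

text \<open>The difference of two kernels may vanish or have a larger rank, so its own rank is not
  consulted. Both kernels have vanishing partial means below \<open>r\<close>, and partial means are
  linear where both are integrable.\<close>

lemma degenerate_kernel_diff: "law.degenerate d r (\<lambda>x. \<Phi> x t - \<Phi> x s)"
proof (rule law.degenerateI)
  show "integrable (law.P d) (\<lambda>x. \<Phi> x t - \<Phi> x s)"
    by (intro Bochner_Integration.integrable_diff integrable_kernel)
  fix A assume A: "A \<subseteq> {1..d}" "card A < r"
  from AE_partial_mean_kernel[OF A, of t] AE_partial_mean_kernel[OF A, of s]
    law.integrable_merged(2)[OF integrable_kernel[of t], of A] law.integrable_merged(2)[OF integrable_kernel[of s], of A]
  show "AE x in law.P d. law.partial_mean d A (\<lambda>x. \<Phi> x t - \<Phi> x s) x = 0"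
    by eventually_elim (simp add: law.partial_mean_def)
qed

abbreviation \<phi> :: "nat \<Rightarrow> 'a \<Rightarrow> 't \<Rightarrow> real" where
  "\<phi> \<equiv> normed_deviation M \<xi> d \<Phi> r"

lemma normed_deviation_eq:
  assumes "n > d"
  shows "\<phi> n \<omega> t = real n powr (real r / 2) * U_stat \<xi> d (\<lambda>x. \<Phi> x t) n \<omega>"
proof -
  have "(\<integral>y. \<Phi> y t \<partial>law.P d) = 0" using centered[of t] integral_kernel_var[OF d measurable_kernel] by simp
  from integral_U_stat[OF d assms integrable_kernel this] show ?thesis by (simp add: normed_deviation_def)
qed

text \<open>The growth \<open>sqrt p ^ d\<close> of the moment constant is absorbed by the factor in
  \<tau>.\<close>

lemma moment_factor_le:
  assumes p: "p \<in> exponents" and a: "0 \<le> a"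
  shows "(7 * real d * sqrt p) ^ d * (a * psi_real p) \<le> (7 * real d) ^ d * tau_real p * a"
proof -
  have "(7 * real d) ^ d * a * (sqrt p ^ d * psi_real p) \<le> (7 * real d) ^ d * a * tau_real p"
    using a by (intro mult_left_mono sqrt_power_psi_le exponents_dom2 p) auto
  then show ?thesis by (simp add: power_mult_distrib mult_ac)
qed

lemma Lp_le_normed_deviation:
  assumes n: "n > d" and p: "p \<in> exponents"
  shows "Lp_le M p ((7 * real d) ^ d * tau_real p * sup_norm) (\<lambda>\<omega>. \<phi> n \<omega> t)"
    "Lp_le M p ((7 * real d) ^ d * tau_real p * w t s) (\<lambda>\<omega>. \<phi> n \<omega> t - \<phi> n \<omega> s)"
proof -
  have p2: "p \<ge> 2" using p by (simp add: exponents_def)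
  have "Lp_le M p ((7 * real d * sqrt p) ^ d * (sup_norm * psi_real p)) (\<lambda>\<omega>. \<phi> n \<omega> t)"
    using Lp_le_normed_U_stat[OF d n Lp_le_kernel_law[OF p] p2 degenerate_kernel] by (simp add: normed_deviation_eq[OF n])
  then show "Lp_le M p ((7 * real d) ^ d * tau_real p * sup_norm) (\<lambda>\<omega>. \<phi> n \<omega> t)"
    by (rule Lp_le_mono) (use moment_factor_le[OF p sup_norm_nonneg] p2 in auto)
  have m: "(\<lambda>x. \<Phi> x t - \<Phi> x s) \<in> borel_measurable (law.P d)" by measurable
  have "kernel_var \<xi> d (\<lambda>x. \<Phi> x t - \<Phi> x s) = (\<lambda>\<omega>. kernel_var \<xi> d (\<lambda>x. \<Phi> x t) \<omega> - kernel_var \<xi> d (\<lambda>x. \<Phi> x s) \<omega>)"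
    by (simp add: kernel_var_def fun_eq_iff)
  then have "Lp_le (law.P d) p (w t s * psi_real p) (\<lambda>x. \<Phi> x t - \<Phi> x s)"
    using Lp_le_kernel_var[OF d m, of p] Lp_le_kernel_diff[OF p] by simp
  from Lp_le_normed_U_stat[OF d n this p2 degenerate_kernel_diff]
  have "Lp_le M p ((7 * real d * sqrt p) ^ d * (w t s * psi_real p)) (\<lambda>\<omega>. \<phi> n \<omega> t - \<phi> n \<omega> s)"
    by (simp add: normed_deviation_eq[OF n] U_stat_def sum_subtractf diff_divide_distrib right_diff_distrib)
  then show "Lp_le M p ((7 * real d) ^ d * tau_real p * w t s) (\<lambda>\<omega>. \<phi> n \<omega> t - \<phi> n \<omega> s)"
    by (rule Lp_le_mono) (use moment_factor_le[OF p w_nonneg] p2 in auto)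
qed

end

section \<open>Entropy integral and tail estimate\<close>

context grand_lebesgue
begin

definition v_real :: "real \<Rightarrow> real" where
  "v_real x = (INF p\<in>exponents. x / p + ln (tau_real p))"

lemma v_fun_eq: "v_fun b (tau d b \<psi>) = v_real"
  by (simp add: v_fun_def v_real_def exponents_def tau_real_def fun_eq_iff)

lemma tau_pos: "p \<in> exponents \<Longrightarrow> 0 < tau_real p"
  using tau_lower[OF exponents_dom2, of p] lower(1) by linarith

lemma v_real_bdd:
  assumes "x \<ge> 0"
  shows "bdd_below ((\<lambda>p. x / p + ln (tau_real p)) ` exponents)"
proof (rule bdd_belowI2)
  fix p assume p: "p \<in> exponents"
  have "ln lower \<le> ln (tau_real p)" using tau_lower[OF exponents_dom2[OF p]] lower(1) tau_pos[OF p] by simp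
  moreover have "0 \<le> x / p" using assms p by (simp add: exponents_def)
  ultimately show "ln lower \<le> x / p + ln (tau_real p)" by linarith
qed

lemma v_real_mono:
  assumes "0 \<le> x" "x \<le> y"
  shows "v_real x \<le> v_real y"
  unfolding v_real_def
proof (rule cINF_mono[OF exponents_nonempty v_real_bdd[OF assms(1)]])
  fix p assume p: "p \<in> exponents"
  then have "x / p \<le> y / p" using assms by (intro divide_right_mono) (auto simp: exponents_def)
  with p show "\<exists>q\<in>exponents. x / q + ln (tau_real q) \<le> y / p + ln (tau_real p)" by (intro bexI[of _ p]) auto
qed

text \<open>The left-hand side is \<open>exp\<close> of the expression whose infimum over exponents
  is \<open>v_real (ln N)\<close>.\<close>

lemma v_real_approx:
  assumes N: "N \<ge> 1" and e: "e > 0"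
  shows "\<exists>p\<in>exponents. N powr (1 / p) * tau_real p \<le> exp (v_real (ln N)) + e"
proof -
  let ?v = "v_real (ln N)"
  have "?v < ln (exp ?v + e)"
    using e by (metis exp_gt_zero less_add_same_cancel1 ln_exp ln_less_cancel_iff add_pos_pos)
  then obtain p where p: "p \<in> exponents" "ln N / p + ln (tau_real p) < ln (exp ?v + e)"
    unfolding v_real_def using cINF_less_iff[OF exponents_nonempty v_real_bdd, of "ln N"] N by auto
  have "N powr (1 / p) * tau_real p = exp (ln N / p + ln (tau_real p))"
    using N tau_pos[OF p(1)] by (simp add: powr_def exp_add)
  also have "\<dots> \<le> exp (ln (exp ?v + e))" using p(2) by simp
  also have "\<dots> = exp ?v + e" using e by (simp add: add_pos_pos)
  finally show ?thesis using p(1) by blast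
qed

text \<open>The supremum defining the Young-Fenchel transform includes \<open>p = 2\<close>, where the moment
  bound is obtained by letting the exponent decrease to 2.\<close>

lemma tail_bound_at_2:
  assumes y: "y > 0" and C: "C > 0"
    and le: "\<And>p. p \<in> exponents \<Longrightarrow> T \<le> (C * tau_real p / y) powr p"
    and p: "p \<in> dom2 b"
  shows "T \<le> (C * tau_real p / y) powr p"
proof (cases "p = 2")
  case False
  then show ?thesis using p le by (auto simp: dom2_def exponents_def)
next
  case True
  obtain q0 where q0: "2 < q0" "ereal q0 < b"
    using ereal_dense2[of 2 b] b by auto
  have "continuous_on (dom2 b) \<psi>" using \<psi> by (simp add: Psi_def)
  then have "(\<psi> \<longlongrightarrow> \<psi> 2) (at 2 within dom2 b)" using p True by (simp add: continuous_on_def)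
  then have "(psi_real \<longlongrightarrow> psi_real 2) (at 2 within dom2 b)"
    unfolding psi_real_def[abs_def] using psi_eq[OF p] True by (intro tendsto_enn2real) auto
  \<comment> \<open>An interval to the right of 2 lies in \<open>dom2 b\<close>, so continuity of
    \<psi> can be used along the exponents for which the bound is assumed.\<close>
  moreover have "at_right (2::real) \<le> at 2 within dom2 b"
  proof -
    have "at_right (2::real) = at 2 within {2<..<q0}"
      using q0(1) by (intro at_within_Icc_at_right[symmetric] at_within_nhd[where S = "{..<q0}"]) auto
    also have "\<dots> \<le> at 2 within dom2 b"
      using q0(2) by (intro at_le) (auto simp: dom2_def intro: less_trans[of _ "ereal q0"])
    finally show ?thesis .
  qed
  ultimately have psi2: "(psi_real \<longlongrightarrow> psi_real 2) (at_right 2)" by (rule tendsto_mono[rotated])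
  have "((\<lambda>q. (C * ((q / ln q) ^ d * psi_real q) / y) powr q) \<longlongrightarrow> (C * ((2 / ln 2) ^ d * psi_real 2) / y) powr 2) (at_right 2)"
    using psi_pos[of 2] p True C y by (intro tendsto_intros psi2) (auto intro!: tendsto_eq_intros)
  moreover have "eventually (\<lambda>q. T \<le> (C * ((q / ln q) ^ d * psi_real q) / y) powr q) (at_right 2)"
    unfolding eventually_at_right_field
  proof (intro exI[of _ q0] conjI q0 allI impI)
    fix q :: real assume "2 < q" "q < q0"
    then have q: "q \<in> exponents" using q0(2) by (auto simp: exponents_def intro: less_trans[of _ "ereal q0"])
    from le[OF q] show "T \<le> (C * ((q / ln q) ^ d * psi_real q) / y) powr q"
      by (simp add: tau_real_eq[OF exponents_dom2[OF q]])
  qed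
  ultimately have "T \<le> (C * ((2 / ln 2) ^ d * psi_real 2) / y) powr 2"
    by (intro tendsto_lowerbound) auto
  then show ?thesis using True p by (simp add: tau_real_eq)
qed

text \<open>Taking logarithms, each exponent gives
  \<open>ln T \<le> p * ln (tau_real p) - p * ln (y / C)\<close>, and optimising over
  \<open>p\<close> produces the transform. Outside \<open>dom2 b\<close> the function
  \<open>nu\<close> is infinite and contributes nothing to the supremum; \<open>T \<le> 0\<close>
  has no logarithm and is treated apart.\<close>

lemma le_exp_young_fenchel:
  assumes y: "y > 0" and C: "C > 0"
    and le: "\<And>p. p \<in> exponents \<Longrightarrow> T \<le> (C * tau_real p / y) powr p"
  shows "ereal T \<le> exp_ereal (- young_fenchel (nu b (tau d b \<psi>)) (ln (y / C)))"
proof (cases "T \<le> 0")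
  case True
  then show ?thesis using exp_ereal_nonneg order_trans by (metis ereal_less_eq(3) zero_ereal_def)
next
  case False
  have "young_fenchel (nu b (tau d b \<psi>)) (ln (y / C)) \<le> ereal (- ln T)"
    unfolding young_fenchel_def
  proof (rule SUP_least)
    fix p
    show "ereal (p * ln (y / C)) - nu b (tau d b \<psi>) p \<le> ereal (- ln T)"
    proof (cases "p \<in> dom2 b")
      case True
      have tp: "tau_real p > 0" using tau_lower[OF True] lower(1) by linarith
      have "ln T \<le> ln ((C * tau_real p / y) powr p)"
        using tail_bound_at_2[OF y C le True] False by (intro ln_mono) auto
      also have "\<dots> = p * ln (tau_real p) - p * ln (y / C)"
        using y C tp by (simp add: ln_powr ln_div ln_mult algebra_simps)
      finally show ?thesis using True by (simp add: nu_def tau_real_def)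
    qed (simp add: nu_def)
  qed
  then have "ereal (ln T) \<le> - young_fenchel (nu b (tau d b \<psi>)) (ln (y / C))"
    by (metis ereal_minus_le_minus ereal_uminus_uminus uminus_ereal.simps(1))
  from exp_ereal_mono[OF this] show ?thesis using False by (simp add: exp_ereal_def)
qed

end

lemma (in prob_space) tail_le:
  assumes f: "Lp_le M p a f" and p: "p > 0" and y: "y > 0"
  shows "tail M f y \<le> (a / y) powr p"
proof -
  note [measurable] = Lp_leD(2)[OF f]
  have "prob {\<omega> \<in> space M. f \<omega> > y} \<le> prob {\<omega>\<in>space M. y < \<bar>f \<omega>\<bar>}"
    "prob {\<omega> \<in> space M. f \<omega> < - y} \<le> prob {\<omega>\<in>space M. y < \<bar>f \<omega>\<bar>}"
    by (intro finite_measure_mono; auto)+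
  then show ?thesis using Lp_le_tail[OF f p y] unfolding tail_def by linarith
qed

section \<open>Entropy weights and assembly of the bounds\<close>

context U_statistic_field
begin

context
  assumes compact: "compact_space (semi_topology w)"
    and K: "entropy_integral b (tau d b \<psi>) w < \<infinity>"
begin

interpretation compact_semimetric w
  by (rule compact_semimetric_w[OF compact])

definition level_entropy :: "nat \<Rightarrow> real" where
  "level_entropy k = exp (v_real (Defs.entropy w ((1 / 2) ^ k)))"

definition "K_real = enn2real (entropy_integral b (tau d b \<psi>) w)"

lemma entropy_nonneg: "0 < e \<Longrightarrow> 0 \<le> Defs.entropy w e"
  using covering_number_ge_1[of e] by (simp add: Defs.entropy_def)

lemma entropy_antimono:
  assumes "0 < e" "e \<le> e'"
  shows "v_real (Defs.entropy w e') \<le> v_real (Defs.entropy w e)"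
proof (rule v_real_mono)
  show "0 \<le> Defs.entropy w e'" using assms by (intro entropy_nonneg) auto
  show "Defs.entropy w e' \<le> Defs.entropy w e"
    using covering_number_antimono[OF assms] covering_number_ge_1[of e'] assms by (simp add: Defs.entropy_def)
qed

lemma K_real: "0 \<le> K_real" "ennreal K_real = (\<integral>\<^sup>+\<epsilon>\<in>{0<..1}. ennreal (exp (v_real (Defs.entropy w \<epsilon>))) \<partial>lborel)"
  using K by (simp_all add: K_real_def entropy_integral_def v_fun_eq less_top)

text \<open>The integrand is antitone, so on (0, 1] it is at least its value at 1, the radius of the
  net of level 0.\<close>

lemma level_entropy_0_le: "level_entropy 0 \<le> K_real"
proof -
  have "ennreal (level_entropy 0) = (\<integral>\<^sup>+\<epsilon>. ennreal (level_entropy 0) * indicator {0<..1::real} \<epsilon> \<partial>lborel)"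
    by (subst nn_integral_cmult_indicator) auto
  also have "\<dots> \<le> (\<integral>\<^sup>+\<epsilon>\<in>{0<..1}. ennreal (exp (v_real (Defs.entropy w \<epsilon>))) \<partial>lborel)"
    using entropy_antimono[of _ 1] by (intro nn_integral_mono) (auto simp: level_entropy_def indicator_def)
  finally have "ennreal (level_entropy 0) \<le> ennreal K_real" unfolding K_real(2) .
  then show ?thesis by (subst (asm) ennreal_le_iff[OF K_real(1)])
qed

text \<open>Comparison of the series with the integral over the disjoint intervals
  \<open>{(1 / 2) ^ (k + 2) <.. (1 / 2) ^ (k + 1)}\<close>, on which the integrand is at least its value at the right endpoint.\<close>

lemma level_entropy_sum:
  "summable (\<lambda>k. (1 / 2) ^ k * level_entropy (Suc k))" "(\<Sum>k. (1 / 2) ^ k * level_entropy (Suc k)) \<le> 4 * K_real"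
proof -
  \<comment> \<open>The interval \<open>J k\<close> has length \<open>(1 / 2) ^ (k + 2)\<close>, a
    quarter of the weight in the series; hence the factor 4.\<close>
  define a where "a k = (1 / 2) ^ (k + 2) * level_entropy (Suc k)" for k
  have a0: "a k \<ge> 0" for k by (simp add: a_def level_entropy_def)
  define J where "J k = {(1 / 2) ^ (k + 2) <.. (1 / 2 :: real) ^ (k + 1)}" for k :: nat
  have lenJ: "emeasure lborel (J k) = ennreal ((1 / 2) ^ (k + 2))" for k
  proof -
    have "(1 / 2 :: real) ^ (k + 2) \<le> (1 / 2) ^ (k + 1)" by (rule power_decreasing) auto
    moreover have "(1 / 2 :: real) ^ (k + 1) - (1 / 2) ^ (k + 2) = (1 / 2) ^ (k + 2)" by (simp add: power_add)
    ultimately show ?thesis unfolding J_def by (subst emeasure_lborel_Ioc) simp_all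
  qed
  have disj: "\<epsilon> \<notin> J l" if "\<epsilon> \<in> J k" "k < l" for \<epsilon> k l
  proof -
    have "(1 / 2 :: real) ^ (l + 1) \<le> (1 / 2) ^ (k + 2)" using that(2) by (intro power_decreasing) auto
    then show ?thesis using that(1) by (auto simp: J_def)
  qed
  have point: "(\<Sum>k. ennreal (level_entropy (Suc k)) * indicator (J k) \<epsilon>) \<le> ennreal (exp (v_real (Defs.entropy w \<epsilon>))) * indicator {0<..1} \<epsilon>" for \<epsilon> :: real
  proof (cases "\<exists>k. \<epsilon> \<in> J k")
    case True
    then obtain k where k: "\<epsilon> \<in> J k" by blast
    have other: "\<epsilon> \<notin> J l" if "l \<noteq> k" for l
      using that disj[of \<epsilon> k l] disj[of \<epsilon> l k] k by (cases "k < l") auto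
    have "(\<Sum>l. ennreal (level_entropy (Suc l)) * indicator (J l) \<epsilon>) = (\<Sum>l\<in>{k}. ennreal (level_entropy (Suc l)) * indicator (J l) \<epsilon>)"
      using other by (intro suminf_finite) auto
    also have "\<dots> = ennreal (level_entropy (Suc k))" using k by simp
    also have "\<dots> \<le> ennreal (exp (v_real (Defs.entropy w \<epsilon>))) * indicator {0<..1} \<epsilon>"
    proof -
      have e: "0 < \<epsilon>" "\<epsilon> \<le> (1 / 2) ^ Suc k"
      proof -
        have "0 < (1 / 2 :: real) ^ (k + 2)" by simp
        then show "0 < \<epsilon>" using k unfolding J_def greaterThanAtMost_iff by (rule less_trans[OF _ conjunct1])
        show "\<epsilon> \<le> (1 / 2) ^ Suc k" using k unfolding J_def by (simp only: greaterThanAtMost_iff Suc_eq_plus1)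
      qed
      have "(1 / 2 :: real) ^ Suc k \<le> 1" by (rule power_le_one) auto
      with e have "\<epsilon> \<in> {0<..1}" by auto
      then show ?thesis using entropy_antimono[OF e] by (simp add: level_entropy_def ennreal_leI)
    qed
    finally show ?thesis .
  next
    case False
    then show ?thesis by simp
  qed
  have sum: "(\<Sum>k. ennreal (a k)) \<le> ennreal K_real"
  proof -
    have "(\<Sum>k. ennreal (a k)) = (\<Sum>k. \<integral>\<^sup>+\<epsilon>. ennreal (level_entropy (Suc k)) * indicator (J k) \<epsilon> \<partial>lborel)"
    proof (rule suminf_cong)
      fix k
      have "(\<integral>\<^sup>+\<epsilon>. ennreal (level_entropy (Suc k)) * indicator (J k) \<epsilon> \<partial>lborel) = ennreal (level_entropy (Suc k)) * emeasure lborel (J k)"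
        by (rule nn_integral_cmult_indicator) (simp add: J_def)
      then show "ennreal (a k) = (\<integral>\<^sup>+\<epsilon>. ennreal (level_entropy (Suc k)) * indicator (J k) \<epsilon> \<partial>lborel)"
      proof -
        assume "(\<integral>\<^sup>+\<epsilon>. ennreal (level_entropy (Suc k)) * indicator (J k) \<epsilon> \<partial>lborel) = ennreal (level_entropy (Suc k)) * emeasure lborel (J k)"
        moreover have "ennreal (a k) = ennreal (level_entropy (Suc k)) * ennreal ((1 / 2) ^ (k + 2))"
          unfolding a_def by (subst mult.commute, rule ennreal_mult) (simp_all add: level_entropy_def)
        ultimately show ?thesis by (simp only: lenJ)
      qed
    qed
    also have "\<dots> = (\<integral>\<^sup>+\<epsilon>. (\<Sum>k. ennreal (level_entropy (Suc k)) * indicator (J k) \<epsilon>) \<partial>lborel)"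
      by (rule nn_integral_suminf[symmetric]) (simp add: J_def)
    also have "\<dots> \<le> ennreal K_real" unfolding K_real(2) by (intro nn_integral_mono point)
    finally show ?thesis .
  qed
  then have sa: "summable a" using a0 by (intro summable_suminf_not_top) (auto simp: top_unique)
  have "ennreal (suminf a) \<le> ennreal K_real" using sum by (simp add: suminf_ennreal2[OF a0 sa])
  then have "suminf a \<le> K_real" by (subst (asm) ennreal_le_iff[OF K_real(1)])
  moreover have eq: "(\<lambda>k. (1 / 2) ^ k * level_entropy (Suc k)) = (\<lambda>k. 4 * a k)"
    by (simp add: a_def fun_eq_iff)
  ultimately show "summable (\<lambda>k. (1 / 2) ^ k * level_entropy (Suc k))" "(\<Sum>k. (1 / 2) ^ k * level_entropy (Suc k)) \<le> 4 * K_real"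
    unfolding eq using sa by (simp_all add: suminf_mult)
qed

lemma entropy_chaining_normed_deviation:
  assumes n: "n > d"
  shows "entropy_chaining w M exponents tau_real ((7 * real d) ^ d) sup_norm lower level_entropy (\<phi> n)"
proof
  show "exponents \<noteq> {}" by (rule exponents_nonempty)
  show "1 \<le> p" if "p \<in> exponents" for p using that by (simp add: exponents_def)
  show "0 < lower" by (rule lower)
  show "lower \<le> tau_real p" if "p \<in> exponents" for p using tau_lower[OF exponents_dom2[OF that]] .
  show "\<exists>p\<in>exponents. real (covering_number w ((1 / 2) ^ k)) powr (1 / p) * tau_real p \<le> level_entropy k + e"
    if "0 < e" for k e
    unfolding level_entropy_def Defs.entropy_def using that covering_number_ge_1[of "(1 / 2) ^ k"]
    by (intro v_real_approx) auto
  show "summable (\<lambda>k. (1 / 2) ^ k * level_entropy (Suc k))" by (rule level_entropy_sum)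
  show "Lp_le M p ((7 * real d) ^ d * tau_real p * w t s) (\<lambda>\<omega>. \<phi> n \<omega> t - \<phi> n \<omega> s)"
    "Lp_le M p ((7 * real d) ^ d * tau_real p * sup_norm) (\<lambda>\<omega>. \<phi> n \<omega> t)"
    if "p \<in> exponents" for p t s
    by (rule Lp_le_normed_deviation[OF n that])+
qed (auto simp: sup_norm_nonneg level_entropy_def)

text \<open>\<open>(7 * d) ^ d\<close> is the moment constant, \<open>1 / lower\<close> the price
  for changing the exponent, \<open>sup_norm * K_real\<close> bounds the maximum over the coarsest
  net, and \<open>4 * K_real\<close> bounds the sum over all links.\<close>

definition sup_constant :: real where
  "sup_constant = (7 * real d) ^ d / lower * (sup_norm * K_real + 4 * K_real)"

lemma sup_constant_nonneg: "0 \<le> sup_constant"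
  unfolding sup_constant_def using lower(1) sup_norm_nonneg K_real(1) by auto

lemma Lp_le_sup_normed_deviation:
  assumes n: "n > d" and sep: "separable_field M w (\<phi> n)" and p: "p \<in> exponents"
  shows "Lp_le (completion M) p (sup_constant * tau_real p) (sup_field (\<phi> n))"
proof -
  interpret E: entropy_chaining w M exponents tau_real "(7 * real d) ^ d" sup_norm lower level_entropy "\<phi> n"
    by (rule entropy_chaining_normed_deviation[OF n])
  have "E.rest 0 \<le> 4 * K_real" using level_entropy_sum(2) by (simp add: E.rest_def)
  then have "sup_norm * level_entropy 0 + E.rest 0 \<le> sup_norm * K_real + 4 * K_real"
    using level_entropy_0_le sup_norm_nonneg by (intro add_mono mult_left_mono)
  moreover have "0 \<le> (7 * real d) ^ d * (tau_real p / lower)" using tau_pos[OF p] lower(1) by simp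
  ultimately have "(7 * real d) ^ d * (tau_real p / lower) * (sup_norm * level_entropy 0 + E.rest 0)
      \<le> (7 * real d) ^ d * (tau_real p / lower) * (sup_norm * K_real + 4 * K_real)"
    by (rule mult_left_mono)
  also have "\<dots> = sup_constant * tau_real p" by (simp add: sup_constant_def)
  finally show ?thesis
    by (rule Lp_le_mono[OF E.Lp_le_sup_field[OF sep p]]) (use p in \<open>simp add: exponents_def\<close>)
qed

text \<open>The tail constant may be any positive number not below \<open>sup_constant\<close>,
  since enlarging it only weakens the moment bounds from which the tail is derived.\<close>

lemma normed_deviation_conclusion:
  assumes sep: "\<And>n. n > d \<Longrightarrow> separable_field M w (\<phi> n)" and C2: "C2 \<ge> sup_constant" "C2 > 0"
  shows "(\<forall>n>d. AE \<omega> in M. continuous_map (semi_topology w) euclideanreal (\<phi> n \<omega>)) \<and>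
        (\<forall>n>d. path_map w (\<phi> n) \<in> completion M \<rightarrow>\<^sub>M borel_on (C_space w)) \<and>
        weakly_compact_family (C_space w) {law_on_C M w (\<phi> n) | n. n > d} \<and>
        (\<forall>n>d. sup_field (\<phi> n) \<in> borel_measurable (completion M)) \<and>
        (SUP n\<in>{d<..}. gls_norm (completion M) b (tau d b \<psi>) (sup_field (\<phi> n))) \<le> ennreal sup_constant \<and>
        0 < C2 \<and>
        (\<forall>y > C2 * exp 1.
          ereal (SUP n\<in>{d<..}. tail (completion M) (sup_field (\<phi> n)) y)
            \<le> exp_ereal (- young_fenchel (nu b (tau d b \<psi>)) (ln (y / C2))))"
proof (intro conjI allI impI C2(2))
  fix n assume n: "n > d"
  interpret E: entropy_chaining w M exponents tau_real "(7 * real d) ^ d" sup_norm lower level_entropy "\<phi> n"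
    by (rule entropy_chaining_normed_deviation[OF n])
  show cont: "AE \<omega> in M. continuous_map (semi_topology w) euclideanreal (\<phi> n \<omega>)"
    by (rule E.AE_continuous[OF sep[OF n]])
  show "path_map w (\<phi> n) \<in> completion M \<rightarrow>\<^sub>M borel_on (C_space w)"
    by (rule measurable_path_map[OF E.measurable_X cont])
  show "sup_field (\<phi> n) \<in> borel_measurable (completion M)"
    by (rule measurable_sup_field[OF E.measurable_X cont])
next
  have "weakly_compact_family (C_space w) {law_on_C M w (\<phi> n) | n. n \<in> {d<..}}"
    by (rule weakly_compact_laws[OF entropy_chaining_normed_deviation sep]) auto
  then show "weakly_compact_family (C_space w) {law_on_C M w (\<phi> n) | n. n > d}" by simp
next
  show "(SUP n\<in>{d<..}. gls_norm (completion M) b (tau d b \<psi>) (sup_field (\<phi> n))) \<le> ennreal sup_constant"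
  proof (rule SUP_least)
    fix n assume "n \<in> {d<..}"
    then show "gls_norm (completion M) b (tau d b \<psi>) (sup_field (\<phi> n)) \<le> ennreal sup_constant"
      by (intro gls_norm_leI[where g = tau_real] Lp_le_sup_normed_deviation sep tau_eq tau_pos sup_constant_nonneg)
        (auto intro: exponents_dom2)
  qed
next
  fix y assume y: "y > C2 * exp 1"
  then have y0: "y > 0" using C2(2) by (meson less_trans mult_pos_pos exp_gt_zero)
  interpret C: prob_space "completion M" by (rule prob_space_completion)
  show "ereal (SUP n\<in>{d<..}. tail (completion M) (sup_field (\<phi> n)) y)
      \<le> exp_ereal (- young_fenchel (nu b (tau d b \<psi>)) (ln (y / C2)))"
  proof (rule le_exp_young_fenchel[OF y0 C2(2)])
    fix p assume p: "p \<in> exponents"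
    show "(SUP n\<in>{d<..}. tail (completion M) (sup_field (\<phi> n)) y) \<le> (C2 * tau_real p / y) powr p"
    proof (rule cSUP_least)
      fix n assume "n \<in> {d<..}"
      then have n: "n > d" by simp
      have p0: "p > 0" using p by (simp add: exponents_def)
      have "Lp_le (completion M) p (C2 * tau_real p) (sup_field (\<phi> n))"
        by (rule Lp_le_mono[OF Lp_le_sup_normed_deviation[OF n sep[OF n] p]])
          (use C2 tau_pos[OF p] p0 in auto)
      from C.tail_le[OF this p0 y0] show "tail (completion M) (sup_field (\<phi> n)) y \<le> (C2 * tau_real p / y) powr p" .
    qed auto
  qed
qed

end

end

theorem theorem3p1:
  fixes d :: nat and b :: ereal and \<psi> :: "real \<Rightarrow> ennreal"
  assumes "d \<ge> 1" and "2 < b" and "\<psi> \<in> Psi b"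
  shows "\<exists>C C2 :: ennreal \<Rightarrow> ('t \<Rightarrow> 't \<Rightarrow> real) \<Rightarrow> (real \<Rightarrow> ennreal) \<Rightarrow> ennreal \<Rightarrow> real \<Rightarrow> real.
    \<forall>(M :: 'a measure) (S :: 'x measure) \<xi> (\<Phi> :: (nat \<Rightarrow> 'x) \<Rightarrow> 't \<Rightarrow> real) r.
     let \<sigma> = (SUP t. gls_norm M b \<psi> (kernel_var \<xi> d (\<lambda>x. \<Phi> x t)));
         w = kernel_dist M \<xi> d b \<psi> \<Phi>;
         \<tau> = tau d b \<psi>;
         K = entropy_integral b \<tau> w;
         \<phi> = normed_deviation M \<xi> d \<Phi> r
     in
      prob_space M \<longrightarrow>
      iid_sequence M S \<xi> \<longrightarrow>
      (\<forall>t. measurable_symmetric_kernel d S (\<lambda>x. \<Phi> x t)) \<longrightarrow>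
      (\<forall>t. 0 < var_of M (kernel_var \<xi> d (\<lambda>x. \<Phi> x t))) \<longrightarrow>
      (\<forall>t. hoeffding_rank M \<xi> d (\<lambda>x. \<Phi> x t) = r) \<longrightarrow>
      (\<forall>t. (\<integral>\<omega>. kernel_var \<xi> d (\<lambda>x. \<Phi> x t) \<omega> \<partial>M) = 0) \<longrightarrow>
      \<sigma> < \<infinity> \<longrightarrow>
      compact_space (semi_topology w) \<longrightarrow>
      (\<forall>n>d. separable_field M w (\<phi> n)) \<longrightarrow>
      K < \<infinity> \<longrightarrow>
        (\<forall>n>d. AE \<omega> in M. continuous_map (semi_topology w) euclideanreal (\<phi> n \<omega>)) \<and>
        (\<forall>n>d. path_map w (\<phi> n) \<in> completion M \<rightarrow>\<^sub>M borel_on (C_space w)) \<and>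
        weakly_compact_family (C_space w) {law_on_C M w (\<phi> n) | n. n > d} \<and>
        (\<forall>n>d. sup_field (\<phi> n) \<in> borel_measurable (completion M)) \<and>
        (SUP n\<in>{d<..}. gls_norm (completion M) b \<tau> (sup_field (\<phi> n)))
          \<le> ennreal (C \<sigma> w \<tau> K (diam w)) \<and>
        0 < C2 \<sigma> w \<tau> K (diam w) \<and>
        (\<forall>y > C2 \<sigma> w \<tau> K (diam w) * exp 1.
          ereal (SUP n\<in>{d<..}. tail (completion M) (sup_field (\<phi> n)) y)
            \<le> exp_ereal (- young_fenchel (nu b \<tau>) (ln (y / C2 \<sigma> w \<tau> K (diam w)))))"
proof -
  interpret grand_lebesgue d b \<psi> by (unfold_locales) (use assms in auto)
  \<comment> \<open>This is \<open>sup_constant\<close> as a function of the kernel norm and the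
    entropy integral; \<open>d\<close> and \<open>lower\<close> belong to the data fixed
    beforehand.\<close>
  define C :: "ennreal \<Rightarrow> ('t \<Rightarrow> 't \<Rightarrow> real) \<Rightarrow> (real \<Rightarrow> ennreal) \<Rightarrow> ennreal \<Rightarrow> real \<Rightarrow> real"
    where "C = (\<lambda>\<sigma> _ _ K _. (7 * real d) ^ d / lower * (enn2real \<sigma> * enn2real K + 4 * enn2real K))"
  \<comment> \<open>The maximum with 1 makes positivity immediate, as the logarithm of
    \<open>y / C2\<close> requires.\<close>
  define C2 :: "ennreal \<Rightarrow> ('t \<Rightarrow> 't \<Rightarrow> real) \<Rightarrow> (real \<Rightarrow> ennreal) \<Rightarrow> ennreal \<Rightarrow> real \<Rightarrow> real"
    where "C2 = (\<lambda>\<sigma> w \<tau> K D. max 1 (C \<sigma> w \<tau> K D))"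
  show ?thesis
    unfolding Let_def
  proof (rule exI[of _ C], rule exI[of _ C2], intro allI impI)
    fix M :: "'a measure" and S :: "'x measure" and \<xi> and \<Phi> :: "(nat \<Rightarrow> 'x) \<Rightarrow> 't \<Rightarrow> real" and r
    let ?\<sigma> = "SUP t. gls_norm M b \<psi> (kernel_var \<xi> d (\<lambda>x. \<Phi> x t))"
    let ?w = "kernel_dist M \<xi> d b \<psi> \<Phi>"
    let ?K = "entropy_integral b (tau d b \<psi>) ?w"
    assume M: "prob_space M" and iid: "iid_sequence M S \<xi>"
      and ker: "\<forall>t. measurable_symmetric_kernel d S (\<lambda>x. \<Phi> x t)"
      and var: "\<forall>t. 0 < var_of M (kernel_var \<xi> d (\<lambda>x. \<Phi> x t))"
      and rank: "\<forall>t. hoeffding_rank M \<xi> d (\<lambda>x. \<Phi> x t) = r"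
      and mean: "\<forall>t. (\<integral>\<omega>. kernel_var \<xi> d (\<lambda>x. \<Phi> x t) \<omega> \<partial>M) = 0"
      and \<sigma>: "?\<sigma> < \<infinity>" and compact: "compact_space (semi_topology ?w)"
      and sep: "\<forall>n>d. separable_field M ?w (normed_deviation M \<xi> d \<Phi> r n)" and K: "?K < \<infinity>"
    interpret prob_space M by (rule M)
    interpret U_statistic_field d b \<psi> M S \<xi> \<Phi> r
      using iid ker var rank mean \<sigma> by unfold_locales auto
    have C: "sup_constant = C ?\<sigma> ?w (tau d b \<psi>) ?K (diam ?w)"
      by (simp only: sup_constant_def[OF compact K] C_def K_real_def[OF compact K] sup_norm_def)
    show "(\<forall>n>d. AE \<omega> in M. continuous_map (semi_topology ?w) euclideanreal (normed_deviation M \<xi> d \<Phi> r n \<omega>)) \<and>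
        (\<forall>n>d. path_map ?w (normed_deviation M \<xi> d \<Phi> r n) \<in> completion M \<rightarrow>\<^sub>M borel_on (C_space ?w)) \<and>
        weakly_compact_family (C_space ?w) {law_on_C M ?w (normed_deviation M \<xi> d \<Phi> r n) | n. n > d} \<and>
        (\<forall>n>d. sup_field (normed_deviation M \<xi> d \<Phi> r n) \<in> borel_measurable (completion M)) \<and>
        (SUP n\<in>{d<..}. gls_norm (completion M) b (tau d b \<psi>) (sup_field (normed_deviation M \<xi> d \<Phi> r n)))
          \<le> ennreal (C ?\<sigma> ?w (tau d b \<psi>) ?K (diam ?w)) \<and>
        0 < C2 ?\<sigma> ?w (tau d b \<psi>) ?K (diam ?w) \<and>
        (\<forall>y > C2 ?\<sigma> ?w (tau d b \<psi>) ?K (diam ?w) * exp 1.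
          ereal (SUP n\<in>{d<..}. tail (completion M) (sup_field (normed_deviation M \<xi> d \<Phi> r n)) y)
            \<le> exp_ereal (- young_fenchel (nu b (tau d b \<psi>)) (ln (y / C2 ?\<sigma> ?w (tau d b \<psi>) ?K (diam ?w)))))"
      unfolding C[symmetric]
      by (rule normed_deviation_conclusion[OF compact K]) (use sep in \<open>auto simp: C2_def C\<close>)
  qed
qed

end
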